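(* The category $\mathrm{CrysMo}$ is (isomorphic to) the $\Bbbk$-linear monoidal category generated by a single object $B$ and the generating morphisms (besides the identity $\mathrm{id}$ of $B$) $$\eta:\mathbb 1\to B,\qquad\theta:B\to\mathbb 1,\qquad u:\mathbb 1\to B\otimes B,\qquad c:B\otimes B\to\mathbb 1$$ (top dot, bottom dot, cup, cap), where $\mathbb 1$ is the monoidal unit, subject to the relations (M.1) $(\mathrm{id}\otimes c)(u\otimes\mathrm{id})=0=(c\otimes\mathrm{id})(\mathrm{id}\otimes u)$, (M.2) $c(\eta\otimes\mathrm{id})=0=c(\mathrm{id}\otimes\eta)$, and the vertical reflections $(\theta\otimes\mathrm{id})u=0=(\mathrm{id}\otimes\theta)u$, (M.3) $c\,u=1=\theta\,\eta$.
   Context: $\Bbbk$ is a field. $\mathfrak{sl}_2$-Crys is the (strictified) $\Bbbk$-linear monoidal category whose objects are finite direct sums (disjoint unions) of the highest weight crystals $B(k\omega_1)$, $k\ge0$, of $\mathfrak{sl}_2$, with morphisms $\Bbbk$-linear combinations of strict crystal morphisms (maps $B\sqcup\{0\}\to C\sqcup\{0\}$ with $0\mapsto0$, preserving weights and commuting with the Kashiwara operators $e,f$), viewed as linear maps between $\Bbbk$-spans. Tensor product: $e(b\otimes c)=eb\otimes c$ if $\varphi(b)\ge\varepsilon(c)$, else $b\otimes ec$; $f(b\otimes c)=fb\otimes c$ if $\varphi(b)>\varepsilon(c)$, else $b\otimes fc$, where $\varepsilon(b)=\max\{m:e^mb\ne0\}$, $\varphi(b)=\max\{m:f^mb\ne0\}$.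 $\mathrm{CrysMo}$ (the Motzkin crystal category) is the full monoidal subcategory of $\mathfrak{sl}_2$-Crys whose objects are the tensor powers (including $\mathbb 1$) of the crystal $B=B(\omega_1)\oplus B(0)$. Juxtaposition denotes composition. *)

theory Defs
  imports Complex_Main "HOL-Library.Function_Algebras"
begin

section \<open>Strict linear monoidal categories\<close>

text \<open>
  Composition and the tensor product of morphisms are total operations on the type of
  morphisms; only their values on (composable) elements of the hom-sets matter.
  \<open>Comp C g f\<close> is the composite ``f, then g'', written \<open>g f\<close> by juxtaposition.
\<close>

record ('o, 'm, 'k) linear_monoidal =
  Obj :: "'o set"
  Hom :: "'o \<Rightarrow> 'o \<Rightarrow> 'm set"
  Ident :: "'o \<Rightarrow> 'm"
  Comp :: "'m \<Rightarrow> 'm \<Rightarrow> 'm"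
  Unit :: "'o"
  TensO :: "'o \<Rightarrow> 'o \<Rightarrow> 'o"
  TensM :: "'m \<Rightarrow> 'm \<Rightarrow> 'm"
  Zero :: "'o \<Rightarrow> 'o \<Rightarrow> 'm"
  Add :: "'m \<Rightarrow> 'm \<Rightarrow> 'm"
  Scale :: "'k \<Rightarrow> 'm \<Rightarrow> 'm"

locale strict_linear_monoidal_category =
  fixes C :: "('o, 'm, 'k::field) linear_monoidal"
  assumes Ident_in: "x \<in> Obj C \<Longrightarrow> Ident C x \<in> Hom C x x"
    and Comp_in: "\<lbrakk>x \<in> Obj C; y \<in> Obj C; z \<in> Obj C; f \<in> Hom C x y; g \<in> Hom C y z\<rbrakk>
      \<Longrightarrow> Comp C g f \<in> Hom C x z"
    and Comp_assoc: "\<lbrakk>w \<in> Obj C; x \<in> Obj C; y \<in> Obj C; z \<in> Obj C;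
        f \<in> Hom C w x; g \<in> Hom C x y; h \<in> Hom C y z\<rbrakk>
      \<Longrightarrow> Comp C (Comp C h g) f = Comp C h (Comp C g f)"
    and Comp_Ident: "\<lbrakk>x \<in> Obj C; y \<in> Obj C; f \<in> Hom C x y\<rbrakk> \<Longrightarrow> Comp C f (Ident C x) = f"
    and Ident_Comp: "\<lbrakk>x \<in> Obj C; y \<in> Obj C; f \<in> Hom C x y\<rbrakk> \<Longrightarrow> Comp C (Ident C y) f = f"
    and Unit_in: "Unit C \<in> Obj C"
    and TensO_in: "\<lbrakk>x \<in> Obj C; y \<in> Obj C\<rbrakk> \<Longrightarrow> TensO C x y \<in> Obj C"
    and TensO_assoc: "\<lbrakk>x \<in> Obj C; y \<in> Obj C; z \<in> Obj C\<rbrakk>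
      \<Longrightarrow> TensO C (TensO C x y) z = TensO C x (TensO C y z)"
    and TensO_Unit: "x \<in> Obj C \<Longrightarrow> TensO C x (Unit C) = x"
    and Unit_TensO: "x \<in> Obj C \<Longrightarrow> TensO C (Unit C) x = x"
    and TensM_in: "\<lbrakk>x \<in> Obj C; y \<in> Obj C; x' \<in> Obj C; y' \<in> Obj C; f \<in> Hom C x y; g \<in> Hom C x' y'\<rbrakk>
      \<Longrightarrow> TensM C f g \<in> Hom C (TensO C x x') (TensO C y y')"
    and TensM_assoc: "\<lbrakk>x \<in> Obj C; y \<in> Obj C; x' \<in> Obj C; y' \<in> Obj C; x'' \<in> Obj C; y'' \<in> Obj C;
        f \<in> Hom C x y; g \<in> Hom C x' y'; h \<in> Hom C x'' y''\<rbrakk>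
      \<Longrightarrow> TensM C (TensM C f g) h = TensM C f (TensM C g h)"
    and TensM_Unit: "\<lbrakk>x \<in> Obj C; y \<in> Obj C; f \<in> Hom C x y\<rbrakk>
      \<Longrightarrow> TensM C f (Ident C (Unit C)) = f"
    and Unit_TensM: "\<lbrakk>x \<in> Obj C; y \<in> Obj C; f \<in> Hom C x y\<rbrakk>
      \<Longrightarrow> TensM C (Ident C (Unit C)) f = f"
    and TensM_Ident: "\<lbrakk>x \<in> Obj C; y \<in> Obj C\<rbrakk>
      \<Longrightarrow> TensM C (Ident C x) (Ident C y) = Ident C (TensO C x y)"
    and interchange: "\<lbrakk>x \<in> Obj C; y \<in> Obj C; z \<in> Obj C; x' \<in> Obj C; y' \<in> Obj C; z' \<in> Obj C;
        f \<in> Hom C x y; g \<in> Hom C y z; f' \<in> Hom C x' y'; g' \<in> Hom C y' z'\<rbrakk>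
      \<Longrightarrow> TensM C (Comp C g f) (Comp C g' f') = Comp C (TensM C g g') (TensM C f f')"
    and Zero_in: "\<lbrakk>x \<in> Obj C; y \<in> Obj C\<rbrakk> \<Longrightarrow> Zero C x y \<in> Hom C x y"
    and Add_in: "\<lbrakk>x \<in> Obj C; y \<in> Obj C; f \<in> Hom C x y; g \<in> Hom C x y\<rbrakk> \<Longrightarrow> Add C f g \<in> Hom C x y"
    and Scale_in: "\<lbrakk>x \<in> Obj C; y \<in> Obj C; f \<in> Hom C x y\<rbrakk> \<Longrightarrow> Scale C a f \<in> Hom C x y"
    and Add_assoc: "\<lbrakk>x \<in> Obj C; y \<in> Obj C; f \<in> Hom C x y; g \<in> Hom C x y; h \<in> Hom C x y\<rbrakk>
      \<Longrightarrow> Add C (Add C f g) h = Add C f (Add C g h)"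
    and Add_commute: "\<lbrakk>x \<in> Obj C; y \<in> Obj C; f \<in> Hom C x y; g \<in> Hom C x y\<rbrakk>
      \<Longrightarrow> Add C f g = Add C g f"
    and Add_Zero: "\<lbrakk>x \<in> Obj C; y \<in> Obj C; f \<in> Hom C x y\<rbrakk> \<Longrightarrow> Add C f (Zero C x y) = f"
    and Add_minus: "\<lbrakk>x \<in> Obj C; y \<in> Obj C; f \<in> Hom C x y\<rbrakk>
      \<Longrightarrow> Add C f (Scale C (- 1) f) = Zero C x y"
    and Scale_one: "\<lbrakk>x \<in> Obj C; y \<in> Obj C; f \<in> Hom C x y\<rbrakk> \<Longrightarrow> Scale C 1 f = f"
    and Scale_Scale: "\<lbrakk>x \<in> Obj C; y \<in> Obj C; f \<in> Hom C x y\<rbrakk>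
      \<Longrightarrow> Scale C a (Scale C b f) = Scale C (a * b) f"
    and Scale_add: "\<lbrakk>x \<in> Obj C; y \<in> Obj C; f \<in> Hom C x y\<rbrakk>
      \<Longrightarrow> Scale C (a + b) f = Add C (Scale C a f) (Scale C b f)"
    and Scale_Add: "\<lbrakk>x \<in> Obj C; y \<in> Obj C; f \<in> Hom C x y; g \<in> Hom C x y\<rbrakk>
      \<Longrightarrow> Scale C a (Add C f g) = Add C (Scale C a f) (Scale C a g)"
    and Comp_Add_left: "\<lbrakk>x \<in> Obj C; y \<in> Obj C; z \<in> Obj C; f \<in> Hom C x y; g \<in> Hom C y z; g' \<in> Hom C y z\<rbrakk>
      \<Longrightarrow> Comp C (Add C g g') f = Add C (Comp C g f) (Comp C g' f)"
    and Comp_Add_right: "\<lbrakk>x \<in> Obj C; y \<in> Obj C; z \<in> Obj C; f \<in> Hom C x y; f' \<in> Hom C x y; g \<in> Hom C y z\<rbrakk>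
      \<Longrightarrow> Comp C g (Add C f f') = Add C (Comp C g f) (Comp C g f')"
    and Comp_Scale_left: "\<lbrakk>x \<in> Obj C; y \<in> Obj C; z \<in> Obj C; f \<in> Hom C x y; g \<in> Hom C y z\<rbrakk>
      \<Longrightarrow> Comp C (Scale C a g) f = Scale C a (Comp C g f)"
    and Comp_Scale_right: "\<lbrakk>x \<in> Obj C; y \<in> Obj C; z \<in> Obj C; f \<in> Hom C x y; g \<in> Hom C y z\<rbrakk>
      \<Longrightarrow> Comp C g (Scale C a f) = Scale C a (Comp C g f)"
    and TensM_Add_left: "\<lbrakk>x \<in> Obj C; y \<in> Obj C; x' \<in> Obj C; y' \<in> Obj C;
        f \<in> Hom C x y; f' \<in> Hom C x y; g \<in> Hom C x' y'\<rbrakk>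
      \<Longrightarrow> TensM C (Add C f f') g = Add C (TensM C f g) (TensM C f' g)"
    and TensM_Add_right: "\<lbrakk>x \<in> Obj C; y \<in> Obj C; x' \<in> Obj C; y' \<in> Obj C;
        f \<in> Hom C x y; g \<in> Hom C x' y'; g' \<in> Hom C x' y'\<rbrakk>
      \<Longrightarrow> TensM C f (Add C g g') = Add C (TensM C f g) (TensM C f g')"
    and TensM_Scale_left: "\<lbrakk>x \<in> Obj C; y \<in> Obj C; x' \<in> Obj C; y' \<in> Obj C;
        f \<in> Hom C x y; g \<in> Hom C x' y'\<rbrakk>
      \<Longrightarrow> TensM C (Scale C a f) g = Scale C a (TensM C f g)"
    and TensM_Scale_right: "\<lbrakk>x \<in> Obj C; y \<in> Obj C; x' \<in> Obj C; y' \<in> Obj C;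
        f \<in> Hom C x y; g \<in> Hom C x' y'\<rbrakk>
      \<Longrightarrow> TensM C f (Scale C a g) = Scale C a (TensM C f g)"

locale strict_linear_monoidal_isomorphism =
  C: strict_linear_monoidal_category C + D: strict_linear_monoidal_category D
  for C :: "('o, 'm, 'k::field) linear_monoidal"
    and D :: "('p, 'n, 'k) linear_monoidal" +
  fixes Fo :: "'o \<Rightarrow> 'p" and Fm :: "'m \<Rightarrow> 'n"
  assumes bij_Obj: "bij_betw Fo (Obj C) (Obj D)"
    and bij_Hom: "\<lbrakk>x \<in> Obj C; y \<in> Obj C\<rbrakk> \<Longrightarrow> bij_betw Fm (Hom C x y) (Hom D (Fo x) (Fo y))"
    and map_Ident: "x \<in> Obj C \<Longrightarrow> Fm (Ident C x) = Ident D (Fo x)"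
    and map_Comp: "\<lbrakk>x \<in> Obj C; y \<in> Obj C; z \<in> Obj C; f \<in> Hom C x y; g \<in> Hom C y z\<rbrakk>
      \<Longrightarrow> Fm (Comp C g f) = Comp D (Fm g) (Fm f)"
    and map_Unit: "Fo (Unit C) = Unit D"
    and map_TensO: "\<lbrakk>x \<in> Obj C; y \<in> Obj C\<rbrakk> \<Longrightarrow> Fo (TensO C x y) = TensO D (Fo x) (Fo y)"
    and map_TensM: "\<lbrakk>x \<in> Obj C; y \<in> Obj C; x' \<in> Obj C; y' \<in> Obj C; f \<in> Hom C x y; g \<in> Hom C x' y'\<rbrakk>
      \<Longrightarrow> Fm (TensM C f g) = TensM D (Fm f) (Fm g)"
    and map_Add: "\<lbrakk>x \<in> Obj C; y \<in> Obj C; f \<in> Hom C x y; g \<in> Hom C x y\<rbrakk>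
      \<Longrightarrow> Fm (Add C f g) = Add D (Fm f) (Fm g)"
    and map_Scale: "\<lbrakk>x \<in> Obj C; y \<in> Obj C; f \<in> Hom C x y\<rbrakk>
      \<Longrightarrow> Fm (Scale C a f) = Scale D a (Fm f)"

definition tensor_power :: "('o, 'm, 'k) linear_monoidal \<Rightarrow> 'o \<Rightarrow> nat \<Rightarrow> 'o" where
  "tensor_power C x n = (TensO C x ^^ n) (Unit C)"

definition full_on :: "('o, 'm, 'k) linear_monoidal \<Rightarrow> 'o set \<Rightarrow> ('o, 'm, 'k) linear_monoidal" where
  "full_on C S = C\<lparr>Obj := S\<rparr>"


section \<open>Presentations by generators and relations\<close>

text \<open>
  Objects of the presented category are words in the generating objects \<open>'o\<close>; a generating
  morphism \<open>g\<close> goes from \<open>gdom g\<close> to \<open>gcod g\<close>.  Morphisms are formal expressions modulo the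
  least congruence that contains the relations and the axioms of a strict linear monoidal category.
\<close>

datatype ('k, 'o, 'g) mterm =
    TGen 'g
  | TId "'o list"
  | TComp "('k, 'o, 'g) mterm" "('k, 'o, 'g) mterm"  (infixr \<open>\<cdot>\<close> 70)
  | TTens "('k, 'o, 'g) mterm" "('k, 'o, 'g) mterm"  (infixr \<open>\<otimes>\<close> 75)
  | TZero "'o list" "'o list"
  | TAdd "('k, 'o, 'g) mterm" "('k, 'o, 'g) mterm"
  | TScale 'k "('k, 'o, 'g) mterm"

inductive has_type :: "('g \<Rightarrow> 'o list) \<Rightarrow> ('g \<Rightarrow> 'o list) \<Rightarrow>
    'o list \<Rightarrow> 'o list \<Rightarrow> ('k, 'o, 'g) mterm \<Rightarrow> bool"
  for gdom gcod :: "'g \<Rightarrow> 'o list" where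
  Gen: "has_type gdom gcod (gdom g) (gcod g) (TGen g)"
| Id: "has_type gdom gcod x x (TId x)"
| Comp: "has_type gdom gcod x y f \<Longrightarrow> has_type gdom gcod y z g \<Longrightarrow> has_type gdom gcod x z (g \<cdot> f)"
| Tens: "has_type gdom gcod x y f \<Longrightarrow> has_type gdom gcod x' y' g
    \<Longrightarrow> has_type gdom gcod (x @ x') (y @ y') (f \<otimes> g)"
| Zero: "has_type gdom gcod x y (TZero x y)"
| Add: "has_type gdom gcod x y f \<Longrightarrow> has_type gdom gcod x y g \<Longrightarrow> has_type gdom gcod x y (TAdd f g)"
| Scale: "has_type gdom gcod x y f \<Longrightarrow> has_type gdom gcod x y (TScale a f)"

inductive term_eq :: "('g \<Rightarrow> 'o list) \<Rightarrow> ('g \<Rightarrow> 'o list) \<Rightarrow>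
    (('k::field, 'o, 'g) mterm \<times> ('k, 'o, 'g) mterm) set \<Rightarrow>
    'o list \<Rightarrow> 'o list \<Rightarrow> ('k, 'o, 'g) mterm \<Rightarrow> ('k, 'o, 'g) mterm \<Rightarrow> bool"
  for gdom gcod :: "'g \<Rightarrow> 'o list" and R :: "(('k, 'o, 'g) mterm \<times> ('k, 'o, 'g) mterm) set" where
  rel: "\<lbrakk>(f, g) \<in> R; has_type gdom gcod x y f; has_type gdom gcod x y g\<rbrakk>
    \<Longrightarrow> term_eq gdom gcod R x y f g"
| refl: "has_type gdom gcod x y f \<Longrightarrow> term_eq gdom gcod R x y f f"
| sym: "term_eq gdom gcod R x y f g \<Longrightarrow> term_eq gdom gcod R x y g f"
| trans: "\<lbrakk>term_eq gdom gcod R x y f g; term_eq gdom gcod R x y g h\<rbrakk>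
    \<Longrightarrow> term_eq gdom gcod R x y f h"
| cong_comp: "\<lbrakk>term_eq gdom gcod R x y f f'; term_eq gdom gcod R y z g g'\<rbrakk>
    \<Longrightarrow> term_eq gdom gcod R x z (g \<cdot> f) (g' \<cdot> f')"
| cong_tens: "\<lbrakk>term_eq gdom gcod R x y f f'; term_eq gdom gcod R x' y' g g'\<rbrakk>
    \<Longrightarrow> term_eq gdom gcod R (x @ x') (y @ y') (f \<otimes> g) (f' \<otimes> g')"
| cong_add: "\<lbrakk>term_eq gdom gcod R x y f f'; term_eq gdom gcod R x y g g'\<rbrakk>
    \<Longrightarrow> term_eq gdom gcod R x y (TAdd f g) (TAdd f' g')"
| cong_scale: "term_eq gdom gcod R x y f f' \<Longrightarrow> term_eq gdom gcod R x y (TScale a f) (TScale a f')"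
| comp_assoc: "\<lbrakk>has_type gdom gcod w x f; has_type gdom gcod x y g; has_type gdom gcod y z h\<rbrakk>
    \<Longrightarrow> term_eq gdom gcod R w z ((h \<cdot> g) \<cdot> f) (h \<cdot> (g \<cdot> f))"
| comp_id: "has_type gdom gcod x y f \<Longrightarrow> term_eq gdom gcod R x y (f \<cdot> TId x) f"
| id_comp: "has_type gdom gcod x y f \<Longrightarrow> term_eq gdom gcod R x y (TId y \<cdot> f) f"
| tens_assoc: "\<lbrakk>has_type gdom gcod x y f; has_type gdom gcod x' y' g; has_type gdom gcod x'' y'' h\<rbrakk>
    \<Longrightarrow> term_eq gdom gcod R (x @ x' @ x'') (y @ y' @ y'') ((f \<otimes> g) \<otimes> h) (f \<otimes> (g \<otimes> h))"
| tens_unit: "has_type gdom gcod x y f \<Longrightarrow> term_eq gdom gcod R x y (f \<otimes> TId []) f"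
| unit_tens: "has_type gdom gcod x y f \<Longrightarrow> term_eq gdom gcod R x y (TId [] \<otimes> f) f"
| tens_id: "term_eq gdom gcod R (x @ y) (x @ y) (TId x \<otimes> TId y) (TId (x @ y))"
| interchange: "\<lbrakk>has_type gdom gcod x y f; has_type gdom gcod y z g;
      has_type gdom gcod x' y' f'; has_type gdom gcod y' z' g'\<rbrakk>
    \<Longrightarrow> term_eq gdom gcod R (x @ x') (z @ z') ((g \<cdot> f) \<otimes> (g' \<cdot> f')) ((g \<otimes> g') \<cdot> (f \<otimes> f'))"
| add_assoc: "\<lbrakk>has_type gdom gcod x y f; has_type gdom gcod x y g; has_type gdom gcod x y h\<rbrakk>
    \<Longrightarrow> term_eq gdom gcod R x y (TAdd (TAdd f g) h) (TAdd f (TAdd g h))"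
| add_commute: "\<lbrakk>has_type gdom gcod x y f; has_type gdom gcod x y g\<rbrakk>
    \<Longrightarrow> term_eq gdom gcod R x y (TAdd f g) (TAdd g f)"
| add_zero: "has_type gdom gcod x y f \<Longrightarrow> term_eq gdom gcod R x y (TAdd f (TZero x y)) f"
| add_minus: "has_type gdom gcod x y f
    \<Longrightarrow> term_eq gdom gcod R x y (TAdd f (TScale (- 1) f)) (TZero x y)"
| scale_one: "has_type gdom gcod x y f \<Longrightarrow> term_eq gdom gcod R x y (TScale 1 f) f"
| scale_scale: "has_type gdom gcod x y f
    \<Longrightarrow> term_eq gdom gcod R x y (TScale a (TScale b f)) (TScale (a * b) f)"
| scale_plus: "has_type gdom gcod x y f
    \<Longrightarrow> term_eq gdom gcod R x y (TScale (a + b) f) (TAdd (TScale a f) (TScale b f))"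
| scale_add: "\<lbrakk>has_type gdom gcod x y f; has_type gdom gcod x y g\<rbrakk>
    \<Longrightarrow> term_eq gdom gcod R x y (TScale a (TAdd f g)) (TAdd (TScale a f) (TScale a g))"
| comp_add_left: "\<lbrakk>has_type gdom gcod x y f; has_type gdom gcod y z g; has_type gdom gcod y z g'\<rbrakk>
    \<Longrightarrow> term_eq gdom gcod R x z (TAdd g g' \<cdot> f) (TAdd (g \<cdot> f) (g' \<cdot> f))"
| comp_add_right: "\<lbrakk>has_type gdom gcod x y f; has_type gdom gcod x y f'; has_type gdom gcod y z g\<rbrakk>
    \<Longrightarrow> term_eq gdom gcod R x z (g \<cdot> TAdd f f') (TAdd (g \<cdot> f) (g \<cdot> f'))"
| comp_scale_left: "\<lbrakk>has_type gdom gcod x y f; has_type gdom gcod y z g\<rbrakk>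
    \<Longrightarrow> term_eq gdom gcod R x z (TScale a g \<cdot> f) (TScale a (g \<cdot> f))"
| comp_scale_right: "\<lbrakk>has_type gdom gcod x y f; has_type gdom gcod y z g\<rbrakk>
    \<Longrightarrow> term_eq gdom gcod R x z (g \<cdot> TScale a f) (TScale a (g \<cdot> f))"
| tens_add_left: "\<lbrakk>has_type gdom gcod x y f; has_type gdom gcod x y f'; has_type gdom gcod x' y' g\<rbrakk>
    \<Longrightarrow> term_eq gdom gcod R (x @ x') (y @ y') (TAdd f f' \<otimes> g) (TAdd (f \<otimes> g) (f' \<otimes> g))"
| tens_add_right: "\<lbrakk>has_type gdom gcod x y f; has_type gdom gcod x' y' g; has_type gdom gcod x' y' g'\<rbrakk>
    \<Longrightarrow> term_eq gdom gcod R (x @ x') (y @ y') (f \<otimes> TAdd g g') (TAdd (f \<otimes> g) (f \<otimes> g'))"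
| tens_scale_left: "\<lbrakk>has_type gdom gcod x y f; has_type gdom gcod x' y' g\<rbrakk>
    \<Longrightarrow> term_eq gdom gcod R (x @ x') (y @ y') (TScale a f \<otimes> g) (TScale a (f \<otimes> g))"
| tens_scale_right: "\<lbrakk>has_type gdom gcod x y f; has_type gdom gcod x' y' g\<rbrakk>
    \<Longrightarrow> term_eq gdom gcod R (x @ x') (y @ y') (f \<otimes> TScale a g) (TScale a (f \<otimes> g))"

definition term_class :: "('g \<Rightarrow> 'o list) \<Rightarrow> ('g \<Rightarrow> 'o list) \<Rightarrow>
    (('k::field, 'o, 'g) mterm \<times> ('k, 'o, 'g) mterm) set \<Rightarrow>
    ('k, 'o, 'g) mterm \<Rightarrow> ('k, 'o, 'g) mterm set" where
  "term_class gdom gcod R t = {s. \<exists>x y. term_eq gdom gcod R x y t s}"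

text \<open>
  A well-typed term determines its domain and codomain, so equivalence classes belonging to
  different hom-sets are disjoint.
\<close>

definition presented_category :: "('g \<Rightarrow> 'o list) \<Rightarrow> ('g \<Rightarrow> 'o list) \<Rightarrow>
    (('k::field, 'o, 'g) mterm \<times> ('k, 'o, 'g) mterm) set \<Rightarrow>
    ('o list, ('k, 'o, 'g) mterm set, 'k) linear_monoidal" where
  "presented_category gdom gcod R = (let cls = term_class gdom gcod R in
    \<lparr> Obj = UNIV,
      Hom = (\<lambda>x y. cls ` {t. has_type gdom gcod x y t}),
      Ident = (\<lambda>x. cls (TId x)),
      Comp = (\<lambda>G F. \<Union>g\<in>G. \<Union>f\<in>F. cls (g \<cdot> f)),
      Unit = [],
      TensO = (@),
      TensM = (\<lambda>F G. \<Union>f\<in>F. \<Union>g\<in>G. cls (f \<otimes> g)),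
      Zero = (\<lambda>x y. cls (TZero x y)),
      Add = (\<lambda>F G. \<Union>f\<in>F. \<Union>g\<in>G. cls (TAdd f g)),
      Scale = (\<lambda>a F. \<Union>f\<in>F. cls (TScale a f)) \<rparr>)"


section \<open>Crystals of \<open>sl\<^sub>2\<close>\<close>

text \<open>
  The element \<open>0\<close> adjoined to a crystal is \<open>None\<close>, and the weight \<open>k \<omega>\<^sub>1\<close> is the integer \<open>k\<close>.
\<close>

record 'b crystal =
  elems :: "'b set"
  wt :: "'b \<Rightarrow> int"
  e_op :: "'b \<Rightarrow> 'b option"
  f_op :: "'b \<Rightarrow> 'b option"

definition eps :: "'b crystal \<Rightarrow> 'b \<Rightarrow> nat" where
  "eps C b = Max {m. ((\<lambda>x. Option.bind x (e_op C)) ^^ m) (Some b) \<noteq> None}"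

definition phi :: "'b crystal \<Rightarrow> 'b \<Rightarrow> nat" where
  "phi C b = Max {m. ((\<lambda>x. Option.bind x (f_op C)) ^^ m) (Some b) \<noteq> None}"

text \<open>The highest weight crystal \<open>B(k \<omega>\<^sub>1)\<close>: its element \<open>j\<close> is \<open>f\<^sup>j\<close> of the highest weight element.\<close>

definition hw_crystal :: "nat \<Rightarrow> nat crystal" where
  "hw_crystal k = \<lparr> elems = {..k},
    wt = (\<lambda>j. int k - 2 * int j),
    e_op = (\<lambda>j. if j = 0 then None else Some (j - 1)),
    f_op = (\<lambda>j. if j < k then Some (Suc j) else None) \<rparr>"

definition direct_sum :: "'b crystal list \<Rightarrow> (nat \<times> 'b) crystal" where
  "direct_sum Cs = \<lparr> elems = {(i, b). i < length Cs \<and> b \<in> elems (Cs ! i)},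
    wt = (\<lambda>(i, b). wt (Cs ! i) b),
    e_op = (\<lambda>(i, b). map_option (Pair i) (e_op (Cs ! i) b)),
    f_op = (\<lambda>(i, b). map_option (Pair i) (f_op (Cs ! i) b)) \<rparr>"

definition tensor_crystal :: "'b crystal \<Rightarrow> 'c crystal \<Rightarrow> ('b \<times> 'c) crystal" where
  "tensor_crystal B C = \<lparr> elems = elems B \<times> elems C,
    wt = (\<lambda>(b, c). wt B b + wt C c),
    e_op = (\<lambda>(b, c). if phi B b \<ge> eps C c then map_option (\<lambda>b'. (b', c)) (e_op B b)
                     else map_option (Pair b) (e_op C c)),
    f_op = (\<lambda>(b, c). if phi B b > eps C c then map_option (\<lambda>b'. (b', c)) (f_op B b)
                     else map_option (Pair b) (f_op C c)) \<rparr>"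

definition transport_crystal :: "('b \<Rightarrow> 'c) \<Rightarrow> ('c \<Rightarrow> 'b) \<Rightarrow> 'b crystal \<Rightarrow> 'c crystal" where
  "transport_crystal g g' C = \<lparr> elems = g ` elems C,
    wt = (\<lambda>c. wt C (g' c)),
    e_op = (\<lambda>c. map_option g (e_op C (g' c))),
    f_op = (\<lambda>c. map_option g (f_op C (g' c))) \<rparr>"

text \<open>
  For strictness, the pure tensor \<open>b\<^sub>1 \<otimes> \<dots> \<otimes> b\<^sub>n\<close> is the list \<open>[b\<^sub>1, \<dots>, b\<^sub>n]\<close>.
\<close>

fun tensor_list :: "'b crystal list \<Rightarrow> 'b list crystal" where
  "tensor_list [] = \<lparr> elems = {[]}, wt = (\<lambda>_. 0), e_op = (\<lambda>_. None), f_op = (\<lambda>_. None) \<rparr>"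
| "tensor_list (C # Cs) =
    transport_crystal (\<lambda>(b, bs). b # bs) (\<lambda>bs. (hd bs, tl bs)) (tensor_crystal C (tensor_list Cs))"

definition strict_morphism :: "'b crystal \<Rightarrow> 'c crystal \<Rightarrow> ('b option \<Rightarrow> 'c option) \<Rightarrow> bool" where
  "strict_morphism C D \<psi> \<longleftrightarrow>
    \<psi> None = None \<and>
    (\<forall>b\<in>elems C. \<psi> (Some b) \<in> insert None (Some ` elems D)) \<and>
    (\<forall>b\<in>elems C. \<forall>d. \<psi> (Some b) = Some d \<longrightarrow> wt D d = wt C b) \<and>
    (\<forall>b\<in>elems C. \<psi> (e_op C b) = Option.bind (\<psi> (Some b)) (e_op D)) \<and>
    (\<forall>b\<in>elems C. \<psi> (f_op C b) = Option.bind (\<psi> (Some b)) (f_op D))"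


section \<open>The category of \<open>sl\<^sub>2\<close>-crystals\<close>

text \<open>
  A linear map between the spans of two finite crystals is given by its matrix: \<open>M b d\<close> is the
  coefficient of \<open>d\<close> in the image of the basis vector \<open>b\<close>.  Entries outside the crystals are \<open>0\<close>.
\<close>

definition mat_scale :: "'k::field \<Rightarrow> ('b \<Rightarrow> 'c \<Rightarrow> 'k) \<Rightarrow> 'b \<Rightarrow> 'c \<Rightarrow> 'k" where
  "mat_scale a M = (\<lambda>b d. a * M b d)"

interpretation mat: vector_space mat_scale
  by unfold_locales (auto simp: mat_scale_def fun_eq_iff algebra_simps)

definition linearize :: "'b crystal \<Rightarrow> ('b option \<Rightarrow> 'c option) \<Rightarrow> 'b \<Rightarrow> 'c \<Rightarrow> 'k::field" where
  "linearize C \<psi> = (\<lambda>b d. if b \<in> elems C \<and> \<psi> (Some b) = Some d then 1 else 0)"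

definition crystal_maps :: "'b crystal \<Rightarrow> 'c crystal \<Rightarrow> ('b \<Rightarrow> 'c \<Rightarrow> 'k::field) set" where
  "crystal_maps C D = mat.span {linearize C \<psi> | \<psi>. strict_morphism C D \<psi>}"

text \<open>
  A finite direct sum \<open>B(k\<^sub>1 \<omega>\<^sub>1) \<oplus> \<dots> \<oplus> B(k\<^sub>r \<omega>\<^sub>1)\<close> is encoded by \<open>[k\<^sub>1, \<dots>, k\<^sub>r]\<close>.  As usual for a
  strictification, the objects of the strictified category are words of objects of the original
  one, a word standing for the tensor product of its letters.
\<close>

definition word_crystal :: "nat list list \<Rightarrow> (nat \<times> nat) list crystal" where
  "word_crystal w = tensor_list (map (\<lambda>ks. direct_sum (map hw_crystal ks)) w)"

type_synonym 'k crystal_mor =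
  "nat list list \<times> nat list list \<times> ((nat \<times> nat) list \<Rightarrow> (nat \<times> nat) list \<Rightarrow> 'k)"

definition sl2_Crys :: "(nat list list, 'k::field crystal_mor, 'k) linear_monoidal" where
  "sl2_Crys = \<lparr>
    Obj = UNIV,
    Hom = (\<lambda>v w. {(v, w, M) | M. M \<in> crystal_maps (word_crystal v) (word_crystal w)}),
    Ident = (\<lambda>v. (v, v, \<lambda>b d. if b \<in> elems (word_crystal v) \<and> b = d then 1 else 0)),
    Comp = (\<lambda>(v', w', N) (v, w, M).
      (v, w', \<lambda>b d. \<Sum>c\<in>elems (word_crystal w). M b c * N c d)),
    Unit = [],
    TensO = (@),
    TensM = (\<lambda>(v, w, M) (v', w', N). (v @ v', w @ w',
      \<lambda>b d. M (take (length v) b) (take (length w) d) * N (drop (length v) b) (drop (length w) d))),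
    Zero = (\<lambda>v w. (v, w, 0)),
    Add = (\<lambda>(v, w, M) (v', w', N). (v, w, M + N)),
    Scale = (\<lambda>a (v, w, M). (v, w, mat_scale a M)) \<rparr>"

text \<open>The object \<open>B = B(\<omega>\<^sub>1) \<oplus> B(0)\<close>.\<close>

definition motzkin_B :: "nat list list" where
  "motzkin_B = [[1, 0]]"

definition CrysMo :: "(nat list list, 'k::field crystal_mor, 'k) linear_monoidal" where
  "CrysMo = full_on sl2_Crys
    (range (tensor_power (sl2_Crys :: (_, 'k crystal_mor, 'k) linear_monoidal) motzkin_B))"


section \<open>The presentation\<close>

text \<open>The only generating object is \<open>() :: unit\<close>, and its identity is \<open>TId [()]\<close>.\<close>

datatype mo_gen = Eta | Theta | Cup | Cap

fun mo_dom :: "mo_gen \<Rightarrow> unit list" where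
  "mo_dom Eta = []"
| "mo_dom Theta = [()]"
| "mo_dom Cup = []"
| "mo_dom Cap = [(), ()]"

fun mo_cod :: "mo_gen \<Rightarrow> unit list" where
  "mo_cod Eta = [()]"
| "mo_cod Theta = []"
| "mo_cod Cup = [(), ()]"
| "mo_cod Cap = []"

definition mo_relations :: "(('k::field, unit, mo_gen) mterm \<times> ('k, unit, mo_gen) mterm) set" where
  "mo_relations =
    (let \<eta> = TGen Eta; \<theta> = TGen Theta; u = TGen Cup; c = TGen Cap; \<iota> = TId [()] in
     { ((\<iota> \<otimes> c) \<cdot> (u \<otimes> \<iota>), TZero [()] [()]),
       ((c \<otimes> \<iota>) \<cdot> (\<iota> \<otimes> u), TZero [()] [()]),
       (c \<cdot> (\<eta> \<otimes> \<iota>), TZero [()] []),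
       (c \<cdot> (\<iota> \<otimes> \<eta>), TZero [()] []),
       ((\<theta> \<otimes> \<iota>) \<cdot> u, TZero [] [()]),
       ((\<iota> \<otimes> \<theta>) \<cdot> u, TZero [] [()]),
       (c \<cdot> u, TId []),
       (\<theta> \<cdot> \<eta>, TId []) })"

end

theory Submission
  imports Defs
begin

text \<open>
  Elements of \<open>B\<^sup>\<otimes>\<^sup>n\<close> are words in three letters, and on highest weight words the generators act
  by inserting or deleting a letter of weight \<open>0\<close> or an adjacent pair \<open>b\<^sub>+ b\<^sub>-\<close>.  In the presented
  category let \<open>J\<^sub>k\<close> be the endomorphism of \<open>B\<^sup>\<otimes>\<^sup>k\<close> defined recursively by
  \<open>J\<^sub>k\<^sub>+\<^sub>1 = J\<^sub>k \<otimes> id - J\<^sub>k \<otimes> \<eta>\<theta> - u\<^sub>k J\<^sub>k\<^sub>-\<^sub>1 c\<^sub>k\<close>; it is idempotent and its image under the functor to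
  crystals is the projection onto the component \<open>B(k\<omega>\<^sub>1)\<close>.  Every highest weight word \<open>h\<close> of weight \<open>k\<close>
  and length \<open>n\<close> gives a morphism \<open>v\<^sub>h : B\<^sup>\<otimes>\<^sup>k \<rightarrow> B\<^sup>\<otimes>\<^sup>n\<close> with \<open>v\<^sub>h J\<^sub>k = v\<^sub>h\<close>, and whiskered generators send
  \<open>v\<^sub>h\<close> to some \<open>v\<^sub>h\<^sub>'\<close> or to \<open>0\<close>, so that \<open>f v\<^sub>h\<close> is always a combination of the \<open>v\<^sub>h\<^sub>'\<close>.  Their images
  are linearly independent, since \<open>v\<^sub>h\<close> maps \<open>b\<^sub>+ \<dots> b\<^sub>+\<close> to \<open>h\<close>.  Finally the recursion for \<open>J\<^sub>k\<close>
  expresses \<open>v\<^sub>h \<otimes> id\<close> through the \<open>v\<^sub>h\<^sub>'\<close> with \<open>h'\<close> extending \<open>h\<close> by one letter; hence a morphism is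
  determined by its composites with the \<open>v\<^sub>h\<close>, which gives both faithfulness and fullness.
\<close>

section \<open>Presented categories\<close>

text \<open>The relations (M.1) make zigzags vanish instead of straightening them, so strands cannot
  be bent and Hom spaces do not reduce to those out of the unit. Highest weight words take over that
  role. The recursion for \<open>J\<close> is the branching rule: \<open>B(k) \<otimes> B\<close>
  splits into \<open>B(k+1)\<close>, \<open>B(k)\<close> and \<open>B(k-1)\<close>, and the two
  subtracted terms cut out the last two. Closing the last strand of \<open>J\<close> on
  \<open>k+1\<close> strands returns \<open>J\<close> on \<open>k\<close> strands with coefficient
  1, where the Jones-Wenzl projector produces a quotient of quantum integers; hence no denominators
  occur and every field is allowed. Iterating the branching writes the identity of a tensor power as
  a sum of composites through the \<open>v_h\<close>, so no normal form of diagrams is involved. A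
  crystal map composed with \<open>v_h\<close> is known once its value on the highest weight element
  is known, which is how its coefficients are read off. Closure of crystal maps under tensor
  products is a consequence of fullness: such maps are images of diagrams, and diagrams can be
  tensored.\<close>

inductive_cases has_type_GenE: "has_type gdom gcod x y (TGen g)"
inductive_cases has_type_IdE: "has_type gdom gcod x y (TId z)"
inductive_cases has_type_CompE: "has_type gdom gcod x y (g \<cdot> f)"
inductive_cases has_type_TensE: "has_type gdom gcod x y (f \<otimes> g)"
inductive_cases has_type_ZeroE: "has_type gdom gcod x y (TZero z w)"
inductive_cases has_type_AddE: "has_type gdom gcod x y (TAdd f g)"
inductive_cases has_type_ScaleE: "has_type gdom gcod x y (TScale a f)"

lemmas has_type_elims = has_type_GenE has_type_IdE has_type_CompE has_type_TensE
  has_type_ZeroE has_type_AddE has_type_ScaleE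

lemma has_type_unique:
  "has_type gdom gcod x y t \<Longrightarrow> has_type gdom gcod x' y' t \<Longrightarrow> x' = x \<and> y' = y"
proof (induction arbitrary: x' y' rule: has_type.induct)
  case (Comp x y f z g)
  from Comp.prems Comp.IH show ?case by (metis has_type_CompE)
next
  case (Tens x y f x' y' g)
  from Tens.prems Tens.IH show ?case by (elim has_type_TensE) metis
next
  case (Add x y f g)
  from Add.prems Add.IH show ?case by (elim has_type_AddE) metis
next
  case (Scale x y f a)
  from Scale.prems Scale.IH show ?case by (elim has_type_ScaleE) metis
qed (elim has_type_elims; simp)+

lemma has_type_tens_assoc:
  assumes "has_type gdom gcod x y f" "has_type gdom gcod x' y' g" "has_type gdom gcod x'' y'' h"
  shows "has_type gdom gcod (x @ x' @ x'') (y @ y' @ y'') ((f \<otimes> g) \<otimes> h)"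
  using has_type.Tens[OF has_type.Tens[OF assms(1,2)] assms(3)] by simp

lemma term_eq_has_type:
  "term_eq gdom gcod R x y s t \<Longrightarrow> has_type gdom gcod x y s \<and> has_type gdom gcod x y t"
proof (induction rule: term_eq.induct)
  case (tens_assoc x y f x' y' g x'' y'' h)
  then show ?case by (simp add: has_type.Tens has_type_tens_assoc)
next
  case (tens_unit x y f)
  then show ?case using has_type.Tens[OF tens_unit has_type.Id[of gdom gcod "[]"]] by auto
next
  case (unit_tens x y f)
  then show ?case using has_type.Tens[OF has_type.Id[of gdom gcod "[]"] unit_tens] by auto
qed (blast intro: has_type.intros)+

context
  fixes gdom gcod :: "'g \<Rightarrow> 'o list"
    and R :: "(('k::field, 'o, 'g) mterm \<times> ('k, 'o, 'g) mterm) set"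
begin

abbreviation (input) cls :: "('k, 'o, 'g) mterm \<Rightarrow> ('k, 'o, 'g) mterm set" where
  "cls \<equiv> term_class gdom gcod R"

text \<open>A term has only one type, so the objects quantified away in \<open>term_class\<close>
  must be the given ones.\<close>

lemma mem_term_class:
  assumes "has_type gdom gcod x y t"
  shows "s \<in> cls t \<longleftrightarrow> term_eq gdom gcod R x y t s"
proof
  assume "s \<in> cls t"
  then obtain x' y' where "term_eq gdom gcod R x' y' t s"
    by (auto simp: term_class_def)
  moreover from this have "x' = x \<and> y' = y"
    using term_eq_has_type has_type_unique assms by metis
  ultimately show "term_eq gdom gcod R x y t s" by simp
qed (auto simp: term_class_def)

lemma term_class_eqI:
  assumes "term_eq gdom gcod R x y s t"
  shows "cls s = cls t"
proof -
  note ty = term_eq_has_type[OF assms]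
  show ?thesis
    using mem_term_class[of x y s] mem_term_class[of x y t] ty assms
    by (blast intro: term_eq.trans term_eq.sym)
qed

lemma presented_simps [simp]:
  "Obj (presented_category gdom gcod R) = UNIV"
  "Hom (presented_category gdom gcod R) x y = cls ` {t. has_type gdom gcod x y t}"
  "Ident (presented_category gdom gcod R) x = cls (TId x)"
  "Unit (presented_category gdom gcod R) = []"
  "TensO (presented_category gdom gcod R) = (@)"
  "Zero (presented_category gdom gcod R) x y = cls (TZero x y)"
  by (simp_all add: presented_category_def Let_def)

lemma term_class_selfI: "has_type gdom gcod x y t \<Longrightarrow> t \<in> cls t"
  by (simp add: mem_term_class term_eq.refl)

lemma term_class_dest:
  assumes "s \<in> cls t" "has_type gdom gcod x y s"
  shows "term_eq gdom gcod R x y t s" "has_type gdom gcod x y t"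
proof -
  obtain x' y' where "term_eq gdom gcod R x' y' t s"
    using assms by (auto simp: term_class_def)
  moreover from this have "x' = x \<and> y' = y"
    using term_eq_has_type has_type_unique assms by metis
  ultimately show "term_eq gdom gcod R x y t s" "has_type gdom gcod x y t"
    using term_eq_has_type by blast+
qed

lemma term_class_dest':
  assumes "s \<in> cls t"
  obtains x y where "term_eq gdom gcod R x y t s" "has_type gdom gcod x y t"
  using assms term_eq_has_type by (fastforce simp: term_class_def)

text \<open>The equation covers ill-typed composites too: their class is empty, and so is the union
  over representatives. Otherwise congruence puts every member of the union into
  \<open>cls (g \<cdot> f)\<close>, and the representatives \<open>g\<close>, \<open>f\<close>
  already contribute all of it.\<close>

lemma presented_Comp [simp]: "Comp (presented_category gdom gcod R) (cls g) (cls f) = cls (g \<cdot> f)"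
proof -
  have "r \<in> cls (g \<cdot> f)" if r: "r \<in> cls (g' \<cdot> f')" and g': "g' \<in> cls g" and f': "f' \<in> cls f" for r g' f'
  proof -
    obtain x z where 1: "term_eq gdom gcod R x z (g' \<cdot> f') r" "has_type gdom gcod x z (g' \<cdot> f')"
      using r by (rule term_class_dest')
    then obtain y where y: "has_type gdom gcod x y f'" "has_type gdom gcod y z g'"
      by (auto elim: has_type_CompE)
    have "term_eq gdom gcod R x z (g \<cdot> f) (g' \<cdot> f')"
      using term_class_dest(1)[OF f' y(1)] term_class_dest(1)[OF g' y(2)] by (rule term_eq.cong_comp)
    then have "term_eq gdom gcod R x z (g \<cdot> f) r" using 1(1) by (rule term_eq.trans)
    then show ?thesis by (auto simp: term_class_def)
  qed
  moreover have "g \<in> cls g \<and> f \<in> cls f" if "r \<in> cls (g \<cdot> f)" for r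
  proof -
    obtain x z where "has_type gdom gcod x z (g \<cdot> f)" using \<open>r \<in> cls (g \<cdot> f)\<close> by (rule term_class_dest')
    then show ?thesis by (elim has_type_CompE) (simp add: term_class_selfI)
  qed
  ultimately show ?thesis
    unfolding presented_category_def Let_def linear_monoidal.simps by blast
qed

lemma presented_TensM [simp]: "TensM (presented_category gdom gcod R) (cls f) (cls g) = cls (f \<otimes> g)"
proof -
  have "r \<in> cls (f \<otimes> g)" if r: "r \<in> cls (f' \<otimes> g')" and f': "f' \<in> cls f" and g': "g' \<in> cls g" for r g' f'
  proof -
    obtain x z where 1: "term_eq gdom gcod R x z (f' \<otimes> g') r" "has_type gdom gcod x z (f' \<otimes> g')"
      using r by (rule term_class_dest')
    then obtain a b c d where y: "has_type gdom gcod a b f'" "has_type gdom gcod c d g'" "x = a @ c" "z = b @ d"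
      by (auto elim: has_type_TensE)
    have "term_eq gdom gcod R x z (f \<otimes> g) (f' \<otimes> g')"
      unfolding y(3,4)
      using term_class_dest(1)[OF f' y(1)] term_class_dest(1)[OF g' y(2)] by (rule term_eq.cong_tens)
    then have "term_eq gdom gcod R x z (f \<otimes> g) r" using 1(1) by (rule term_eq.trans)
    then show ?thesis by (auto simp: term_class_def)
  qed
  moreover have "g \<in> cls g \<and> f \<in> cls f" if "r \<in> cls (f \<otimes> g)" for r
  proof -
    obtain x z where "has_type gdom gcod x z (f \<otimes> g)" using \<open>r \<in> cls (f \<otimes> g)\<close> by (rule term_class_dest')
    then show ?thesis by (elim has_type_TensE) (simp add: term_class_selfI)
  qed
  ultimately show ?thesis
    unfolding presented_category_def Let_def linear_monoidal.simps by blast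
qed

lemma presented_Add [simp]: "Add (presented_category gdom gcod R) (cls f) (cls g) = cls (TAdd f g)"
proof -
  have "r \<in> cls (TAdd f g)" if r: "r \<in> cls (TAdd f' g')" and f': "f' \<in> cls f" and g': "g' \<in> cls g" for r g' f'
  proof -
    obtain x z where 1: "term_eq gdom gcod R x z (TAdd f' g') r" "has_type gdom gcod x z (TAdd f' g')"
      using r by (rule term_class_dest')
    then have y: "has_type gdom gcod x z f'" "has_type gdom gcod x z g'"
      by (auto elim: has_type_AddE)
    have "term_eq gdom gcod R x z (TAdd f g) (TAdd f' g')"
      using term_class_dest(1)[OF f' y(1)] term_class_dest(1)[OF g' y(2)] by (rule term_eq.cong_add)
    then have "term_eq gdom gcod R x z (TAdd f g) r" using 1(1) by (rule term_eq.trans)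
    then show ?thesis by (auto simp: term_class_def)
  qed
  moreover have "g \<in> cls g \<and> f \<in> cls f" if "r \<in> cls (TAdd f g)" for r
  proof -
    obtain x z where "has_type gdom gcod x z (TAdd f g)" using \<open>r \<in> cls (TAdd f g)\<close> by (rule term_class_dest')
    then show ?thesis by (elim has_type_AddE) (simp add: term_class_selfI)
  qed
  ultimately show ?thesis
    unfolding presented_category_def Let_def linear_monoidal.simps by blast
qed

lemma presented_Scale [simp]: "Scale (presented_category gdom gcod R) a (cls f) = cls (TScale a f)"
proof -
  have "r \<in> cls (TScale a f)" if r: "r \<in> cls (TScale a f')" and f': "f' \<in> cls f" for r f'
  proof -
    obtain x z where 1: "term_eq gdom gcod R x z (TScale a f') r" "has_type gdom gcod x z (TScale a f')"
      using r by (rule term_class_dest')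
    then have y: "has_type gdom gcod x z f'"
      by (auto elim: has_type_ScaleE)
    have "term_eq gdom gcod R x z (TScale a f) (TScale a f')"
      using term_class_dest(1)[OF f' y(1)] by (rule term_eq.cong_scale)
    then have "term_eq gdom gcod R x z (TScale a f) r" using 1(1) by (rule term_eq.trans)
    then show ?thesis by (auto simp: term_class_def)
  qed
  moreover have "f \<in> cls f" if "r \<in> cls (TScale a f)" for r
  proof -
    obtain x z where "has_type gdom gcod x z (TScale a f)" using \<open>r \<in> cls (TScale a f)\<close> by (rule term_class_dest')
    then show ?thesis by (elim has_type_ScaleE) (simp add: term_class_selfI)
  qed
  ultimately show ?thesis
    unfolding presented_category_def Let_def linear_monoidal.simps by blast
qed

text \<open>Each law for morphisms is an introduction rule of \<open>has_type\<close> or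
  \<open>term_eq\<close>; the laws for objects are those of list concatenation.\<close>

lemma strict_linear_monoidal_category_presented: "strict_linear_monoidal_category (presented_category gdom gcod R)"
  by (unfold_locales; unfold presented_simps; clarify?;
      (simp only: presented_Comp presented_TensM presented_Add presented_Scale)?;
      ((rule imageI, rule CollectI, (rule has_type.intros; assumption)) | (rule term_class_eqI, (rule term_eq.intros; assumption)) | simp))

end

section \<open>Interpreting terms\<close>

primrec eval_object :: "('p, 'm, 'k) linear_monoidal \<Rightarrow> ('o \<Rightarrow> 'p) \<Rightarrow> 'o list \<Rightarrow> 'p" where
  "eval_object C X [] = Unit C"
| "eval_object C X (a # w) = TensO C (X a) (eval_object C X w)"

primrec eval :: "('p, 'm, 'k) linear_monoidal \<Rightarrow> ('o \<Rightarrow> 'p) \<Rightarrow> ('g \<Rightarrow> 'm) \<Rightarrow> ('k, 'o, 'g) mterm \<Rightarrow> 'm" where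
  "eval C X G (TGen g) = G g"
| "eval C X G (TId w) = Ident C (eval_object C X w)"
| "eval C X G (g \<cdot> f) = Comp C (eval C X G g) (eval C X G f)"
| "eval C X G (f \<otimes> g) = TensM C (eval C X G f) (eval C X G g)"
| "eval C X G (TZero v w) = Zero C (eval_object C X v) (eval_object C X w)"
| "eval C X G (TAdd f g) = Add C (eval C X G f) (eval C X G g)"
| "eval C X G (TScale a f) = Scale C a (eval C X G f)"

context strict_linear_monoidal_category
begin

text \<open>A second name, because an induction case called \<open>interchange\<close> hides the
  axiom in the soundness proof below.\<close>

lemmas tensor_Comp = interchange

context
  fixes X :: "'a \<Rightarrow> 'o" and G :: "'g \<Rightarrow> 'm" and gdom gcod :: "'g \<Rightarrow> 'a list"
  assumes X: "\<And>a. X a \<in> Obj C"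
    and G: "\<And>g. G g \<in> Hom C (eval_object C X (gdom g)) (eval_object C X (gcod g))"
begin

lemma eval_object_in: "eval_object C X w \<in> Obj C"
  by (induction w) (auto intro: Unit_in TensO_in X)

lemma eval_object_append:
  "eval_object C X (v @ w) = TensO C (eval_object C X v) (eval_object C X w)"
  by (induction v) (auto simp: Unit_TensO TensO_assoc X eval_object_in)

lemma eval_in_Hom:
  "has_type gdom gcod x y t \<Longrightarrow> eval C X G t \<in> Hom C (eval_object C X x) (eval_object C X y)"
  by (induction rule: has_type.induct)
    (auto simp: eval_object_append
      intro: G Ident_in Comp_in TensM_in Zero_in Add_in Scale_in eval_object_in)

text \<open>Soundness: all rules of \<open>term_eq\<close> other than \<open>rel\<close> mirror
  axioms valid in every strict linear monoidal category, so a choice of values for the generators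
  has to be tested on \<open>R\<close> alone.\<close>

lemma eval_respects_term_eq:
  assumes R: "\<And>s t x y. (s, t) \<in> R \<Longrightarrow> has_type gdom gcod x y s \<Longrightarrow> has_type gdom gcod x y t
    \<Longrightarrow> eval C X G s = eval C X G t"
  shows "term_eq gdom gcod R x y s t \<Longrightarrow> eval C X G s = eval C X G t"
proof (induction rule: term_eq.induct)
  case (rel f g x y)
  then show ?case by (rule R)
next
  case (comp_assoc w x f y g z h)
  then show ?case
    using Comp_assoc[OF _ _ _ _ eval_in_Hom eval_in_Hom eval_in_Hom] by (simp add: eval_object_in)
next
  case (tens_assoc x y f x' y' g x'' y'' h)
  then show ?case
    using TensM_assoc[OF _ _ _ _ _ _ eval_in_Hom eval_in_Hom eval_in_Hom] by (simp add: eval_object_in)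
next
  case (interchange x y f z g x' y' f' z' g')
  then show ?case
    using tensor_Comp[OF _ _ _ _ _ _ eval_in_Hom eval_in_Hom eval_in_Hom eval_in_Hom]
    by (simp add: eval_object_in)
next
  case (tens_id x y)
  then show ?case by (simp add: TensM_Ident eval_object_in eval_object_append)
qed (auto intro: eval_object_in eval_in_Hom Comp_Ident Ident_Comp TensM_Unit Unit_TensM
  Add_assoc Add_commute Add_Zero Add_minus Scale_one Scale_Scale Scale_add Scale_Add
  Comp_Add_left Comp_Add_right Comp_Scale_left Comp_Scale_right
  TensM_Add_left TensM_Add_right TensM_Scale_left TensM_Scale_right)

end

end

section \<open>The algebra of Motzkin diagrams\<close>

type_synonym 'k tm = "('k, unit, mo_gen) mterm"

abbreviation word :: "nat \<Rightarrow> unit list" where "word n \<equiv> replicate n ()"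

lemma word_length [simp]: "word (length w) = w"
  by (induction w) auto

primrec tdom :: "'k tm \<Rightarrow> nat" where
  "tdom (TGen g) = length (mo_dom g)"
| "tdom (TId w) = length w"
| "tdom (g \<cdot> f) = tdom f"
| "tdom (f \<otimes> g) = tdom f + tdom g"
| "tdom (TZero v w) = length v"
| "tdom (TAdd f g) = max (tdom f) (tdom g)"
| "tdom (TScale a f) = tdom f"

primrec tcod :: "'k tm \<Rightarrow> nat" where
  "tcod (TGen g) = length (mo_cod g)"
| "tcod (TId w) = length w"
| "tcod (g \<cdot> f) = tcod g"
| "tcod (f \<otimes> g) = tcod f + tcod g"
| "tcod (TZero v w) = length w"
| "tcod (TAdd f g) = max (tcod f) (tcod g)"
| "tcod (TScale a f) = tcod f"

abbreviation mo_type :: "unit list \<Rightarrow> unit list \<Rightarrow> 'k tm \<Rightarrow> bool" where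
  "mo_type \<equiv> has_type mo_dom mo_cod"

abbreviation mo_eq :: "unit list \<Rightarrow> unit list \<Rightarrow> 'k::field tm \<Rightarrow> 'k tm \<Rightarrow> bool" where
  "mo_eq \<equiv> term_eq mo_dom mo_cod mo_relations"

definition typed :: "'k tm \<Rightarrow> bool" where
  "typed t \<longleftrightarrow> mo_type (word (tdom t)) (word (tcod t)) t"

lemma mo_type_lengths: "mo_type x y t \<Longrightarrow> length x = tdom t \<and> length y = tcod t"
  by (induction rule: has_type.induct) auto

lemma mo_type_iff: "mo_type x y t \<longleftrightarrow> typed t \<and> length x = tdom t \<and> length y = tcod t"
  unfolding typed_def using mo_type_lengths by (metis word_length)

lemma typed_simps [simp]:
  "typed (TGen x)"
  "typed (TId w)"
  "typed (g \<cdot> f) \<longleftrightarrow> typed g \<and> typed f \<and> tcod f = tdom g"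
  "typed (f \<otimes> g) \<longleftrightarrow> typed f \<and> typed g"
  "typed (TZero v w)"
  "typed (TAdd f g) \<longleftrightarrow> typed f \<and> typed g \<and> tdom f = tdom g \<and> tcod f = tcod g"
  "typed (TScale a f) \<longleftrightarrow> typed f"
proof -
  show "typed (TGen x)"
    using has_type.Gen[of mo_dom mo_cod x] unfolding mo_type_iff by simp
  show "typed (TId w)"
    using has_type.Id[of mo_dom mo_cod w] unfolding mo_type_iff by simp
  show "typed (TZero v w)"
    using has_type.Zero[of mo_dom mo_cod v w] unfolding mo_type_iff by simp
  have "typed (g \<cdot> f) \<longleftrightarrow> (\<exists>y. mo_type (word (tdom f)) y f \<and> mo_type y (word (tcod g)) g)"
    unfolding typed_def tdom.simps tcod.simps by (blast elim: has_type_CompE intro: has_type.Comp)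
  then show "typed (g \<cdot> f) \<longleftrightarrow> typed g \<and> typed f \<and> tcod f = tdom g"
    unfolding mo_type_iff by (metis length_replicate)
  have "typed (f \<otimes> g)" if "typed f" "typed g"
    using has_type.Tens[of mo_dom mo_cod "word (tdom f)" "word (tcod f)" f "word (tdom g)" "word (tcod g)" g] that
    unfolding mo_type_iff by simp
  moreover have "typed f \<and> typed g" if "typed (f \<otimes> g)"
    using that unfolding typed_def[of "f \<otimes> g"] by (elim has_type_TensE) (simp add: mo_type_iff)
  ultimately show "typed (f \<otimes> g) \<longleftrightarrow> typed f \<and> typed g" by blast
  have "typed (TAdd f g)" if "typed f" "typed g" "tdom f = tdom g" "tcod f = tcod g"
    using has_type.Add[of mo_dom mo_cod "word (tdom f)" "word (tcod f)" f g] that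
    unfolding mo_type_iff by simp
  moreover have "typed f \<and> typed g \<and> tdom f = tdom g \<and> tcod f = tcod g" if "typed (TAdd f g)"
    using that unfolding typed_def[of "TAdd f g"] by (elim has_type_AddE) (simp add: mo_type_iff)
  ultimately show "typed (TAdd f g) \<longleftrightarrow> typed f \<and> typed g \<and> tdom f = tdom g \<and> tcod f = tcod g"
    by blast
  show "typed (TScale a f) \<longleftrightarrow> typed f"
    unfolding typed_def tdom.simps tcod.simps by (blast elim: has_type_ScaleE intro: has_type.Scale)
qed

text \<open>
  All ill-typed terms with the same syntactic domain and codomain are identified (the maximum in
  the equations for \<open>TAdd\<close> makes addition commutative on them).  The
  operations then become total, the syntactic (co)domain is always additive under \<open>\<otimes>\<close>, and most
  axioms hold unconditionally.
\<close>

definition mo_equiv :: "'k::field tm \<Rightarrow> 'k tm \<Rightarrow> bool" where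
  "mo_equiv s t \<longleftrightarrow> tdom s = tdom t \<and> tcod s = tcod t \<and>
    (typed s \<or> typed t \<longrightarrow> mo_eq (word (tdom s)) (word (tcod s)) s t)"

lemma mo_eq_typed: "mo_eq x y s t \<Longrightarrow> typed s \<and> typed t \<and> x = word (tdom s) \<and> y = word (tcod s)
    \<and> tdom t = tdom s \<and> tcod t = tcod s"
  using term_eq_has_type[of mo_dom mo_cod mo_relations x y s t] unfolding mo_type_iff
  by (metis word_length)

lemma mo_equiv_typed: "mo_equiv s t \<Longrightarrow> typed s \<longleftrightarrow> typed t"
  unfolding mo_equiv_def using mo_eq_typed by blast

lemma mo_equivI: "mo_eq x y s t \<Longrightarrow> mo_equiv s t"
  unfolding mo_equiv_def using mo_eq_typed by metis

quotient_type (overloaded) 'k mo = "'k::field tm" / mo_equiv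
proof (rule equivpI)
  show "reflp mo_equiv"
    by (rule reflpI) (auto simp: mo_equiv_def typed_def intro: term_eq.refl)
  show "symp mo_equiv"
    by (rule sympI) (auto simp: mo_equiv_def intro: term_eq.sym)
  show "transp mo_equiv"
    by (rule transpI) (metis mo_equiv_def mo_equiv_typed term_eq.trans)
qed

instantiation mo :: (field) "{plus, minus, uminus, times}"
begin

lift_definition times_mo :: "'a mo \<Rightarrow> 'a mo \<Rightarrow> 'a mo" is "(\<cdot>)"
  subgoal premises p for g g' f f'
    using p mo_equiv_typed[OF p(1)] mo_equiv_typed[OF p(2)]
    by (auto simp: mo_equiv_def intro!: term_eq.cong_comp)
  done

lift_definition plus_mo :: "'a mo \<Rightarrow> 'a mo \<Rightarrow> 'a mo" is TAdd
  subgoal premises p for g g' f f'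
    using p mo_equiv_typed[OF p(1)] mo_equiv_typed[OF p(2)]
    by (auto simp: mo_equiv_def intro!: term_eq.cong_add)
  done

lift_definition uminus_mo :: "'a mo \<Rightarrow> 'a mo" is "TScale (- 1)"
  by (auto simp: mo_equiv_def intro!: term_eq.cong_scale)

definition minus_mo :: "'a mo \<Rightarrow> 'a mo \<Rightarrow> 'a mo" where
  "minus_mo f g = f + - g"

instance ..

end

lift_definition tens :: "'k::field mo \<Rightarrow> 'k mo \<Rightarrow> 'k mo"  (infixr \<open>\<odot>\<close> 75) is "(\<otimes>)"
  subgoal premises p for g g' f f'
    using p mo_equiv_typed[OF p(1)] mo_equiv_typed[OF p(2)]
    by (auto simp: mo_equiv_def replicate_add intro!: term_eq.cong_tens)
  done

lift_definition scale :: "'k::field \<Rightarrow> 'k mo \<Rightarrow> 'k mo"  (infixr \<open>\<bullet>\<close> 74) is TScale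
  by (auto simp: mo_equiv_def intro!: term_eq.cong_scale)

lift_definition idn :: "nat \<Rightarrow> 'k::field mo" is "\<lambda>n. TId (word n)" .
lift_definition zer :: "nat \<Rightarrow> nat \<Rightarrow> 'k::field mo" is "\<lambda>m n. TZero (word m) (word n)" .
lift_definition gen :: "mo_gen \<Rightarrow> 'k::field mo" is TGen .
lift_definition dm :: "'k::field mo \<Rightarrow> nat" is tdom by (simp add: mo_equiv_def)
lift_definition cd :: "'k::field mo \<Rightarrow> nat" is tcod by (simp add: mo_equiv_def)
lift_definition arr :: "'k::field mo \<Rightarrow> bool" is typed by (rule mo_equiv_typed)

text \<open>With composition as multiplication, associativity and distributivity are at hand for
  rewriting. Every pair of objects has its own zero, so the class is a semiring without zero
  element.\<close>

instance mo :: (field) semiring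
proof
  fix f g h :: "'a mo"
  show "f + g + h = f + (g + h)"
    by transfer (auto simp: mo_equiv_def mo_type_iff intro!: term_eq.add_assoc)
  show "f + g = g + f"
    by transfer (auto simp: mo_equiv_def mo_type_iff intro!: term_eq.add_commute)
  show "f * g * h = f * (g * h)"
    apply transfer
    subgoal for f g h
      using term_eq.comp_assoc[of mo_dom mo_cod "word (tdom h)" "word (tcod h)" h "word (tcod g)" g "word (tcod f)" f]
      by (auto simp: mo_equiv_def mo_type_iff)
    done
  show "(f + g) * h = f * h + g * h"
    apply transfer
    subgoal for f g h
      using term_eq.comp_add_left[of mo_dom mo_cod "word (tdom h)" "word (tcod h)" h "word (tcod g)" f g]
      by (auto simp: mo_equiv_def mo_type_iff)
    done
  show "f * (g + h) = f * g + f * h"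
    apply transfer
    subgoal for f g h
      using term_eq.comp_add_right[of mo_dom mo_cod "word (tdom h)" "word (tcod h)" g h "word (tcod f)" f]
      by (auto simp: mo_equiv_def mo_type_iff)
    done
qed


lemma dm_simps [simp]:
  "dm (g * f) = dm f" "dm (f \<odot> g) = dm f + dm g" "dm (f + g) = max (dm f) (dm g)"
  "dm (- f) = dm f" "dm (a \<bullet> f) = dm f" "dm (idn n) = n" "dm (zer m n) = m"
  "dm (gen x) = length (mo_dom x)"
  by (transfer, simp)+

lemma cd_simps [simp]:
  "cd (g * f) = cd g" "cd (f \<odot> g) = cd f + cd g" "cd (f + g) = max (cd f) (cd g)"
  "cd (- f) = cd f" "cd (a \<bullet> f) = cd f" "cd (idn n) = n" "cd (zer m n) = n"
  "cd (gen x) = length (mo_cod x)"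
  by (transfer, simp)+

lemma arr_simps [simp]:
  "arr (g * f) \<longleftrightarrow> arr g \<and> arr f \<and> cd f = dm g"
  "arr (f \<odot> g) \<longleftrightarrow> arr f \<and> arr g"
  "arr (f + g) \<longleftrightarrow> arr f \<and> arr g \<and> dm f = dm g \<and> cd f = cd g"
  "arr (- f) \<longleftrightarrow> arr f" "arr (a \<bullet> f) \<longleftrightarrow> arr f" "arr (idn n)" "arr (zer m n)" "arr (gen x)"
  by (transfer, simp)+

lemma diff_simps [simp]:
  "dm (f - g) = max (dm f) (dm g)" "cd (f - g) = max (cd f) (cd g)"
  "arr (f - g) \<longleftrightarrow> arr f \<and> arr g \<and> dm f = dm g \<and> cd f = cd g"
  by (simp_all add: minus_mo_def)

lemma tens_assoc: "(f \<odot> g) \<odot> h = f \<odot> g \<odot> h"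
  by transfer (auto simp: mo_equiv_def mo_type_iff replicate_add intro!: term_eq.tens_assoc)

lemma tens_idn0 [simp]: "f \<odot> idn 0 = f" "idn 0 \<odot> f = f"
  by (transfer, auto simp: mo_equiv_def mo_type_iff intro!: term_eq.tens_unit term_eq.unit_tens)+

lemma tens_idn [simp]: "idn m \<odot> idn n = idn (m + n)"
  by transfer (auto simp: mo_equiv_def mo_type_iff replicate_add intro!: term_eq.tens_id)

lemma comp_idn [simp]: "dm f = n \<Longrightarrow> f * idn n = f" "cd f = n \<Longrightarrow> idn n * f = f"
  by (transfer, auto simp: mo_equiv_def mo_type_iff intro!: term_eq.comp_id term_eq.id_comp)+

text \<open>Both middle objects must agree separately. If only the sums \<open>cd f + cd f'\<close>
  and \<open>dm g + dm g'\<close> agreed, then for arrows the left side would be well typed and the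
  right side not.\<close>

lemma tens_comp:
  assumes "cd f = dm g" "cd f' = dm g'"
  shows "(g \<odot> g') * (f \<odot> f') = (g * f) \<odot> (g' * f')"
  using assms
  apply transfer
  subgoal for f g f' g'
    using term_eq.interchange[of mo_dom mo_cod "word (tdom f)" "word (tcod f)" f "word (tcod g)" g
        "word (tdom f')" "word (tcod f')" f' "word (tcod g')" g' mo_relations]
    by (auto simp: mo_equiv_def mo_type_iff replicate_add intro: term_eq.sym)
  done

lemma tens_add: "(f + f') \<odot> g = f \<odot> g + f' \<odot> g" "g \<odot> (f + f') = g \<odot> f + g \<odot> f'"
  by (transfer, auto simp: mo_equiv_def mo_type_iff replicate_add
      intro!: term_eq.tens_add_left term_eq.tens_add_right)+

lemma scale_add: "a \<bullet> (f + g) = a \<bullet> f + a \<bullet> g"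
  by transfer (auto simp: mo_equiv_def mo_type_iff intro!: term_eq.scale_add)

lemma scale_plus: "(a + b) \<bullet> f = a \<bullet> f + b \<bullet> f"
  by transfer (auto simp: mo_equiv_def mo_type_iff intro!: term_eq.scale_plus)

lemma scale_scale: "a \<bullet> b \<bullet> f = (a * b) \<bullet> f"
  by transfer (auto simp: mo_equiv_def mo_type_iff intro!: term_eq.scale_scale)

lemma scale_one [simp]: "1 \<bullet> f = f"
  by transfer (auto simp: mo_equiv_def mo_type_iff intro!: term_eq.scale_one)

lemma scale_comp: "(a \<bullet> g) * f = a \<bullet> (g * f)" "g * (a \<bullet> f) = a \<bullet> (g * f)"
  subgoal
    apply transfer
    subgoal for a g f
      using term_eq.comp_scale_left[of mo_dom mo_cod "word (tdom f)" "word (tcod f)" f "word (tcod g)" g]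
      by (auto simp: mo_equiv_def mo_type_iff)
    done
  subgoal
    apply transfer
    subgoal for g a f
      using term_eq.comp_scale_right[of mo_dom mo_cod "word (tdom f)" "word (tcod f)" f "word (tcod g)" g]
      by (auto simp: mo_equiv_def mo_type_iff)
    done
  done

lemma scale_tens: "(a \<bullet> f) \<odot> g = a \<bullet> (f \<odot> g)" "f \<odot> (a \<bullet> g) = a \<bullet> (f \<odot> g)"
  by (transfer, auto simp: mo_equiv_def mo_type_iff replicate_add
      intro!: term_eq.tens_scale_left term_eq.tens_scale_right)+

lemma add_zer [simp]: "dm f = m \<Longrightarrow> cd f = n \<Longrightarrow> f + zer m n = f"
  by transfer (auto simp: mo_equiv_def mo_type_iff intro!: term_eq.add_zero)

lemma zer_add [simp]: "dm f = m \<Longrightarrow> cd f = n \<Longrightarrow> zer m n + f = f"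
  by (simp add: add.commute)

lemma uminus_mo: "- f = (- 1) \<bullet> f" for f :: "'k::field mo"
  by transfer (auto simp: mo_equiv_def mo_type_iff intro!: term_eq.refl)

text \<open>A zero morphism is well typed, while \<open>f - f\<close> is ill-typed whenever
  \<open>f\<close> is; hence the hypothesis.\<close>

lemma diff_self [simp]: "arr f \<Longrightarrow> f - f = zer (dm f) (cd f)"
  unfolding minus_mo_def
  by transfer (auto simp: mo_equiv_def mo_type_iff intro!: term_eq.add_minus)

lemma scale_0: "arr f \<Longrightarrow> 0 \<bullet> f = zer (dm f) (cd f)"
  using scale_plus[of 1 "-1" f] diff_self[of f] by (simp add: minus_mo_def uminus_mo)

text \<open>Absorption by zero morphisms is not among the axioms. Writing a zero as 0 times itself
  reduces it to the linearity of \<open>*\<close> and \<open>\<odot>\<close>.\<close>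

lemma zer_eq: "zer m n = 0 \<bullet> zer m n"
  by (simp add: scale_0)

lemma scale_zer [simp]: "a \<bullet> zer m n = zer m n"
  by (subst (1 2) zer_eq) (simp add: scale_scale)

lemma comp_zer [simp]: "arr g \<Longrightarrow> dm g = n \<Longrightarrow> g * zer m n = zer m (cd g)"
  using scale_comp(2)[of g 0 "zer m n"] scale_0[of "g * zer m n"] by simp

lemma zer_comp [simp]: "arr f \<Longrightarrow> cd f = m \<Longrightarrow> zer m n * f = zer (dm f) n"
  using scale_comp(1)[of 0 "zer m n" f] scale_0[of "zer m n * f"] by simp

lemma tens_zer [simp]: "arr f \<Longrightarrow> f \<odot> zer m n = zer (dm f + m) (cd f + n)"
  using scale_tens(2)[of f 0 "zer m n"] scale_0[of "f \<odot> zer m n"] by simp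

lemma zer_tens [simp]: "arr f \<Longrightarrow> zer m n \<odot> f = zer (m + dm f) (n + cd f)"
  using scale_tens(1)[of 0 "zer m n" f] scale_0[of "zer m n \<odot> f"] by simp

lemma neg_zer [simp]: "- zer m n = zer m n"
  by (simp add: uminus_mo)

lemma diff_zer [simp]: "dm f = m \<Longrightarrow> cd f = n \<Longrightarrow> f - zer m n = f"
  by (simp add: minus_mo_def)

lemma diff_comp: "(f - g) * h = f * h - g * h" "h * (f - g) = h * f - h * g"
  for f g h :: "'k::field mo"
  by (simp_all add: minus_mo_def uminus_mo algebra_simps scale_comp)

lemma diff_tens: "(f - g) \<odot> h = f \<odot> h - g \<odot> h" "h \<odot> (f - g) = h \<odot> f - h \<odot> g"
  by (simp_all add: minus_mo_def uminus_mo tens_add scale_tens)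

lemma add_diff_cancel_mo: "arr g \<Longrightarrow> dm f = dm g \<Longrightarrow> cd f = cd g \<Longrightarrow> g + (f - g) = f"
  for f g :: "'k::field mo"
  using diff_self[of g] by (simp add: minus_mo_def add.left_commute)

abbreviation mo_eta :: "'k::field mo" (\<open>\<eta>\<close>) where "\<eta> \<equiv> gen Eta"
abbreviation mo_theta :: "'k::field mo" (\<open>\<theta>\<close>) where "\<theta> \<equiv> gen Theta"
abbreviation mo_cup :: "'k::field mo" (\<open>\<union>\<close>) where "\<union> \<equiv> gen Cup"
abbreviation mo_cap :: "'k::field mo" (\<open>\<inter>\<close>) where "\<inter> \<equiv> gen Cap"

lemma mo_relation:
  assumes "(s, t) \<in> mo_relations" "typed s" "typed t" "tdom s = tdom t" "tcod s = tcod t"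
  shows "mo_equiv s t"
proof (rule mo_equivI)
  show "mo_eq (word (tdom s)) (word (tcod s)) s t"
    using assms by (intro term_eq.rel) (simp_all add: mo_type_iff)
qed

lemma relations [simp]:
  "(idn (Suc 0) \<odot> \<inter>) * (\<union> \<odot> idn (Suc 0)) = zer (Suc 0) (Suc 0)"
  "(\<inter> \<odot> idn (Suc 0)) * (idn (Suc 0) \<odot> \<union>) = zer (Suc 0) (Suc 0)"
  "\<inter> * (\<eta> \<odot> idn (Suc 0)) = zer (Suc 0) 0"
  "\<inter> * (idn (Suc 0) \<odot> \<eta>) = zer (Suc 0) 0"
  "(\<theta> \<odot> idn (Suc 0)) * \<union> = zer 0 (Suc 0)"
  "(idn (Suc 0) \<odot> \<theta>) * \<union> = zer 0 (Suc 0)"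
  "\<inter> * \<union> = idn 0"
  "\<theta> * \<eta> = idn 0"
  by (transfer, rule mo_relation; simp add: mo_relations_def Let_def)+

section \<open>Idempotents of Jones-Wenzl type\<close>

abbreviation strand :: "'k::field mo" (\<open>\<iota>\<close>) where "\<iota> \<equiv> idn (Suc 0)"

lemma idn_Suc: "idn (Suc n) = idn n \<odot> \<iota>"
  by simp

lemma comp_tens_idn: "cd f = dm g \<Longrightarrow> (g * f) \<odot> idn n = (g \<odot> idn n) * (f \<odot> idn n)"
  by (simp add: tens_comp)

lemma idn_tens_comp: "cd f = dm g \<Longrightarrow> idn n \<odot> (g * f) = (idn n \<odot> g) * (idn n \<odot> f)"
  by (simp add: tens_comp)

text \<open>The middle factor \<open>jones k\<close> restricts the cup term to a single copy of
  \<open>B(k)\<close>; a bare cup-cap composite would also subtract components that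
  \<open>jones (Suc k) \<odot> \<iota>\<close> no longer contains.\<close>

fun jones :: "nat \<Rightarrow> 'k::field mo" where
  "jones 0 = idn 0"
| "jones (Suc 0) = \<iota> - \<eta> * \<theta>"
| "jones (Suc (Suc k)) = jones (Suc k) \<odot> \<iota> - jones (Suc k) \<odot> (\<eta> * \<theta>)
    - (idn k \<odot> \<union>) * jones k * (idn k \<odot> \<inter>)"

lemmas jones_Suc_Suc = jones.simps(3)
declare jones_Suc_Suc [simp del]

lemma jones_type [simp]: "arr (jones k :: 'k::field mo)" "dm (jones k :: 'k mo) = k" "cd (jones k :: 'k mo) = k"
proof -
  have "arr (jones k :: 'k mo) \<and> dm (jones k :: 'k mo) = k \<and> cd (jones k :: 'k mo) = k"
    by (induction k rule: jones.induct) (auto simp: jones_Suc_Suc)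
  then show "arr (jones k :: 'k mo)" "dm (jones k :: 'k mo) = k" "cd (jones k :: 'k mo) = k"
    by auto
qed

lemma zigzag1: "(idn (Suc k) \<odot> \<inter>) * (idn k \<odot> \<union> \<odot> \<iota>) = zer (Suc k) (Suc k)"
  unfolding idn_Suc[of k] tens_assoc by (simp add: tens_comp)

lemma zigzag2: "(idn k \<odot> \<inter> \<odot> \<iota>) * (idn (Suc k) \<odot> \<union>) = zer (Suc k) (Suc k)"
  unfolding idn_Suc[of k] tens_assoc by (simp add: tens_comp)

lemma comp_zero_left: "g * f = zer m n \<Longrightarrow> arr h \<Longrightarrow> cd h = m \<Longrightarrow> g * (f * h) = zer (dm h) n"
  by (simp add: mult.assoc[symmetric])

lemma comp_zero_right: "g * f = zer m n \<Longrightarrow> arr h \<Longrightarrow> dm h = n \<Longrightarrow> (h * g) * f = zer m (cd h)"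
  by (simp add: mult.assoc)

lemma cap_dot [simp]: "\<inter> * ((\<eta> * \<theta>) \<odot> \<iota>) = zer (Suc (Suc 0)) 0" "\<inter> * (\<iota> \<odot> (\<eta> * \<theta>)) = zer (Suc (Suc 0)) 0"
  by (simp_all add: comp_tens_idn idn_tens_comp comp_zero_left[where m = "Suc 0" and n = 0])

lemma dot_cup [simp]: "((\<eta> * \<theta>) \<odot> \<iota>) * \<union> = zer 0 (Suc (Suc 0))" "(\<iota> \<odot> (\<eta> * \<theta>)) * \<union> = zer 0 (Suc (Suc 0))"
  by (simp_all add: comp_tens_idn idn_tens_comp comp_zero_right[where m = 0 and n = "Suc 0"])

lemma comp_idn_tens: "dm f = m \<Longrightarrow> cd g = 0 \<Longrightarrow> f * (idn m \<odot> g) = f \<odot> g"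
  by (metis tens_comp tens_idn0(1) comp_idn cd_simps(6) dm_simps(6))

lemma idn_tens_comp0: "cd f = m \<Longrightarrow> dm g = 0 \<Longrightarrow> (idn m \<odot> g) * f = f \<odot> g"
  by (metis tens_comp tens_idn0(1) comp_idn cd_simps(6) dm_simps(6))

lemma theta_eta_comp [simp]: "cd f = 0 \<Longrightarrow> \<theta> * (\<eta> * f) = f"
  by (simp add: mult.assoc[symmetric])

text \<open>After expanding \<open>jones (Suc k)\<close>, the cap kills the dot term by (M.2) and
  forms a zigzag with the cup term, zero by (M.1). Only the leading term survives, and it slides
  past the cap.\<close>

lemma cap_jones: "(idn k \<odot> \<inter>) * (jones (Suc k) \<odot> \<iota>) = jones k * (idn k \<odot> (\<inter> :: 'k::field mo))"
proof (cases k)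
  case 0
  then show ?thesis by (simp add: diff_tens diff_comp)
next
  case (Suc l)
  have "(idn k \<odot> \<inter>) * (((idn l \<odot> \<union>) * jones l * (idn l \<odot> (\<inter> :: 'k mo))) \<odot> \<iota>) = zer (Suc (Suc k)) k"
    by (simp add: Suc comp_tens_idn tens_assoc mult.assoc comp_zero_left[OF zigzag1])
  then show ?thesis
    by (simp add: Suc jones_Suc_Suc diff_tens diff_comp tens_assoc tens_comp) (simp add: comp_idn_tens)
qed

text \<open>Vertical reflection of \<open>cap_jones\<close>.\<close>

lemma jones_cup: "(jones (Suc k) \<odot> \<iota>) * (idn k \<odot> \<union>) = (idn k \<odot> (\<union> :: 'k::field mo)) * jones k"
proof (cases k)
  case 0
  then show ?thesis by (simp add: diff_tens diff_comp)
next
  case (Suc l)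
  have "(((idn l \<odot> \<union>) * jones l * (idn l \<odot> \<inter>)) \<odot> \<iota>) * (idn k \<odot> (\<union> :: 'k mo)) = zer k (Suc (Suc k))"
    by (simp add: Suc comp_tens_idn tens_assoc mult.assoc zigzag2)
  then show ?thesis
    by (simp add: Suc jones_Suc_Suc diff_tens diff_comp tens_assoc tens_comp) (simp add: idn_tens_comp0)
qed

lemma theta_cup: "(idn (Suc k) \<odot> \<theta>) * (idn k \<odot> \<union>) = zer k (Suc k)"
  unfolding idn_Suc[of k] tens_assoc by (simp add: tens_comp)

text \<open>The first two terms cancel because \<open>\<theta> * \<eta>\<close> is the identity of
  the unit; the cup term vanishes by the reflected (M.2).\<close>

lemma theta_jones: "(idn k \<odot> \<theta>) * jones (Suc k) = zer (Suc k) k"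
proof (cases k)
  case 0
  then show ?thesis by (simp add: diff_comp)
next
  case (Suc l)
  have "(idn (Suc l) \<odot> \<theta>) * jones (Suc (Suc l)) =
    jones (Suc l) \<odot> \<theta> - jones (Suc l) \<odot> (\<theta> * (\<eta> * \<theta>))
    - (idn (Suc l) \<odot> \<theta>) * ((idn l \<odot> \<union>) * (jones l * (idn l \<odot> (\<inter> :: 'a mo))))"
    by (simp add: jones_Suc_Suc diff_comp tens_comp mult.assoc)
  also have "\<dots> = zer (Suc (Suc l)) (Suc l)"
    by (subst comp_zero_left[OF theta_cup]) simp_all
  finally show ?thesis by (simp only: Suc)
qed

lemma cap_dot_last:
  fixes f :: "'k::field mo"
  assumes f: "arr f" "cd f = Suc k"
  shows "(idn k \<odot> \<inter>) * (f \<odot> (\<eta> * \<theta>)) = zer (Suc (dm f)) k"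
proof -
  have "(idn k \<odot> \<inter>) * (idn k \<odot> \<iota> \<odot> \<eta>) = (zer (Suc k) k :: 'k mo)"
    by (simp add: tens_comp)
  from comp_zero_left[OF this, of "f \<odot> \<theta>"]
  have "(idn k \<odot> \<inter>) * ((idn k \<odot> \<iota> \<odot> \<eta>) * (f \<odot> \<theta>)) = zer (Suc (dm f)) k"
    using f by simp
  moreover have "(idn k \<odot> \<iota> \<odot> \<eta>) * (f \<odot> \<theta>) = f \<odot> (\<eta> * \<theta>)"
    using f by (simp add: tens_assoc[symmetric] tens_comp)
  ultimately show ?thesis by simp
qed

lemma cap_cup: "(idn k \<odot> \<inter>) * (idn k \<odot> \<union>) = idn k"
  by (simp add: tens_comp)

text \<open>The leading term becomes \<open>jones k\<close> after the cap by
  \<open>cap_jones\<close>. The cup term gives the same because a closed loop is 1, and the dot term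
  gives zero.\<close>

lemma cap_jones_Suc: "(idn k \<odot> \<inter>) * jones (Suc (Suc k)) = zer (Suc (Suc k)) k"
proof -
  have "(idn k \<odot> \<inter>) * ((idn k \<odot> \<union>) * jones k * (idn k \<odot> \<inter>)) = jones k * (idn k \<odot> (\<inter> :: 'a mo))"
    unfolding mult.assoc[symmetric] cap_cup by simp
  then show ?thesis
    by (simp only: jones_Suc_Suc diff_comp cap_jones) (simp add: cap_dot_last)
qed

lemma jones_absorb_aux:
  assumes jones: "jones (Suc l) * jones (Suc l) = (jones (Suc l) :: 'k::field mo)" "jones l * jones l = (jones l :: 'k mo)"
  shows "(jones (Suc l) \<odot> \<iota>) * jones (Suc (Suc l)) = (jones (Suc (Suc l)) :: 'k mo)"
proof -
  have "(jones (Suc l) \<odot> \<iota>) * ((idn l \<odot> \<union>) * jones l * (idn l \<odot> (\<inter> :: 'k mo))) =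
     ((jones (Suc l) \<odot> \<iota>) * (idn l \<odot> \<union>)) * jones l * (idn l \<odot> \<inter>)"
    by (simp only: mult.assoc)
  also have "\<dots> = (idn l \<odot> \<union>) * (jones l * jones l) * (idn l \<odot> \<inter>)"
    by (simp only: mult.assoc jones_cup)
  finally show ?thesis
    unfolding jones_Suc_Suc diff_comp by (simp add: tens_comp jones)
qed

lemma jones_kill:
  assumes "arr f" "dm f = Suc l" 
  shows "(f \<odot> (\<eta> * \<theta>)) * jones (Suc (Suc l)) = zer (Suc (Suc l)) (Suc (cd f))"
proof -
  have "f \<odot> (\<eta> * \<theta>) = (f \<odot> \<eta>) * (idn (Suc l) \<odot> \<theta>)"
    using assms tens_comp[of "idn (Suc l)" f \<theta> \<eta>] by (simp)
  then show ?thesis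
    using assms by (simp only: mult.assoc theta_jones) simp
qed

text \<open>Only the left factor is expanded. Its leading term is absorbed by the right factor, and
  its dot and cup terms begin with a \<open>\<theta>\<close> or a cap that the right factor
  kills.\<close>

lemma jones_idem_step:
  assumes jones: "jones (Suc l) * jones (Suc l) = (jones (Suc l) :: 'k::field mo)" "jones l * jones l = (jones l :: 'k mo)"
  shows "jones (Suc (Suc l)) * jones (Suc (Suc l)) = (jones (Suc (Suc l)) :: 'k mo)"
proof -
  have "jones (Suc (Suc l)) * jones (Suc (Suc l)) = (jones (Suc l) \<odot> \<iota>) * jones (Suc (Suc l))
    - (jones (Suc l) \<odot> (\<eta> * \<theta>)) * jones (Suc (Suc l))
    - (idn l \<odot> \<union>) * (jones l * ((idn l \<odot> (\<inter> :: 'k mo)) * jones (Suc (Suc l))))"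
    by (subst (1) jones_Suc_Suc) (simp only: diff_comp mult.assoc)
  also have "\<dots> = jones (Suc (Suc l))"
    unfolding jones_absorb_aux[OF jones] cap_jones_Suc by (simp add: jones_kill)
  finally show ?thesis .
qed

lemma jones_idem [simp]: "jones k * jones k = (jones k :: 'k::field mo)"
proof (induction k rule: jones.induct)
  case 2
  show ?case by (simp add: diff_comp mult.assoc)
next
  case (3 k)
  then show ?case by (intro jones_idem_step)
qed simp

section \<open>Highest weight words\<close>

type_synonym letter = "nat \<times> nat"

text \<open>
  The letters \<open>(0, 0)\<close>, \<open>(0, 1)\<close> and \<open>(1, 0)\<close> are the elements of \<open>B\<close> of weight \<open>1\<close>,
  \<open>-1\<close> and of the summand \<open>B(0)\<close>.  Here words are reversed: the list \<open>r\<close> stands for the tensor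
  \<open>rev r\<close>, so that the recursion extends a word at its right end.  The truncated subtractions are
  harmless for highest weight words.
\<close>

primrec height :: "letter list \<Rightarrow> nat" where
  "height [] = 0"
| "height (x # r) = (if x = (0, 0) then Suc (height r) else if x = (0, 1) then height r - 1 else height r)"

primrec hw :: "letter list \<Rightarrow> bool" where
  "hw [] \<longleftrightarrow> True"
| "hw (x # r) \<longleftrightarrow> hw r \<and> (x = (0, 0) \<or> x = (1, 0) \<or> x = (0, 1) \<and> height r > 0)"

text \<open>Each letter selects one summand of \<open>B(k) \<otimes> B\<close> with
  \<open>k = height r\<close>: the idempotent selects \<open>B(k+1)\<close>, a cup joining the last
  strand to the new one selects \<open>B(k-1)\<close>, and a dot on the new strand selects
  \<open>B(k)\<close>.\<close>

primrec hw_mor :: "letter list \<Rightarrow> 'k::field mo" where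
  "hw_mor [] = idn 0"
| "hw_mor (x # r) =
    (if x = (0, 0) then (hw_mor r \<odot> \<iota>) * jones (Suc (height r))
     else if x = (0, 1) then (hw_mor r \<odot> \<iota>) * (idn (height r - 1) \<odot> \<union>)
     else hw_mor r \<odot> \<eta>)"

lemma hw_mor_simps [simp]:
  "hw_mor ((0, 0) # r) = (hw_mor r \<odot> \<iota>) * jones (Suc (height r))"
  "hw_mor ((0, Suc 0) # r) = (hw_mor r \<odot> \<iota>) * (idn (height r - 1) \<odot> \<union>)"
  "hw_mor ((Suc 0, 0) # r) = hw_mor r \<odot> \<eta>"
  by simp_all

declare hw_mor.simps(2) [simp del]

lemma hw_cases [consumes 1, case_names Nil Plus Zero Minus]:
  assumes "hw r"
  obtains "r = []" | r' where "r = (0, 0) # r'" "hw r'" | r' where "r = (Suc 0, 0) # r'" "hw r'"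
  | r' l where "r = (0, Suc 0) # r'" "hw r'" "height r' = Suc l"
  using assms by (cases r) (auto simp: gr0_conv_Suc)

lemma hw_mor_type [simp]: "hw r \<Longrightarrow> arr (hw_mor r :: 'k::field mo)" "hw r \<Longrightarrow> dm (hw_mor r :: 'k mo) = height r"
    "hw r \<Longrightarrow> cd (hw_mor r :: 'k mo) = length r"
proof -
  have "hw r \<longrightarrow> arr (hw_mor r :: 'k mo) \<and> dm (hw_mor r :: 'k mo) = height r \<and> cd (hw_mor r :: 'k mo) = length r"
    by (induction r) (auto simp: hw_mor.simps gr0_conv_Suc)
  then show "hw r \<Longrightarrow> arr (hw_mor r :: 'k::field mo)" "hw r \<Longrightarrow> dm (hw_mor r :: 'k mo) = height r"
    "hw r \<Longrightarrow> cd (hw_mor r :: 'k mo) = length r" by auto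
qed

text \<open>For \<open>(0, 0)\<close> this is idempotence. In the cup case \<open>jones_cup\<close>
  carries the idempotent of the shorter word through the cup to the source side.\<close>

lemma hw_mor_jones [simp]:
  fixes r :: "letter list"
  shows "hw r \<Longrightarrow> hw_mor r * jones (height r) = (hw_mor r :: 'k::field mo)"
proof (induction r)
  case (Cons x r)
  then have "hw (x # r)" by simp
  then show ?case
  proof (cases rule: hw_cases)
    case (Plus r')
    then show ?thesis by (simp add: mult.assoc)
  next
    case (Zero r')
    then have "(hw_mor r \<odot> \<eta>) * (jones (height r) \<odot> idn 0) = hw_mor r \<odot> (\<eta> :: 'k mo)"
      using Cons.IH by (subst tens_comp) simp_all
    with Zero show ?thesis by simp
  next
    case (Minus r' l)
    have "hw_mor r * jones (height r) = (hw_mor r :: 'k mo)" using Cons Minus by simp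
    then have "(hw_mor r \<odot> \<iota>) * (jones (height r) \<odot> \<iota>) = hw_mor r \<odot> (\<iota> :: 'k mo)"
      using Minus by (subst tens_comp) simp_all
    then have "(hw_mor r \<odot> \<iota>) * ((jones (height r) \<odot> \<iota>) * (idn l \<odot> \<union>)) = (hw_mor r \<odot> \<iota>) * (idn l \<odot> (\<union> :: 'k mo))"
      by (simp only: mult.assoc[symmetric])
    with Minus show ?thesis by (simp add: mult.assoc jones_cup)
  qed simp
qed simp

section \<open>Action of the generators on highest weight morphisms\<close>

definition act :: "'k::field mo \<Rightarrow> letter list \<Rightarrow> bool" where
  "act X r \<longleftrightarrow> X * hw_mor r = zer (height r) (cd X) \<or>
    (\<exists>r'. hw r' \<and> height r' = height r \<and> length r' = cd X \<and> X * hw_mor r = hw_mor r')"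

text \<open>\<open>hw_mor (x # r)\<close> arises from \<open>hw_mor r\<close> by operations at the
  right end that depend only on \<open>x\<close> and \<open>height r\<close>. As \<open>act\<close>
  preserves the height, the same letter can be appended to the word it produces.\<close>

lemma act_Cons:
  fixes X :: "'k::field mo"
  assumes X: "arr X" "dm X = length r" and r: "hw (x # r)" and act: "act X r"
  shows "act (X \<odot> \<iota>) (x # r)"
  using r
proof (cases rule: hw_cases)
  case (Plus r')
  then have hw: "hw r" "x = (0, 0)" by auto
  have *: "(X \<odot> \<iota>) * hw_mor (x # r) = ((X * hw_mor r) \<odot> \<iota>) * jones (Suc (height r))"
    using hw X by (simp add: mult.assoc[symmetric] tens_comp)
  from act show ?thesis unfolding act_def[of X]
  proof (elim disjE exE conjE)
    assume "X * hw_mor r = zer (height r) (cd X)"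
    then show ?thesis using hw unfolding act_def * by simp
  next
    fix s assume "hw s" "height s = height r" "length s = cd X" "X * hw_mor r = hw_mor s"
    then show ?thesis using hw unfolding act_def *
      by (intro disjI2 exI[of _ "x # s"]) simp
  qed
next
  case (Zero r')
  then have hw: "hw r" "x = (Suc 0, 0)" by auto
  have *: "(X \<odot> \<iota>) * hw_mor (x # r) = (X * hw_mor r) \<odot> \<eta>"
    using hw X by (simp add: tens_comp)
  from act show ?thesis unfolding act_def[of X]
  proof (elim disjE exE conjE)
    assume "X * hw_mor r = zer (height r) (cd X)"
    then show ?thesis using hw unfolding act_def * by simp
  next
    fix s assume "hw s" "height s = height r" "length s = cd X" "X * hw_mor r = hw_mor s"
    then show ?thesis using hw unfolding act_def *
      by (intro disjI2 exI[of _ "x # s"]) simp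
  qed
next
  case (Minus r' l)
  then have hw: "hw r" "x = (0, Suc 0)" "height r = Suc l" by auto
  have *: "(X \<odot> \<iota>) * hw_mor (x # r) = ((X * hw_mor r) \<odot> \<iota>) * (idn l \<odot> \<union>)"
    using hw X by (simp add: mult.assoc[symmetric] tens_comp)
  from act show ?thesis unfolding act_def[of X]
  proof (elim disjE exE conjE)
    assume "X * hw_mor r = zer (height r) (cd X)"
    then show ?thesis using hw unfolding act_def * by simp
  next
    fix s assume "hw s" "height s = height r" "length s = cd X" "X * hw_mor r = hw_mor s"
    then show ?thesis using hw unfolding act_def *
      by (intro disjI2 exI[of _ "x # s"]) simp
  qed
qed simp

text \<open>Since \<open>hw_mor r\<close> absorbs \<open>jones (Suc l)\<close>, it suffices to solve
  the recursion of \<open>jones\<close> for \<open>jones (Suc l) \<odot> \<iota>\<close>. This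
  leaves one summand for each letter that may follow \<open>r\<close>.\<close>

lemma hw_mor_Suc_split:
  assumes "hw r" "height r = Suc l"
  shows "hw_mor r \<odot> \<iota> = hw_mor ((Suc 0, 0) # r) * (idn (Suc l) \<odot> \<theta>) +
    (hw_mor ((0, 0) # r) + hw_mor ((0, Suc 0) # r) * (jones l * (idn l \<odot> (\<inter> :: 'k::field mo))))"
proof -
  let ?E = "(idn l \<odot> \<union>) * jones l * (idn l \<odot> (\<inter> :: 'k mo))"
  let ?B = "jones (Suc l) \<odot> (\<eta> * (\<theta> :: 'k mo))"
  have jones: "jones (Suc l) \<odot> \<iota> = ?B + (jones (Suc (Suc l)) + ?E)"
    unfolding jones_Suc_Suc
    by (simp add: add_diff_cancel_mo add.commute[of _ ?E])
  have "hw_mor r \<odot> \<iota> = (hw_mor r * jones (Suc l)) \<odot> (\<iota> :: 'k mo)"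
    using hw_mor_jones[OF assms(1), where 'k = 'k] assms(2) by simp
  also have "\<dots> = (hw_mor r \<odot> \<iota>) * (jones (Suc l) \<odot> \<iota>)"
    using assms by (simp add: tens_comp)
  also have "\<dots> = (hw_mor r \<odot> \<iota>) * ?B + ((hw_mor r \<odot> \<iota>) * jones (Suc (Suc l)) + (hw_mor r \<odot> \<iota>) * ?E)"
    unfolding jones by (simp only: distrib_left)
  also have "(hw_mor r \<odot> \<iota>) * ?B = (hw_mor r \<odot> \<eta>) * (idn (Suc l) \<odot> \<theta>)"
    using assms hw_mor_jones[OF assms(1), where 'k = 'k] by (simp add: tens_comp)
  finally show ?thesis
    using assms by (simp add: mult.assoc)
qed

text \<open>At height 0 the letter \<open>(0, 1)\<close> cannot follow, and the splitting is that of
  a single strand into \<open>\<eta> * \<theta>\<close> and \<open>jones (Suc 0)\<close>.\<close>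

lemma hw_mor_0_split:
  assumes "hw r" "height r = 0"
  shows "hw_mor r \<odot> \<iota> = hw_mor ((Suc 0, 0) # r) * \<theta> + (hw_mor ((0, 0) # r) :: 'k::field mo)"
proof -
  have "(\<iota> :: 'k mo) = \<eta> * \<theta> + jones (Suc 0)"
    by (simp add: add_diff_cancel_mo)
  then have "hw_mor r \<odot> \<iota> = hw_mor r \<odot> (\<eta> * \<theta>) + hw_mor r \<odot> (jones (Suc 0) :: 'k mo)"
    using tens_add(2) by metis
  moreover have "hw_mor r \<odot> (\<eta> * \<theta>) = (hw_mor r \<odot> \<eta>) * (idn 0 \<odot> (\<theta> :: 'k mo))"
    using assms by (subst tens_comp) simp_all
  moreover have "hw_mor r \<odot> jones (Suc 0) = (hw_mor r \<odot> \<iota>) * (idn 0 \<odot> (jones (Suc 0) :: 'k mo))"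
    using assms by (subst tens_comp) simp_all
  ultimately show ?thesis
    using assms by (simp add: mult.assoc)
qed


text \<open>The strand carrying the last letter is capped with a fresh strand at its right. A dot
  dies by (M.2), a cup yields a zigzag, and for \<open>(0, 0)\<close> the cap moves through the
  idempotent by \<open>cap_jones\<close>.\<close>

lemma cap_hw_mor_Cons:
  fixes r :: "letter list"
  assumes r: "hw r" and a: "length r = a"
  shows "(idn a \<odot> \<inter>) * (hw_mor ((Suc 0, 0) # r) \<odot> \<iota>) = (zer (Suc (height r)) a :: 'k::field mo)"
    and "(idn a \<odot> \<inter>) * (hw_mor ((0, 0) # r) \<odot> \<iota>) = hw_mor r * (idn (height r) \<odot> (\<inter> :: 'k mo))"
    and "height r = Suc l \<Longrightarrow> (idn a \<odot> \<inter>) * (hw_mor ((0, Suc 0) # r) \<odot> \<iota>) = (zer (height r) a :: 'k mo)"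
proof -
  note r = r a
  show "(idn a \<odot> \<inter>) * (hw_mor ((Suc 0, 0) # r) \<odot> \<iota>) = (zer (Suc (height r)) a :: 'k::field mo)"
    using r by (simp add: tens_assoc tens_comp)
  have *: "(idn a \<odot> \<inter>) * (hw_mor r \<odot> idn (Suc (Suc 0))) = hw_mor r * (idn (height r) \<odot> (\<inter> :: 'k mo))"
    using r by (simp add: tens_comp comp_idn_tens)
  have "(idn a \<odot> \<inter>) * (hw_mor ((0, 0) # r) \<odot> \<iota>) =
    ((idn a \<odot> \<inter>) * (hw_mor r \<odot> idn (Suc (Suc 0)))) * (jones (Suc (height r)) \<odot> (\<iota> :: 'k mo))"
    using r by (simp add: comp_tens_idn tens_assoc mult.assoc)
  also have "\<dots> = hw_mor r * jones (height r) * (idn (height r) \<odot> \<inter>)"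
    unfolding * mult.assoc cap_jones ..
  finally show "(idn a \<odot> \<inter>) * (hw_mor ((0, 0) # r) \<odot> \<iota>) = hw_mor r * (idn (height r) \<odot> (\<inter> :: 'k mo))"
    using r by simp
  assume l: "height r = Suc l"
  have "(idn a \<odot> \<inter>) * (hw_mor ((0, Suc 0) # r) \<odot> \<iota>) =
    ((idn a \<odot> \<inter>) * (hw_mor r \<odot> idn (Suc (Suc 0)))) * (idn l \<odot> \<union> \<odot> (\<iota> :: 'k mo))"
    using r l by (simp add: comp_tens_idn tens_assoc mult.assoc)
  also have "\<dots> = hw_mor r * ((idn (Suc l) \<odot> \<inter>) * (idn l \<odot> \<union> \<odot> (\<iota> :: 'k mo)))"
    unfolding * mult.assoc l ..
  also have "\<dots> = zer (height r) a"
    unfolding zigzag1 using r l by simp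
  finally show "(idn a \<odot> \<inter>) * (hw_mor ((0, Suc 0) # r) \<odot> \<iota>) = (zer (height r) a :: 'k mo)" .
qed

text \<open>The cap survives only on a final \<open>(0, 0)\<close> followed by
  \<open>(0, 1)\<close>, which it deletes. Weight 0 letters die by (M.2), a penultimate
  \<open>(0, 1)\<close> by (M.1), and two letters \<open>(0, 0)\<close> by
  \<open>cap_jones_Suc\<close>.\<close>

lemma act_cap:
  assumes "hw r" "length r = Suc (Suc a)"
  shows "act (idn a \<odot> (\<inter> :: 'k::field mo)) r"
proof -
  obtain y r1 where y: "r = y # r1" "length r1 = Suc a" using assms(2) by (cases r) auto
  then obtain x r0 where x: "r1 = x # r0" "length r0 = a" by (cases r1) auto
  note cap = cap_hw_mor_Cons[where 'k = 'k]
  from \<open>hw r\<close> show ?thesis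
  proof (cases rule: hw_cases)
    case (Plus r')
    then have r: "r = (0, 0) # r1" "hw r1" using y by auto
    have *: "(idn a \<odot> \<inter>) * hw_mor r = ((idn a \<odot> (\<inter> :: 'k mo)) * (hw_mor r1 \<odot> \<iota>)) * jones (Suc (height r1))"
      unfolding r hw_mor_simps mult.assoc ..
    show ?thesis
      using r(2)
    proof (cases rule: hw_cases)
      case (Plus r')
      then show ?thesis unfolding act_def * using x r cap(2)[of r0 a]
        by (simp add: mult.assoc cap_jones_Suc)
    next
      case (Zero r')
      then show ?thesis unfolding act_def * using x r cap(1)[of r0 a] by simp
    next
      case (Minus r' l)
      then show ?thesis unfolding act_def * using x r cap(3)[of r0 a l] by simp
    qed (use x in simp)
  next
    case (Zero r')
    then have r: "r = (Suc 0, 0) # r1" "hw r1" using y by auto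
    have "hw_mor r = (idn a \<odot> \<iota> \<odot> \<eta>) * (hw_mor r1 :: 'k mo)"
      using r y by (simp add: tens_assoc[symmetric] idn_tens_comp0)
    moreover have "(idn a \<odot> \<inter>) * (idn a \<odot> \<iota> \<odot> \<eta>) = (zer (Suc a) a :: 'k mo)"
      by (simp add: tens_comp)
    ultimately show ?thesis
      using r y unfolding act_def by (simp add: comp_zero_left)
  next
    case (Minus r' l)
    then have r: "r = (0, Suc 0) # r1" "hw r1" "height r1 = Suc l" using y by auto
    have *: "(idn a \<odot> \<inter>) * hw_mor r = ((idn a \<odot> (\<inter> :: 'k mo)) * (hw_mor r1 \<odot> \<iota>)) * (idn l \<odot> \<union>)"
      using r by (simp add: mult.assoc)
    show ?thesis
      using r(2)
    proof (cases rule: hw_cases)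
      case (Plus r')
      then have r0: "hw r0" "r1 = (0, 0) # r0" "height r0 = l" using x r by auto
      \<comment> \<open>The cap passes the idempotent of \<open>(0, 0)\<close> and meets the cup of
        \<open>(0, 1)\<close> in a closed loop.\<close>
      have "(idn a \<odot> \<inter>) * hw_mor r = (hw_mor r0 :: 'k mo)"
        using cap(2)[of r0 a] r0 x unfolding * by (simp add: mult.assoc cap_cup)
      then show ?thesis
        unfolding act_def using r r0 x by (intro disjI2 exI[of _ r0]) simp
    next
      case (Zero r')
      then show ?thesis unfolding act_def * using x r cap(1)[of r0 a] by simp
    next
      case (Minus r' l)
      then show ?thesis unfolding act_def * using x r cap(3)[of r0 a l] by simp
    qed (use x in simp)
  qed (use y in simp)
qed

text \<open>A final weight 0 letter is removed by (M.3); the other two letters are killed by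
  \<open>theta_jones\<close> and by the reflected (M.2).\<close>

lemma act_theta:
  assumes "hw r" "length r = Suc a"
  shows "act (idn a \<odot> (\<theta> :: 'k::field mo)) r"
  using assms(1)
proof (cases rule: hw_cases)
  case (Plus r')
  have "(idn a \<odot> \<theta>) * hw_mor r = ((idn a \<odot> \<theta>) * (hw_mor r' \<odot> \<iota>)) * (jones (Suc (height r')) :: 'k mo)"
    by (simp add: Plus mult.assoc)
  also have "(idn a \<odot> \<theta>) * (hw_mor r' \<odot> \<iota>) = hw_mor r' * (idn (height r') \<odot> (\<theta> :: 'k mo))"
    using Plus assms by (simp add: tens_comp comp_idn_tens)
  also have "\<dots> * jones (Suc (height r')) = zer (height r) a"
    using Plus assms by (simp add: mult.assoc theta_jones)
  finally show ?thesis by (simp add: act_def)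
next
  case (Zero r')
  have "(idn a \<odot> \<theta>) * hw_mor r = (hw_mor r' :: 'k mo)"
    using Zero assms by (simp add: tens_comp)
  then show ?thesis
    unfolding act_def using Zero assms by (intro disjI2 exI[of _ r']) simp
next
  case (Minus r' l)
  have "(idn a \<odot> \<theta>) * hw_mor r = ((idn a \<odot> \<theta>) * (hw_mor r' \<odot> \<iota>)) * (idn l \<odot> (\<union> :: 'k mo))"
    by (simp add: Minus mult.assoc)
  also have "(idn a \<odot> \<theta>) * (hw_mor r' \<odot> \<iota>) = hw_mor r' * (idn (Suc l) \<odot> (\<theta> :: 'k mo))"
    using Minus assms by (simp add: tens_comp comp_idn_tens)
  also have "\<dots> * (idn l \<odot> \<union>) = zer (height r) a"
    unfolding mult.assoc theta_cup using Minus assms by simp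
  finally show ?thesis by (simp add: act_def)
qed (use assms in simp)

lemma act_eta:
  assumes "hw r" "length r = a"
  shows "act (idn a \<odot> (\<eta> :: 'k::field mo)) r"
  using assms unfolding act_def
  by (intro disjI2 exI[of _ "(Suc 0, 0) # r"]) (simp add: idn_tens_comp0)

text \<open>The new word ends in \<open>(0, 0)\<close>, \<open>(0, 1)\<close>. Its morphism contains
  an additional idempotent, which \<open>jones_cup\<close> moves below the cup, where
  \<open>hw_mor r\<close> absorbs it.\<close>

lemma act_cup:
  assumes "hw r" "length r = a"
  shows "act (idn a \<odot> (\<union> :: 'k::field mo)) r"
proof -
  let ?k = "height r"
  have "hw_mor ((0, Suc 0) # (0, 0) # r) = (hw_mor r \<odot> idn (Suc (Suc 0))) * ((jones (Suc ?k) \<odot> \<iota>) * (idn ?k \<odot> (\<union> :: 'k mo)))"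
    using assms by (simp add: comp_tens_idn tens_assoc mult.assoc)
  also have "\<dots> = (hw_mor r \<odot> \<union>) * jones ?k"
    unfolding jones_cup mult.assoc[symmetric] using assms by (simp add: tens_comp)
  also have "hw_mor r \<odot> \<union> = (idn a \<odot> \<union>) * (hw_mor r :: 'k mo)"
    using assms by (simp add: idn_tens_comp0)
  also have "\<dots> * jones ?k = (idn a \<odot> \<union>) * hw_mor r"
    using assms by (simp add: mult.assoc)
  finally show ?thesis
    unfolding act_def using assms by (intro disjI2 exI[of _ "(0, Suc 0) # (0, 0) # r"]) simp
qed

text \<open>The identity at the left is built into the four base cases; the identity at the right
  grows strand by strand with \<open>act_Cons\<close>.\<close>

lemma act_gen:
  "hw r \<Longrightarrow> length r = a + length (mo_dom x) + b \<Longrightarrow> act (idn a \<odot> gen x \<odot> (idn b :: 'k::field mo)) r"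
proof (induction b arbitrary: r)
  case 0
  then show ?case by (cases x) (simp_all add: act_eta act_theta act_cup act_cap)
next
  case (Suc b)
  let ?X = "idn a \<odot> gen x \<odot> (idn b :: 'k mo)"
  obtain y s where s: "r = y # s" "length s = a + length (mo_dom x) + b"
    using Suc.prems(2) by (cases r) auto
  have "act ?X s"
    using Suc s by auto
  then have "act (?X \<odot> \<iota>) r"
    using Suc.prems s act_Cons[of ?X s y] by simp
  then show ?case by (simp add: tens_assoc)
qed


text \<open>The two splittings in whiskered form. Later arguments use only the types of the
  coefficients \<open>A\<close> and \<open>C\<close>, so their formulas are hidden.\<close>

lemma hw_mor_split:
  assumes "hw r"
  obtains A where "arr A" "dm A = Suc (height r) + b" "cd A = height r + b"
    "height r = 0 \<Longrightarrow> hw_mor r \<odot> idn (Suc b) = (hw_mor ((Suc 0, 0) # r) \<odot> idn b) * A + (hw_mor ((0, 0) # r) \<odot> (idn b :: 'k::field mo))"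
    "\<And>l. height r = Suc l \<Longrightarrow> \<exists>C :: 'k mo. arr C \<and> dm C = Suc (height r) + b \<and> cd C = l + b \<and>
      hw_mor r \<odot> idn (Suc b) = (hw_mor ((Suc 0, 0) # r) \<odot> idn b) * A + ((hw_mor ((0, 0) # r) \<odot> idn b) + (hw_mor ((0, Suc 0) # r) \<odot> idn b) * C)"
proof
  let ?k = "height r"
  let ?A = "(idn ?k \<odot> \<theta>) \<odot> (idn b :: 'k mo)"
  show "arr ?A" "dm ?A = Suc (height r) + b" "cd ?A = height r + b" by simp_all
  have hw_mor: "hw_mor r \<odot> idn (Suc b) = (hw_mor r \<odot> \<iota>) \<odot> (idn b :: 'k mo)"
    by (simp add: tens_assoc)
  show "hw_mor r \<odot> idn (Suc b) = (hw_mor ((Suc 0, 0) # r) \<odot> idn b) * ?A + (hw_mor ((0, 0) # r) \<odot> (idn b :: 'k mo))"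
    if "height r = 0"
    unfolding hw_mor hw_mor_0_split[OF assms that] tens_add using that assms
    by (simp add: comp_tens_idn)
  show "\<exists>C :: 'k mo. arr C \<and> dm C = Suc (height r) + b \<and> cd C = l + b \<and>
      hw_mor r \<odot> idn (Suc b) = (hw_mor ((Suc 0, 0) # r) \<odot> idn b) * ?A + ((hw_mor ((0, 0) # r) \<odot> idn b) + (hw_mor ((0, Suc 0) # r) \<odot> idn b) * C)"
    if l: "height r = Suc l" for l
  proof (intro exI conjI)
    let ?C = "(jones l * (idn l \<odot> \<inter>)) \<odot> (idn b :: 'k mo)"
    show "arr ?C" "dm ?C = Suc (height r) + b" "cd ?C = l + b" using l by simp_all
    show "hw_mor r \<odot> idn (Suc b) = (hw_mor ((Suc 0, 0) # r) \<odot> idn b) * ?A + ((hw_mor ((0, 0) # r) \<odot> idn b) + (hw_mor ((0, Suc 0) # r) \<odot> idn b) * ?C)"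
      unfolding hw_mor hw_mor_Suc_split[OF assms l] tens_add using assms l
      by (subst (1 2) comp_tens_idn) simp_all
  qed
qed

text \<open>The induction trades letters for strands: a word of length \<open>m\<close> tensored
  with \<open>Suc b\<close> strands is a combination of its one-letter extensions tensored with
  \<open>b\<close> strands. When no letter is left, the test morphism is an identity.\<close>

lemma eq_if_eq_on_hw_mor:
  fixes X Y :: "'k::field mo"
  assumes "dm X = m + b" "dm Y = m + b"
    and "\<And>r. hw r \<Longrightarrow> length r = m \<Longrightarrow> X * (hw_mor r \<odot> idn b) = Y * (hw_mor r \<odot> idn b)"
  shows "X = Y"
  using assms
proof (induction m arbitrary: b)
  case 0
  then show ?case using "0.prems"(3)[of "[]"] by simp
next
  case (Suc m)
  show ?case
  proof (rule Suc.IH[of "Suc b"])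
    fix r assume r: "hw r" "length r = m"
    obtain A where A: 
      "height r = 0 \<Longrightarrow> hw_mor r \<odot> idn (Suc b) = (hw_mor ((Suc 0, 0) # r) \<odot> idn b) * A + (hw_mor ((0, 0) # r) \<odot> (idn b :: 'k::field mo))"
      "\<And>l. height r = Suc l \<Longrightarrow> \<exists>C :: 'k mo. 
        hw_mor r \<odot> idn (Suc b) = (hw_mor ((Suc 0, 0) # r) \<odot> idn b) * A + ((hw_mor ((0, 0) # r) \<odot> idn b) + (hw_mor ((0, Suc 0) # r) \<odot> idn b) * C)"
      using hw_mor_split[OF r(1), of b, where 'k = 'k] by metis
    have eq: "X * (hw_mor (x # r) \<odot> idn b) = Y * (hw_mor (x # r) \<odot> idn b)" if "hw (x # r)" for x
      using Suc.prems(3)[of "x # r"] that r by simp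
    show "X * (hw_mor r \<odot> idn (Suc b)) = Y * (hw_mor r \<odot> idn (Suc b))"
    proof (cases "height r")
      case 0
      show ?thesis
        unfolding A(1)[OF 0] distrib_left mult.assoc[symmetric] using r by (simp add: eq del: hw_mor_simps)
    next
      case (Suc l)
      then obtain C where C: "hw_mor r \<odot> idn (Suc b) = (hw_mor ((Suc 0, 0) # r) \<odot> idn b) * A + ((hw_mor ((0, 0) # r) \<odot> idn b) + (hw_mor ((0, Suc 0) # r) \<odot> idn b) * C)"
        using A(2) by blast
      show ?thesis
        unfolding C distrib_left mult.assoc[symmetric] using r Suc
        by (simp add: eq del: hw_mor_simps)
    qed
  qed (use Suc.prems in simp_all)
qed

text \<open>Interchange writes a tensor product as a composite of whiskered factors, so no tensor
  case remains. This serves properties that do not visibly pass to tensor products, such as carrying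
  each \<open>hw_mor r\<close> into the span of the others.\<close>

lemma mo_whisker_induct [consumes 1, case_names gen idn comp zer add scale]:
  fixes f :: "'k::field mo"
  assumes "arr f"
    and gen: "\<And>a x b. Q (idn a \<odot> gen x \<odot> idn b)"
    and idn: "\<And>n. Q (idn n)"
    and comp: "\<And>f g. arr f \<Longrightarrow> arr g \<Longrightarrow> cd f = dm g \<Longrightarrow> Q f \<Longrightarrow> Q g \<Longrightarrow> Q (g * f)"
    and zer: "\<And>m n. Q (zer m n)"
    and add: "\<And>f g. arr f \<Longrightarrow> arr g \<Longrightarrow> dm f = dm g \<Longrightarrow> cd f = cd g \<Longrightarrow> Q f \<Longrightarrow> Q g \<Longrightarrow> Q (f + g)"
    and scale: "\<And>a f. arr f \<Longrightarrow> Q f \<Longrightarrow> Q (a \<bullet> f)"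
  shows "Q f"
proof -
  \<comment> \<open>Both whiskers are arbitrary in the induction because the tensor case enlarges
    them.\<close>
  have "Q (idn a \<odot> abs_mo t \<odot> idn b)" if "typed t" for a b and t :: "'k tm"
    using that
  proof (induction t arbitrary: a b)
    case (TGen x)
    then show ?case using gen[of a x b] by (simp add: gen.abs_eq)
  next
    case (TId w)
    have "abs_mo (TId w) = (idn (length w) :: 'k mo)" by (simp add: idn.abs_eq)
    then show ?case by (simp add: idn)
  next
    case (TComp g f)
    have t: "arr (abs_mo f)" "arr (abs_mo g)" "cd (abs_mo f) = dm (abs_mo g)"
      using TComp.prems by (simp_all add: arr.abs_eq cd.abs_eq dm.abs_eq)
    then have "idn a \<odot> (abs_mo g * abs_mo f) \<odot> idn b =
      (idn a \<odot> abs_mo g \<odot> idn b) * (idn a \<odot> abs_mo f \<odot> idn b)"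
      by (simp add: tens_comp)
    moreover have "Q ((idn a \<odot> abs_mo g \<odot> idn b) * (idn a \<odot> abs_mo f \<odot> idn b))"
      using t TComp by (intro comp) simp_all
    ultimately show ?case by (simp add: times_mo.abs_eq)
  next
    case (TTens f g)
    have t: "arr (abs_mo f)" "arr (abs_mo g)"
      using TTens.prems by (simp_all add: arr.abs_eq)
    let ?f = "abs_mo f" and ?g = "abs_mo g"
    have "(idn a \<odot> ?f \<odot> idn (cd ?g + b)) * (idn (a + dm ?f) \<odot> ?g \<odot> idn b) = idn a \<odot> (?f \<odot> ?g) \<odot> idn b"
    proof -
      have "idn (a + dm ?f) \<odot> ?g \<odot> idn b = idn a \<odot> (idn (dm ?f) \<odot> ?g) \<odot> idn b"
        by (simp add: tens_assoc[symmetric])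
      moreover have "idn a \<odot> ?f \<odot> idn (cd ?g + b) = idn a \<odot> (?f \<odot> idn (cd ?g)) \<odot> idn b"
        by (simp add: tens_assoc)
      moreover have "(?f \<odot> idn (cd ?g)) * (idn (dm ?f) \<odot> ?g) = ?f \<odot> ?g"
        by (simp add: tens_comp)
      ultimately show ?thesis using t by (simp add: tens_comp)
    qed
    moreover have "Q ((idn a \<odot> ?f \<odot> idn (cd ?g + b)) * (idn (a + dm ?f) \<odot> ?g \<odot> idn b))"
      using t TTens by (intro comp) simp_all
    ultimately show ?case by (simp add: tens.abs_eq)
  next
    case (TZero v w)
    have "abs_mo (TZero v w) = (zer (length v) (length w) :: 'k mo)" by (simp add: zer.abs_eq)
    then show ?case by (simp add: zer)
  next
    case (TAdd f g)
    have t: "arr (abs_mo f)" "arr (abs_mo g)" "dm (abs_mo f) = dm (abs_mo g)" "cd (abs_mo f) = cd (abs_mo g)"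
      using TAdd.prems by (simp_all add: arr.abs_eq cd.abs_eq dm.abs_eq)
    then show ?case
      using TAdd by (simp add: plus_mo.abs_eq[symmetric] tens_add add)
  next
    case (TScale c f)
    have t: "arr (abs_mo f)" using TScale.prems by (simp add: arr.abs_eq)
    then show ?case
      using TScale by (simp add: scale.abs_eq[symmetric] scale_tens scale)
  qed
  from this[of _ 0 0] have "typed t \<Longrightarrow> Q (abs_mo t)" for t by simp
  with \<open>arr f\<close> show ?thesis
    by (induction f rule: mo.abs_induct) (simp add: arr.abs_eq)
qed

section \<open>The category of matrices between crystals\<close>

text \<open>Equational axioms are inherited, so shrinking objects and hom-sets only calls for
  closure under the operations.\<close>

lemma (in strict_linear_monoidal_category) subcategory:
  assumes S: "S \<subseteq> Obj C" and H: "\<And>x y. x \<in> S \<Longrightarrow> y \<in> S \<Longrightarrow> H x y \<subseteq> Hom C x y"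
    and "Unit C \<in> S" "\<And>x y. x \<in> S \<Longrightarrow> y \<in> S \<Longrightarrow> TensO C x y \<in> S"
    and "\<And>x. x \<in> S \<Longrightarrow> Ident C x \<in> H x x"
    and "\<And>x y z f g. \<lbrakk>x \<in> S; y \<in> S; z \<in> S; f \<in> H x y; g \<in> H y z\<rbrakk> \<Longrightarrow> Comp C g f \<in> H x z"
    and "\<And>x y x' y' f g. \<lbrakk>x \<in> S; y \<in> S; x' \<in> S; y' \<in> S; f \<in> H x y; g \<in> H x' y'\<rbrakk>
      \<Longrightarrow> TensM C f g \<in> H (TensO C x x') (TensO C y y')"
    and "\<And>x y. \<lbrakk>x \<in> S; y \<in> S\<rbrakk> \<Longrightarrow> Zero C x y \<in> H x y"
    and "\<And>x y f g. \<lbrakk>x \<in> S; y \<in> S; f \<in> H x y; g \<in> H x y\<rbrakk> \<Longrightarrow> Add C f g \<in> H x y"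
    and "\<And>x y a f. \<lbrakk>x \<in> S; y \<in> S; f \<in> H x y\<rbrakk> \<Longrightarrow> Scale C a f \<in> H x y"
  shows "strict_linear_monoidal_category (C\<lparr>Obj := S, Hom := H\<rparr>)"
proof -
  note closed = assms(3-)
  have S': "x \<in> Obj C" if "x \<in> S" for x using S that by blast
  have H': "f \<in> Hom C x y" if "x \<in> S" "y \<in> S" "f \<in> H x y" for x y f using H that by blast
  show ?thesis
    by (rule strict_linear_monoidal_category.intro; simp;
      ((rule closed; assumption) | (rule Comp_assoc Comp_Ident Ident_Comp
        TensO_assoc TensO_Unit Unit_TensO TensM_assoc TensM_Unit Unit_TensM TensM_Ident tensor_Comp
        Add_assoc Add_commute Add_Zero Add_minus Scale_one Scale_Scale Scale_add Scale_Add
        Comp_Add_left Comp_Add_right Comp_Scale_left Comp_Scale_right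
        TensM_Add_left TensM_Add_right TensM_Scale_left TensM_Scale_right;
        ((rule S'; assumption) | (rule H'; assumption)))))
qed

section \<open>Words as elements of tensor product crystals\<close>

abbreviation words :: "nat list list \<Rightarrow> letter list set" where
  "words v \<equiv> elems (word_crystal v)"

lemma words_Nil [simp]: "words [] = {[]}"
  by (simp add: word_crystal_def)

lemma words_Cons: "words (ks # v) = (\<lambda>(x, w). x # w) ` (elems (direct_sum (map hw_crystal ks)) \<times> words v)"
  by (simp add: word_crystal_def transport_crystal_def tensor_crystal_def)

lemma finite_words [simp]: "finite (words v)"
proof (induction v)
  case (Cons ks v)
  have "elems (direct_sum (map hw_crystal ks)) \<subseteq> (\<Union>i<length ks. Pair i ` elems (hw_crystal (ks ! i)))"
    by (auto simp: direct_sum_def)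
  then have "finite (elems (direct_sum (map hw_crystal ks)))"
    by (rule finite_subset) (auto simp: hw_crystal_def)
  with Cons show ?case by (simp add: words_Cons)
qed simp

lemma length_words: "w \<in> words v \<Longrightarrow> length w = length v"
  by (induction v arbitrary: w) (auto simp: words_Cons)

lemma words_append: "words (v @ w) = (\<lambda>(x, y). x @ y) ` (words v \<times> words w)"
proof (induction v)
  case Nil
  then show ?case by (auto simp: image_iff)
next
  case (Cons ks v)
  then show ?case by (force simp: words_Cons image_iff)
qed

lemma mem_words_append: "b \<in> words (v @ w) \<longleftrightarrow> take (length v) b \<in> words v \<and> drop (length v) b \<in> words w"
proof
  assume "b \<in> words (v @ w)"
  then obtain x y where "b = x @ y" "x \<in> words v" "y \<in> words w" by (auto simp: words_append)
  moreover from this have "length x = length v" by (simp add: length_words)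
  ultimately show "take (length v) b \<in> words v \<and> drop (length v) b \<in> words w" by simp
next
  assume "take (length v) b \<in> words v \<and> drop (length v) b \<in> words w"
  then show "b \<in> words (v @ w)"
    unfolding words_append image_iff by (intro bexI[of _ "(take (length v) b, drop (length v) b)"]) auto
qed

lemma sum_words_append:
  "(\<Sum>c\<in>words (v @ w). f (take (length v) c) (drop (length v) c)) = (\<Sum>x\<in>words v. \<Sum>y\<in>words w. f x y)"
proof -
  have inj: "inj_on (\<lambda>(x, y). x @ y) (words v \<times> words w)"
    by (auto simp: inj_on_def dest!: length_words)
  have "(\<Sum>c\<in>words (v @ w). f (take (length v) c) (drop (length v) c)) =
    (\<Sum>(x, y)\<in>words v \<times> words w. f (take (length v) (x @ y)) (drop (length v) (x @ y)))"
    unfolding words_append by (subst sum.reindex[OF inj]) (auto simp: case_prod_unfold)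
  also have "\<dots> = (\<Sum>(x, y)\<in>words v \<times> words w. f x y)"
    by (rule sum.cong) (auto simp: length_words)
  finally show ?thesis by (simp add: sum.cartesian_product)
qed

definition supported :: "nat list list \<Rightarrow> nat list list \<Rightarrow> (letter list \<Rightarrow> letter list \<Rightarrow> 'k::field) set" where
  "supported v w = {M. \<forall>b d. M b d \<noteq> 0 \<longrightarrow> b \<in> words v \<and> d \<in> words w}"

text \<open>An ambient category with all matrices supported on the words: the axioms are linear
  algebra there, and \<open>CrysMo\<close> is later cut out of it.\<close>

definition Mat :: "(nat list list, 'k::field crystal_mor, 'k) linear_monoidal" where
  "Mat = sl2_Crys\<lparr>Hom := \<lambda>v w. {(v, w, M) | M. M \<in> supported v w}\<rparr>"

lemma Mat_simps [simp]:
  "Obj Mat = UNIV"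
  "Hom Mat v w = (\<lambda>M. (v, w, M)) ` supported v w"
  "Ident Mat v = (v, v, \<lambda>b d. if b \<in> words v \<and> b = d then 1 else 0)"
  "Comp Mat (v', w', N) (v, w, M) = (v, w', \<lambda>b d. \<Sum>c\<in>words w. M b c * N c d)"
  "Unit Mat = []"
  "TensO Mat = (@)"
  "TensM Mat (v, w, M) (v', w', N) = (v @ v', w @ w',
      \<lambda>b d. M (take (length v) b) (take (length w) d) * N (drop (length v) b) (drop (length w) d))"
  "Zero Mat v w = (v, w, 0)"
  "Add Mat (v, w, M) (v', w', N) = (v, w, M + N)"
  "Scale Mat a (v, w, M) = (v, w, mat_scale a M)"
  by (auto simp add: Mat_def sl2_Crys_def)

lemma triple_mem_image [simp]: "(a, b, M) \<in> (\<lambda>M. (v, w, M)) ` S \<longleftrightarrow> a = v \<and> b = w \<and> M \<in> S"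
  by auto

lemma supported_0: "M \<in> supported v w \<Longrightarrow> b \<notin> words v \<Longrightarrow> M b d = 0"
   "M \<in> supported v w \<Longrightarrow> d \<notin> words w \<Longrightarrow> M b d = 0"
  by (auto simp: supported_def)

lemma sum_eq_nonzero:
  assumes "sum f A \<noteq> (0::'a::comm_monoid_add)" obtains x where "x \<in> A" "f x \<noteq> 0"
  using assms sum.neutral by metis

lemma strict_linear_monoidal_category_Mat:
  "strict_linear_monoidal_category (Mat :: (nat list list, 'k::field crystal_mor, 'k) linear_monoidal)"
proof
  fix w x y z :: "nat list list" and f g h :: "'k crystal_mor"
  assume "f \<in> Hom Mat w x" "g \<in> Hom Mat x y" "h \<in> Hom Mat y z"
  then show "Comp Mat (Comp Mat h g) f = Comp Mat h (Comp Mat g f)"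
    by (auto simp: fun_eq_iff sum_distrib_left sum_distrib_right mult.assoc intro: sum.swap)
next
  fix x y :: "nat list list" and f :: "'k crystal_mor"
  assume f: "f \<in> Hom Mat x y"
  have "(\<Sum>c\<in>words x. (if b \<in> words x \<and> b = c then 1 else 0) * M c d) = M b d"
    "(\<Sum>c\<in>words y. M b c * (if c \<in> words y \<and> c = d then 1 else 0)) = M b d"
    if "M \<in> supported x y" for M :: "letter list \<Rightarrow> letter list \<Rightarrow> 'k" and b d
  proof -
    have "(\<Sum>c\<in>words x. (if b \<in> words x \<and> b = c then 1 else 0) * M c d) =
        (\<Sum>c\<in>words x. if b = c then M b d else 0)"
      by (rule sum.cong) auto
    then show "(\<Sum>c\<in>words x. (if b \<in> words x \<and> b = c then 1 else 0) * M c d) = M b d"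
      using that by (simp add: supported_0)
    have "(\<Sum>c\<in>words y. M b c * (if c \<in> words y \<and> c = d then 1 else 0)) =
        (\<Sum>c\<in>words y. if d = c then M b d else 0)"
      by (rule sum.cong) auto
    then show "(\<Sum>c\<in>words y. M b c * (if c \<in> words y \<and> c = d then 1 else 0)) = M b d"
      using that by (simp add: supported_0)
  qed
  then show "Comp Mat f (Ident Mat x) = f" "Comp Mat (Ident Mat y) f = f"
    using f by (auto simp: fun_eq_iff)
  \<comment> \<open>A nonzero entry of \<open>M\<close> has row and column words of the right
    lengths, so dropping leaves nothing.\<close>
  have "M (take (length x) b) (take (length y) d) *
      (if drop (length x) b = [] \<and> drop (length x) b = drop (length y) d then 1 else 0) = M b d"
    if "M \<in> supported x y" for M :: "letter list \<Rightarrow> letter list \<Rightarrow> 'k" and b d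
    using that by (cases "M b d = 0") (force simp: supported_def length_words)+
  then show "TensM Mat f (Ident Mat (Unit Mat)) = f"
    using f by (auto simp: fun_eq_iff)
  show "TensM Mat (Ident Mat (Unit Mat)) f = f"
    using f by (auto simp: fun_eq_iff)
next
  fix x y z x' y' z' :: "nat list list" and f g f' g' :: "'k crystal_mor"
  assume f: "f \<in> Hom Mat x y" and g: "g \<in> Hom Mat y z" and f': "f' \<in> Hom Mat x' y'" and g': "g' \<in> Hom Mat y' z'"
  show "TensM Mat (Comp Mat g f) (Comp Mat g' f') = Comp Mat (TensM Mat g g') (TensM Mat f f')"
  proof -
    have "(\<Sum>c\<in>words y. F (take (length x) b) c * G c (take (length z) d)) *
        (\<Sum>c\<in>words y'. F' (drop (length x) b) c * G' c (drop (length z) d)) =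
      (\<Sum>c\<in>words (y @ y').
          F (take (length x) b) (take (length y) c) * F' (drop (length x) b) (drop (length y) c) *
          (G (take (length y) c) (take (length z) d) * G' (drop (length y) c) (drop (length z) d)))"
      for F G F' G' :: "letter list \<Rightarrow> letter list \<Rightarrow> 'k" and b d
      unfolding sum_product
      by (subst sum_words_append[where f = "\<lambda>c c'. F (take (length x) b) c * F' (drop (length x) b) c' *
          (G c (take (length z) d) * G' c' (drop (length z) d))"]) (simp add: ac_simps)
    then show ?thesis using f g f' g' by (auto simp: fun_eq_iff)
  qed
next
  fix x y :: "nat list list"
  have "take (length x) b = take (length x) d \<and> drop (length x) b = drop (length x) d \<longleftrightarrow> b = d"
    for b d :: "letter list"
    by (metis append_take_drop_id)
  then show "TensM Mat (Ident Mat x) (Ident Mat y) = (Ident Mat (TensO Mat x y) :: 'k crystal_mor)"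
    by (auto simp: fun_eq_iff mem_words_append)
next
  fix x y z :: "nat list list" and f g :: "'k crystal_mor"
  assume "f \<in> Hom Mat x y" "g \<in> Hom Mat y z"
  then show "Comp Mat g f \<in> Hom Mat x z"
    by (auto simp: supported_def elim!: sum_eq_nonzero)
next
  fix x y :: "nat list list" and f g :: "'k crystal_mor"
  assume "f \<in> Hom Mat x y" "g \<in> Hom Mat x y"
  then show "Add Mat f g \<in> Hom Mat x y"
    by (auto simp: supported_def) (metis add.right_neutral)+
qed (auto simp: supported_def fun_eq_iff mem_words_append mat_scale_def algebra_simps drop_take sum.distrib sum_distrib_left)

section \<open>Crystal operators on words\<close>

definition pw :: "nat \<Rightarrow> nat list list" where "pw n = replicate n [1, 0]"

lemma length_pw [simp]: "length (pw n) = n"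
  by (simp add: pw_def)

lemma pw_append: "pw m @ pw n = pw (m + n)"
  by (simp add: pw_def replicate_add)

definition B_words :: "nat \<Rightarrow> letter list set" where "B_words n = words (pw n)"

text \<open>Evaluates \<open>eps\<close> and \<open>phi\<close>: if \<open>n\<close> drops by one
  along \<open>g\<close> and is 0 where \<open>g\<close> stops, exactly the iterates up to
  \<open>n x\<close> are defined.\<close>

lemma Max_iterate:
  fixes g :: "'a \<Rightarrow> 'a option" and n :: "'a \<Rightarrow> nat"
  assumes "x \<in> S"
    and step: "\<And>x. x \<in> S \<Longrightarrow> case g x of None \<Rightarrow> n x = 0 | Some y \<Rightarrow> y \<in> S \<and> n x = Suc (n y)"
  shows "Max {m. ((\<lambda>x. Option.bind x g) ^^ m) (Some x) \<noteq> None} = n x"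
proof -
  have None: "((\<lambda>x. Option.bind x g) ^^ m) None = None" for m
    by (induction m) auto
  have "((\<lambda>x. Option.bind x g) ^^ m) (Some x) \<noteq> None \<longleftrightarrow> m \<le> n x" for m
    using \<open>x \<in> S\<close>
  proof (induction m arbitrary: x)
    case (Suc m)
    then show ?case
      using step[OF Suc.prems] None
      by (cases "g x") (simp_all add: funpow_Suc_right del: funpow.simps(2) not_None_eq)
  qed simp
  then have "{m. ((\<lambda>x. Option.bind x g) ^^ m) (Some x) \<noteq> None} = {..n x}"
    by auto
  then show ?thesis by (auto intro!: Max_eqI)
qed

definition B_crystal :: "letter crystal" where
  "B_crystal = direct_sum (map hw_crystal [1, 0])"

lemma elems_B: "elems B_crystal = {(0, 0), (0, 1), (1, 0)}"
  by (auto simp: B_crystal_def direct_sum_def hw_crystal_def less_Suc_eq nth_Cons' split: if_splits)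

lemma B_simps:
  "e_op B_crystal (0, 0) = None" "e_op B_crystal (0, Suc 0) = Some (0, 0)" "e_op B_crystal (Suc 0, 0) = None"
  "f_op B_crystal (0, 0) = Some (0, Suc 0)" "f_op B_crystal (0, Suc 0) = None" "f_op B_crystal (Suc 0, 0) = None"
  "wt B_crystal (0, 0) = 1" "wt B_crystal (0, Suc 0) = -1" "wt B_crystal (Suc 0, 0) = 0"
  by (simp_all add: B_crystal_def direct_sum_def hw_crystal_def)

lemma phi_B: "x \<in> elems B_crystal \<Longrightarrow> phi B_crystal x = (if x = (0, 0) then 1 else 0)"
  unfolding phi_def
  by (rule Max_iterate[where S = "elems B_crystal" and n = "\<lambda>x. if x = (0, 0) then 1 else 0"])
    (auto simp: elems_B B_simps)

lemma B_words_0 [simp]: "B_words 0 = {[]}"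
  by (simp add: B_words_def pw_def)

lemma B_words_Suc: "B_words (Suc n) = (\<lambda>(x, w). x # w) ` ({(0, 0), (0, 1), (1, 0)} \<times> B_words n)"
  using elems_B by (simp add: B_words_def pw_def words_Cons B_crystal_def)

lemma Cons_in_B_words [simp]: "x # w \<in> B_words (Suc n) \<longleftrightarrow> x \<in> {(0, 0), (0, 1), (1, 0)} \<and> w \<in> B_words n"
  by (auto simp: B_words_Suc)

lemma B_words_iff: "w \<in> B_words n \<longleftrightarrow> length w = n \<and> set w \<subseteq> {(0, 0), (0, 1), (1, 0)}"
proof (induction n arbitrary: w)
  case (Suc n)
  then show ?case by (cases w) (auto simp: B_words_Suc)
qed auto

text \<open>The tensor rule gives \<open>\<epsilon>(b \<otimes> c) = \<epsilon>(b) + max 0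
  (\<epsilon>(c) - \<phi>(b))\<close>. The truncated subtraction is this maximum for a first letter
  \<open>(0, 0)\<close>, whose \<open>\<phi>\<close> is 1.\<close>

primrec epsw :: "letter list \<Rightarrow> nat" where
  "epsw [] = 0"
| "epsw (x # w) = (if x = (0, 0) then epsw w - 1 else if x = (0, 1) then Suc (epsw w) else epsw w)"

text \<open>The operator hits the first letter if its \<open>\<phi>\<close> is at least
  \<open>epsw w\<close>, that is for \<open>epsw w \<le> 1\<close> after \<open>(0, 0)\<close> and
  for \<open>epsw w = 0\<close> after the other letters. The last clause covers this for
  \<open>(1, 0)\<close> as well, because \<open>ew w\<close> is then \<open>None\<close>.\<close>

primrec ew :: "letter list \<Rightarrow> letter list option" where
  "ew [] = None"
| "ew (x # w) = (if x = (0, 0) \<and> epsw w \<le> 1 then None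
     else if x = (0, 1) \<and> epsw w = 0 then Some ((0, 0) # w)
     else map_option (Cons x) (ew w))"

primrec fw :: "letter list \<Rightarrow> letter list option" where
  "fw [] = None"
| "fw (x # w) = (if x = (0, 0) \<and> epsw w = 0 then Some ((0, 1) # w)
     else map_option (Cons x) (fw w))"

primrec wtw :: "letter list \<Rightarrow> int" where
  "wtw [] = 0"
| "wtw (x # w) = (if x = (0, 0) then 1 else if x = (0, 1) then -1 else 0) + wtw w"

lemma B_words_length: "w \<in> B_words n \<Longrightarrow> length w = n"
  by (simp add: B_words_iff)

lemma ew_None: "ew w = None \<longleftrightarrow> epsw w = 0"
  by (induction w) auto

lemma ew_Some: "ew w = Some w' \<Longrightarrow> epsw w = Suc (epsw w') \<and> (w \<in> B_words n \<longrightarrow> w' \<in> B_words n)"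
proof (induction w arbitrary: w' n)
  case (Cons x w)
  then show ?case
    by (cases n) (auto split: if_splits)
qed simp

lemma fw_Some: "fw w = Some w' \<Longrightarrow> epsw w' = Suc (epsw w) \<and> (w \<in> B_words n \<longrightarrow> w' \<in> B_words n)"
proof (induction w arbitrary: w' n)
  case (Cons x w)
  then show ?case
    by (cases n) (auto split: if_splits)
qed simp

lemma word_crystal_ops:
  "w \<in> B_words n \<Longrightarrow> e_op (word_crystal (pw n)) w = ew w \<and> f_op (word_crystal (pw n)) w = fw w
    \<and> wt (word_crystal (pw n)) w = wtw w"
proof (induction n arbitrary: w)
  case 0
  then show ?case by (simp add: word_crystal_def pw_def)
next
  case (Suc n)
  then obtain x v where w: "w = x # v" "x \<in> elems B_crystal" "v \<in> B_words n"
    by (auto simp: B_words_Suc elems_B)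
  let ?X = "word_crystal (pw n)"
  have eps: "eps ?X v = epsw v"
    unfolding eps_def
    by (rule Max_iterate[where S = "B_words n" and n = epsw])
      (use w Suc.IH in \<open>auto split: option.split simp: ew_None dest: ew_Some\<close>)
  have X: "word_crystal (pw (Suc n)) =
    transport_crystal (\<lambda>(b, bs). b # bs) (\<lambda>bs. (hd bs, tl bs)) (tensor_crystal B_crystal ?X)"
    by (simp add: word_crystal_def B_crystal_def pw_def)
  show ?case
    unfolding X using w Suc.IH[OF w(3)] eps phi_B[OF w(2)]
    by (auto simp: transport_crystal_def tensor_crystal_def elems_B B_simps option.map_comp comp_def
      ew_None)
qed

text \<open>Preservation of \<open>epsw\<close> is part of the notion because \<open>ew\<close> and
  \<open>fw\<close> on \<open>x # w\<close> choose where to act by inspecting \<open>epsw w\<close>.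
  This makes it stable under putting a letter in front.\<close>

definition wmap :: "nat \<Rightarrow> nat \<Rightarrow> (letter list \<Rightarrow> letter list option) \<Rightarrow> bool" where
  "wmap m n q \<longleftrightarrow> (\<forall>w\<in>B_words m. q w \<in> insert None (Some ` B_words n) \<and>
    (\<forall>w'. q w = Some w' \<longrightarrow> wtw w' = wtw w \<and> epsw w' = epsw w) \<and>
    Option.bind (ew w) q = Option.bind (q w) ew \<and> Option.bind (fw w) q = Option.bind (q w) fw)"

lemma wmap_strict:
  assumes q: "wmap m n q"
  shows "strict_morphism (word_crystal (pw m)) (word_crystal (pw n)) (\<lambda>x. Option.bind x q)"
proof -
  have *: "(q b \<in> insert None (Some ` B_words n)) \<and> (\<forall>d. q b = Some d \<longrightarrow> wt (word_crystal (pw n)) d = wt (word_crystal (pw m)) b)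
    \<and> Option.bind (e_op (word_crystal (pw m)) b) q = Option.bind (q b) (e_op (word_crystal (pw n)))
    \<and> Option.bind (f_op (word_crystal (pw m)) b) q = Option.bind (q b) (f_op (word_crystal (pw n)))"
    if "b \<in> B_words m" for b
  proof -
    have qb: "q b \<in> insert None (Some ` B_words n)" "\<forall>d. q b = Some d \<longrightarrow> wtw d = wtw b \<and> epsw d = epsw b"
      "Option.bind (ew b) q = Option.bind (q b) ew" "Option.bind (fw b) q = Option.bind (q b) fw"
      using q that unfolding wmap_def by blast+
    show ?thesis
    proof (cases "q b")
      case None
      then show ?thesis using qb word_crystal_ops[OF that] by simp
    next
      case (Some d)
      then have "d \<in> B_words n" using qb by auto
      with Some show ?thesis using qb word_crystal_ops[OF that] word_crystal_ops[of d n] by simp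
    qed
  qed
  then show ?thesis
    unfolding strict_morphism_def B_words_def[symmetric] Option.bind.simps by blast
qed

lemma wmap_Cons:
  assumes "wmap m n q"
  shows "wmap (Suc m) (Suc n) (\<lambda>w. map_option (Cons (hd w)) (q (tl w)))"
  unfolding wmap_def
proof
  fix w assume "w \<in> B_words (Suc m)"
  then obtain x v where w: "w = x # v" "x \<in> {(0, 0), (0, 1), (1, 0)}" "v \<in> B_words m"
    by (auto simp: B_words_Suc)
  have q: "q v \<in> insert None (Some ` B_words n)" "\<And>v'. q v = Some v' \<Longrightarrow> wtw v' = wtw v \<and> epsw v' = epsw v"
    "Option.bind (ew v) q = Option.bind (q v) ew" "Option.bind (fw v) q = Option.bind (q v) fw"
    using assms w(3) unfolding wmap_def by auto
  let ?q = "\<lambda>w. map_option (Cons (hd w)) (q (tl w))"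
  have bind: "Option.bind (map_option (Cons x) o1) ?q = map_option (Cons x) (Option.bind o1 q)" for x o1
    by (cases o1) auto
  have "Option.bind (ew w) ?q = Option.bind (?q w) ew"
    using w(2) q(2,3) unfolding w(1) by (cases "q v") (auto simp: bind)
  moreover have "Option.bind (fw w) ?q = Option.bind (?q w) fw"
    using w(2) q(2,4) unfolding w(1) by (cases "q v") (auto simp: bind)
  moreover have "?q w \<in> insert None (Some ` B_words (Suc n))"
    using w q(1) by auto
  moreover have "\<forall>w'. ?q w = Some w' \<longrightarrow> wtw w' = wtw w \<and> epsw w' = epsw w"
    using w q(2) by auto
  ultimately show "?q w \<in> insert None (Some ` B_words (Suc n)) \<and>
    (\<forall>w'. ?q w = Some w' \<longrightarrow> wtw w' = wtw w \<and> epsw w' = epsw w) \<and>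
    Option.bind (ew w) ?q = Option.bind (?q w) ew \<and> Option.bind (fw w) ?q = Option.bind (?q w) fw"
    by blast
qed

text \<open>The tail \<open>w\<close> is arbitrary, so one function describes the generator tensored
  with any identity on its right.\<close>

fun gen_op :: "mo_gen \<Rightarrow> letter list \<Rightarrow> letter list option" where
  "gen_op Eta w = Some ((1, 0) # w)"
| "gen_op Theta (x # w) = (if x = (1, 0) then Some w else None)"
| "gen_op Cup w = Some ((0, 0) # (0, 1) # w)"
| "gen_op Cap (x # y # w) = (if x = (0, 0) \<and> y = (0, 1) then Some w else None)"
| "gen_op _ _ = None"

lemma bind_gen_op:
  "Option.bind o1 (gen_op Eta) = map_option (Cons (1, 0)) o1"
  "Option.bind o1 (gen_op Cup) = map_option (\<lambda>w. (0, 0) # (0, 1) # w) o1"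
  by (cases o1; simp)+

lemma B_words_cases_Suc:
  assumes "w \<in> B_words (Suc n)"
  obtains x v where "w = x # v" "v \<in> B_words n" "x = (0, 0) \<or> x = (0, Suc 0) \<or> x = (Suc 0, 0)"
  using assms by (auto simp: B_words_Suc)

lemma wmap_gen_op: "wmap (length (mo_dom x) + b) (length (mo_cod x) + b) (gen_op x)"
proof (cases x)
  case Eta
  then show ?thesis by (auto simp: wmap_def bind_gen_op)
next
  case Theta
  have "gen_op Theta w \<in> insert None (Some ` B_words b) \<and>
    (\<forall>w'. gen_op Theta w = Some w' \<longrightarrow> wtw w' = wtw w \<and> epsw w' = epsw w) \<and>
    Option.bind (ew w) (gen_op Theta) = Option.bind (gen_op Theta w) ew \<and>
    Option.bind (fw w) (gen_op Theta) = Option.bind (gen_op Theta w) fw" if "w \<in> B_words (Suc b)" for w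
    using that
  proof (rule B_words_cases_Suc)
    fix x v assume "w = x # v" "v \<in> B_words b" "x = (0, 0) \<or> x = (0, Suc 0) \<or> x = (Suc 0, 0)"
    then show ?thesis by (cases "ew v"; cases "fw v"; auto)
  qed
  then show ?thesis by (simp add: Theta wmap_def)
next
  case Cup
  then show ?thesis by (auto simp: wmap_def ew_None bind_gen_op option.map_comp comp_def)
next
  case Cap
  have "gen_op Cap w \<in> insert None (Some ` B_words b) \<and>
    (\<forall>w'. gen_op Cap w = Some w' \<longrightarrow> wtw w' = wtw w \<and> epsw w' = epsw w) \<and>
    Option.bind (ew w) (gen_op Cap) = Option.bind (gen_op Cap w) ew \<and>
    Option.bind (fw w) (gen_op Cap) = Option.bind (gen_op Cap w) fw" if w2: "w \<in> B_words (Suc (Suc b))" for w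
  proof -
    obtain x w' where 1: "w = x # w'" "w' \<in> B_words (Suc b)" "x = (0, 0) \<or> x = (0, Suc 0) \<or> x = (Suc 0, 0)"
      using w2 by (rule B_words_cases_Suc)
    obtain y v where 2: "w' = y # v" "v \<in> B_words b" "y = (0, 0) \<or> y = (0, Suc 0) \<or> y = (Suc 0, 0)"
      using 1(2) by (rule B_words_cases_Suc)
    have w: "w = x # y # v" using 1 2 by simp
    show ?thesis
      using 1(3) 2(2,3) ew_None[of v] unfolding w
      by (elim disjE; cases "ew v"; cases "fw v"; simp)
  qed
  then show ?thesis by (simp add: Cap wmap_def)
qed

fun gen_at :: "nat \<Rightarrow> mo_gen \<Rightarrow> letter list \<Rightarrow> letter list option" where
  "gen_at 0 x w = gen_op x w"
| "gen_at (Suc a) x w = map_option (Cons (hd w)) (gen_at a x (tl w))"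

lemma wmap_gen_at: "wmap (a + length (mo_dom x) + b) (a + length (mo_cod x) + b) (gen_at a x)"
proof (induction a)
  case 0
  then show ?case using wmap_gen_op[of x b] by (simp add: wmap_def)
next
  case (Suc a)
  from wmap_Cons[OF Suc] show ?case by (simp add: fun_eq_iff)
qed

section \<open>The functor to crystals\<close>

definition maps :: "nat \<Rightarrow> nat \<Rightarrow> (letter list \<Rightarrow> letter list option) \<Rightarrow> bool" where
  "maps m n q \<longleftrightarrow> (\<forall>w\<in>B_words m. q w \<in> insert None (Some ` B_words n))"

definition partial_mor :: "nat \<Rightarrow> nat \<Rightarrow> (letter list \<Rightarrow> letter list option) \<Rightarrow> 'k::field crystal_mor" where
  "partial_mor m n q = (pw m, pw n, \<lambda>b d. if b \<in> B_words m \<and> q b = Some d then 1 else 0)"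

lemma B_words_append: "w \<in> B_words (m + n) \<longleftrightarrow> take m w \<in> B_words m \<and> drop m w \<in> B_words n"
  unfolding B_words_def pw_append[symmetric] mem_words_append by simp

lemma partial_mor_cong: "(\<And>w. w \<in> B_words m \<Longrightarrow> q w = q' w) \<Longrightarrow> partial_mor m n q = partial_mor m n q'"
  by (auto simp: partial_mor_def fun_eq_iff)

lemma Ident_partial: "Ident Mat (pw n) = partial_mor n n Some"
  by (auto simp: partial_mor_def B_words_def)

lemma Zero_partial: "Zero Mat (pw m) (pw n) = partial_mor m n (\<lambda>_. None)"
  by (auto simp: partial_mor_def fun_eq_iff)

lemma Comp_partial:
  assumes q: "maps m n q"
  shows "Comp Mat (partial_mor n p q') (partial_mor m n q) =
    (partial_mor m p (\<lambda>w. Option.bind (q w) q') :: 'k::field crystal_mor)"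
proof -
  have "(\<Sum>c\<in>B_words n. (if b \<in> B_words m \<and> q b = Some c then 1 else 0) * (if c \<in> B_words n \<and> q' c = Some d then 1 else 0))
    = (if b \<in> B_words m \<and> Option.bind (q b) q' = Some d then 1 else (0 :: 'k))" for b d
  proof (cases "b \<in> B_words m \<and> q b \<noteq> None")
    case True
    then obtain c0 where c0: "q b = Some c0" "c0 \<in> B_words n" using q by (auto simp: maps_def)
    then have "(\<Sum>c\<in>B_words n. (if b \<in> B_words m \<and> q b = Some c then 1 else 0) * (if c \<in> B_words n \<and> q' c = Some d then 1 else (0 :: 'k)))
      = (\<Sum>c\<in>B_words n. if c0 = c then (if q' c0 = Some d then 1 else 0) else 0)"
      using True by (intro sum.cong) auto
    also have "\<dots> = (if q' c0 = Some d then 1 else 0)"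
      using c0 by (simp add: B_words_def)
    finally show ?thesis using True c0 by simp
  next
    case False
    then have "(\<Sum>c\<in>B_words n. (if b \<in> B_words m \<and> q b = Some c then 1 else 0) * (if c \<in> B_words n \<and> q' c = Some d then 1 else (0 :: 'k))) = 0"
      by (intro sum.neutral) auto
    with False show ?thesis by auto
  qed
  then show ?thesis by (simp add: partial_mor_def B_words_def)
qed

definition tens_op :: "nat \<Rightarrow> (letter list \<Rightarrow> letter list option) \<Rightarrow> (letter list \<Rightarrow> letter list option)
    \<Rightarrow> letter list \<Rightarrow> letter list option" where
  "tens_op m q q' w = (case q (take m w) of None \<Rightarrow> None | Some x \<Rightarrow> map_option ((@) x) (q' (drop m w)))"

lemma TensM_partial:
  assumes q: "maps m n q" "maps m' n' q'"
  shows "TensM Mat (partial_mor m n q) (partial_mor m' n' q') =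
    (partial_mor (m + m') (n + n') (tens_op m q q') :: 'k::field crystal_mor)"
proof -
  have "take m b \<in> B_words m \<and> q (take m b) = Some (take n d) \<and> drop m b \<in> B_words m' \<and> q' (drop m b) = Some (drop n d)
    \<longleftrightarrow> b \<in> B_words (m + m') \<and> tens_op m q q' b = Some d" for b d
  proof -
    have "length x = n" if "take m b \<in> B_words m" "q (take m b) = Some x" for x
    proof -
      have "q (take m b) \<in> insert None (Some ` B_words n)" using q(1) that(1) unfolding maps_def by blast
      then show ?thesis using that(2) B_words_length by auto
    qed
    then show ?thesis
      unfolding B_words_append tens_op_def
      by (auto split: option.split)
  qed
  then show ?thesis
    by (auto simp add: partial_mor_def pw_append fun_eq_iff)
qed

text \<open>Attaches a partial map of words to a 0/1 matrix, so that composites and tensor products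
  of generators are computed on words instead of by matrix sums.\<close>

definition is_partial :: "'k::field crystal_mor \<Rightarrow> nat \<Rightarrow> nat \<Rightarrow> (letter list \<Rightarrow> letter list option) \<Rightarrow> bool" where
  "is_partial X m n q \<longleftrightarrow> X = partial_mor m n q \<and> maps m n q"

lemma is_partial_Comp:
  assumes X: "is_partial X m n q" and Y: "is_partial Y n' p q'" and n: "n = n'"
  shows "is_partial (Comp Mat Y X) m p (\<lambda>w. Option.bind (q w) q')"
proof -
  have "Option.bind (q w) q' \<in> insert None (Some ` B_words p)" if "w \<in> B_words m" for w
  proof -
    have "q w \<in> insert None (Some ` B_words n)"
      using X that unfolding is_partial_def maps_def by blast
    then show ?thesis
      using Y n unfolding is_partial_def maps_def by (cases "q w") auto
  qed
  then show ?thesis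
    using X Y n unfolding is_partial_def by (auto simp: Comp_partial maps_def)
qed

lemma is_partial_TensM:
  "is_partial X m n q \<Longrightarrow> is_partial Y m' n' q' \<Longrightarrow> is_partial (TensM Mat X Y) (m + m') (n + n') (tens_op m q q')"
  unfolding is_partial_def
  by (auto simp: TensM_partial)
    (fastforce simp: maps_def tens_op_def B_words_append B_words_length split: option.split)

lemma is_partial_Ident: "is_partial (Ident Mat (pw n)) n n Some"
  unfolding is_partial_def Ident_partial by (simp add: maps_def)

lemma is_partial_Zero: "is_partial (Zero Mat (pw m) (pw n)) m n (\<lambda>_. None)"
  unfolding is_partial_def Zero_partial by (simp add: maps_def)

definition gen_mor :: "mo_gen \<Rightarrow> 'k::field crystal_mor" where
  "gen_mor x = partial_mor (length (mo_dom x)) (length (mo_cod x)) (gen_op x)"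

lemma is_partial_gen: "is_partial (gen_mor x) (length (mo_dom x)) (length (mo_cod x)) (gen_op x)"
  unfolding is_partial_def gen_mor_def using wmap_gen_op[of x 0] by (simp add: maps_def wmap_def)

lemma is_partial_eq:
  assumes "is_partial X m n q" "is_partial Y m' n' q'" "m = m'" "n = n'" "\<And>w. w \<in> B_words m \<Longrightarrow> q w = q' w"
  shows "X = Y"
  using assms unfolding is_partial_def by (auto intro: partial_mor_cong)

abbreviation ev :: "'k::field tm \<Rightarrow> 'k crystal_mor" where
  "ev \<equiv> eval Mat (\<lambda>_. motzkin_B) gen_mor"

lemma eval_object_Mat: "eval_object Mat (\<lambda>_. motzkin_B) w = pw (length w)"
  by (induction w) (auto simp: pw_def motzkin_B_def)

interpretation Mat: strict_linear_monoidal_category Mat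
  by (rule strict_linear_monoidal_category_Mat)

lemma gen_mor_in:
  "gen_mor x \<in> Hom Mat (eval_object Mat (\<lambda>_. motzkin_B) (mo_dom x)) (eval_object Mat (\<lambda>_. motzkin_B) (mo_cod x))"
  using is_partial_gen[of x]
  unfolding eval_object_Mat gen_mor_def partial_mor_def is_partial_def maps_def
  by (auto simp: supported_def B_words_def[symmetric])

lemmas is_partial_rules =
  is_partial_Comp is_partial_TensM is_partial_gen is_partial_Ident is_partial_Zero

text \<open>Every relation starts from at most one strand, so the partial maps of both sides are
  compared on words of length at most 1.\<close>

lemma ev_relations: "(s, t) \<in> mo_relations \<Longrightarrow> ev s = ev t"
  unfolding mo_relations_def Let_def insert_iff empty_iff prod.inject simp_thms
  by (elim disjE conjE; simp only: eval.simps eval_object_Mat;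
      (rule is_partial_eq, (rule is_partial_rules | (simp; fail))+); auto simp: B_words_Suc tens_op_def)

text \<open>Evaluates a chosen representative. For arrows soundness makes the value independent of
  the choice, which is why the rules below assume \<open>arr\<close>.\<close>

definition crys_of :: "'k::field mo \<Rightarrow> 'k crystal_mor" where
  "crys_of f = ev (rep_mo f)"

definition mat_of :: "'k::field mo \<Rightarrow> letter list \<Rightarrow> letter list \<Rightarrow> 'k" where
  "mat_of f = snd (snd (crys_of f))"

lemma mo_equiv_ev:
  assumes "mo_equiv s t" "typed t"
  shows "ev s = ev t"
proof -
  have "mo_eq (word (tdom s)) (word (tcod s)) s t"
    using assms unfolding mo_equiv_def by blast
  then show ?thesis
    by (rule Mat.eval_respects_term_eq[OF _ gen_mor_in, rotated 2]) (simp, erule ev_relations)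
qed

lemma mo_equiv_rep_abs: "mo_equiv (rep_mo (abs_mo t)) t"
  by (rule Quotient3_rep_abs[OF Quotient3_mo equivp_reflp[OF mo_equivp]])

lemma crys_of_abs [simp]: "typed t \<Longrightarrow> crys_of (abs_mo t) = ev t"
  unfolding crys_of_def by (rule mo_equiv_ev) (simp_all add: mo_equiv_rep_abs)

lemma arr_cases:
  assumes "arr f" obtains t where "f = abs_mo t" "typed t" "tdom t = dm f" "tcod t = cd f"
proof -
  obtain t where t: "f = abs_mo t" by (metis Quotient3_abs_rep[OF Quotient3_mo])
  with assms that show ?thesis by (simp add: arr.abs_eq dm.abs_eq cd.abs_eq)
qed

lemma crys_of_ops:
  "arr f \<Longrightarrow> arr g \<Longrightarrow> cd f = dm g \<Longrightarrow> crys_of (g * f) = Comp Mat (crys_of g) (crys_of f)"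
  "arr f \<Longrightarrow> arr g \<Longrightarrow> crys_of (f \<odot> g) = TensM Mat (crys_of f) (crys_of g)"
  "arr f \<Longrightarrow> arr g \<Longrightarrow> dm f = dm g \<Longrightarrow> cd f = cd g \<Longrightarrow> crys_of (f + g) = Add Mat (crys_of f) (crys_of g)"
  "arr f \<Longrightarrow> crys_of (a \<bullet> f) = Scale Mat a (crys_of f)"
  "crys_of (gen x) = gen_mor x"
  "crys_of (idn n) = Ident Mat (pw n)"
  "crys_of (zer m n) = Zero Mat (pw m) (pw n)"
proof -
  show "crys_of (gen x) = gen_mor x" by (simp add: gen.abs_eq)
  show "crys_of (idn n) = Ident Mat (pw n)" by (simp add: idn.abs_eq eval_object_Mat)
  show "crys_of (zer m n) = Zero Mat (pw m) (pw n)"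
    by (simp add: zer.abs_eq eval_object_Mat del: Mat_simps)
  show "arr f \<Longrightarrow> arr g \<Longrightarrow> cd f = dm g \<Longrightarrow> crys_of (g * f) = Comp Mat (crys_of g) (crys_of f)"
    by (elim arr_cases) (simp add: times_mo.abs_eq)
  show "arr f \<Longrightarrow> arr g \<Longrightarrow> crys_of (f \<odot> g) = TensM Mat (crys_of f) (crys_of g)"
    by (elim arr_cases) (simp add: tens.abs_eq)
  show "arr f \<Longrightarrow> arr g \<Longrightarrow> dm f = dm g \<Longrightarrow> cd f = cd g \<Longrightarrow> crys_of (f + g) = Add Mat (crys_of f) (crys_of g)"
    by (elim arr_cases) (simp add: plus_mo.abs_eq)
  show "arr f \<Longrightarrow> crys_of (a \<bullet> f) = Scale Mat a (crys_of f)"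
    by (elim arr_cases) (simp add: scale.abs_eq)
qed

lemma crys_of_in_Hom: "arr f \<Longrightarrow> crys_of f \<in> Hom Mat (pw (dm f)) (pw (cd f))"
proof (elim arr_cases)
  fix t assume t: "f = abs_mo t" "typed t"
  have "ev t \<in> Hom Mat (pw (tdom t)) (pw (tcod t))"
    using Mat.eval_in_Hom[OF _ gen_mor_in t(2)[unfolded typed_def]] unfolding eval_object_Mat by simp
  then show ?thesis using t by (simp add: dm.abs_eq cd.abs_eq)
qed

lemma crys_of_eq: "arr f \<Longrightarrow> crys_of f = (pw (dm f), pw (cd f), mat_of f)"
  using crys_of_in_Hom[of f] unfolding mat_of_def by auto

lemma mat_of_supported: "arr f \<Longrightarrow> mat_of f \<in> supported (pw (dm f)) (pw (cd f))"
  using crys_of_in_Hom[of f] unfolding mat_of_def by auto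

lemma mat_of_0: "arr f \<Longrightarrow> b \<notin> B_words (dm f) \<Longrightarrow> mat_of f b d = 0" "arr f \<Longrightarrow> d \<notin> B_words (cd f) \<Longrightarrow> mat_of f b d = 0"
  using mat_of_supported[of f] by (auto simp: supported_0 B_words_def)

lemma mat_of_eqI: "crys_of f = (v, w, M) \<Longrightarrow> mat_of f = M"
  by (simp add: mat_of_def)

lemma mat_of_comp:
  assumes "arr f" "arr g" "cd f = dm g"
  shows "mat_of (g * f) b d = (\<Sum>c\<in>B_words (cd f). mat_of f b c * mat_of g c d)"
proof -
  have "crys_of (g * f) = (pw (dm f), pw (cd g), \<lambda>b d. \<Sum>c\<in>B_words (cd f). mat_of f b c * mat_of g c d)"
    unfolding crys_of_ops(1)[OF assms] crys_of_eq[OF assms(1)] crys_of_eq[OF assms(2)] by (simp add: B_words_def)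
  from mat_of_eqI[OF this] show ?thesis by simp
qed

lemma mat_of_tens:
  assumes "arr f" "arr g"
  shows "mat_of (f \<odot> g) b d = mat_of f (take (dm f) b) (take (cd f) d) * mat_of g (drop (dm f) b) (drop (cd f) d)"
proof -
  have "crys_of (f \<odot> g) = (pw (dm f) @ pw (dm g), pw (cd f) @ pw (cd g),
      \<lambda>b d. mat_of f (take (dm f) b) (take (cd f) d) * mat_of g (drop (dm f) b) (drop (cd f) d))"
    unfolding crys_of_ops(2)[OF assms] crys_of_eq[OF assms(1)] crys_of_eq[OF assms(2)] by simp
  from mat_of_eqI[OF this] show ?thesis by simp
qed

lemma mat_of_add:
  assumes "arr f" "arr g" "dm f = dm g" "cd f = cd g"
  shows "mat_of (f + g) = mat_of f + mat_of g"
  by (rule mat_of_eqI) (unfold crys_of_ops(3)[OF assms] crys_of_eq[OF assms(1)] crys_of_eq[OF assms(2)], simp)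

lemma mat_of_scale: "arr f \<Longrightarrow> mat_of (a \<bullet> f) = mat_scale a (mat_of f)"
  by (rule mat_of_eqI) (unfold crys_of_ops(4) crys_of_eq, simp)

lemma mat_of_diff: "arr f \<Longrightarrow> arr g \<Longrightarrow> dm f = dm g \<Longrightarrow> cd f = cd g \<Longrightarrow> mat_of (f - g) b d = mat_of f b d - mat_of g b d"
  by (simp add: minus_mo_def uminus_mo mat_of_add mat_of_scale mat_scale_def)

lemma mat_of_idn: "mat_of (idn n) b d = (if b \<in> B_words n \<and> b = d then 1 else 0)"
  unfolding mat_of_eqI[OF crys_of_ops(6)[unfolded Mat_simps]] by (simp add: B_words_def)

lemma mat_of_zer: "mat_of (zer m n) = 0"
  by (rule mat_of_eqI[OF crys_of_ops(7)[unfolded Mat_simps]])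

lemma mat_of_gen: "mat_of (gen x) b d = (if b \<in> B_words (length (mo_dom x)) \<and> gen_op x b = Some d then 1 else 0)"
  unfolding mat_of_eqI[OF crys_of_ops(5)[unfolded gen_mor_def partial_mor_def]] by simp

lemma gen_at_append:
  "length u = length (mo_dom x) \<Longrightarrow> gen_at (length t) x (t @ u @ v) = map_option (\<lambda>z. t @ z @ v) (gen_op x u)"
proof (induction t)
  case Nil
  then show ?case
    by (cases x) (auto simp: length_Suc_conv)
next
  case (Cons y t)
  then show ?case by (simp add: option.map_comp comp_def)
qed

lemma mat_of_gen_at:
  "mat_of (idn a \<odot> gen x \<odot> (idn b :: 'k::field mo)) w d =
    (if w \<in> B_words (a + length (mo_dom x) + b) \<and> gen_at a x w = Some d then 1 else 0)"
proof -
  let ?m = "length (mo_dom x)" and ?n = "length (mo_cod x)"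
  have "is_partial (crys_of (idn a \<odot> gen x \<odot> (idn b :: 'k mo))) (a + (?m + b)) (a + (?n + b)) (tens_op a Some (tens_op ?m (gen_op x) Some))"
    by (simp add: crys_of_ops del: Mat_simps)
      (intro is_partial_TensM is_partial_Ident is_partial_gen)
  then have "mat_of (idn a \<odot> gen x \<odot> (idn b :: 'k mo)) w d =
    (if w \<in> B_words (a + (?m + b)) \<and> tens_op a Some (tens_op ?m (gen_op x) Some) w = Some d then 1 else 0)"
    unfolding is_partial_def partial_mor_def by (simp add: mat_of_def)
  moreover have "tens_op a Some (tens_op ?m (gen_op x) Some) w = gen_at a x w" if w: "w \<in> B_words (a + (?m + b))"
  proof -
    define t u v where "t = take a w" and "u = take ?m (drop a w)" and "v = drop ?m (drop a w)"
    have "w = t @ u @ v" unfolding t_def u_def v_def append_take_drop_id ..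
    moreover have "length t = a" "length u = ?m"
      using w B_words_length[OF w] unfolding t_def u_def by auto
    ultimately show ?thesis
      using gen_at_append[of u x t v] by (auto simp: tens_op_def split: option.split)
  qed
  ultimately show ?thesis by (auto simp: add.assoc)
qed

section \<open>Linear combinations of crystal morphisms\<close>

abbreviation CM :: "nat \<Rightarrow> nat \<Rightarrow> (letter list \<Rightarrow> letter list \<Rightarrow> 'k::field) set" where
  "CM m n \<equiv> crystal_maps (word_crystal (pw m)) (word_crystal (pw n))"

abbreviation strict_words :: "nat \<Rightarrow> nat \<Rightarrow> (letter list option \<Rightarrow> letter list option) \<Rightarrow> bool" where
  "strict_words m n \<equiv> strict_morphism (word_crystal (pw m)) (word_crystal (pw n))"

lemma strict_wordsD:
  assumes "strict_words m n \<psi>"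
  shows "\<psi> None = None"
    "b \<in> B_words m \<Longrightarrow> \<psi> (Some b) \<in> insert None (Some ` B_words n)"
    "b \<in> B_words m \<Longrightarrow> \<psi> (Some b) = Some d \<Longrightarrow> d \<in> B_words n \<and> wtw d = wtw b"
    "b \<in> B_words m \<Longrightarrow> \<psi> (ew b) = Option.bind (\<psi> (Some b)) ew"
    "b \<in> B_words m \<Longrightarrow> \<psi> (fw b) = Option.bind (\<psi> (Some b)) fw"
proof -
  have \<psi>: "\<psi> None = None"
    "\<And>b. b \<in> B_words m \<Longrightarrow> \<psi> (Some b) \<in> insert None (Some ` B_words n)"
    "\<And>b d. b \<in> B_words m \<Longrightarrow> \<psi> (Some b) = Some d \<Longrightarrow> wt (word_crystal (pw n)) d = wt (word_crystal (pw m)) b"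
    "\<And>b. b \<in> B_words m \<Longrightarrow> \<psi> (e_op (word_crystal (pw m)) b) = Option.bind (\<psi> (Some b)) (e_op (word_crystal (pw n)))"
    "\<And>b. b \<in> B_words m \<Longrightarrow> \<psi> (f_op (word_crystal (pw m)) b) = Option.bind (\<psi> (Some b)) (f_op (word_crystal (pw n)))"
    using assms unfolding strict_morphism_def B_words_def[symmetric] by blast+
  show "\<psi> None = None" "b \<in> B_words m \<Longrightarrow> \<psi> (Some b) \<in> insert None (Some ` B_words n)" by fact+
  show *: "d \<in> B_words n \<and> wtw d = wtw b" if "b \<in> B_words m" "\<psi> (Some b) = Some d" for d
  proof -
    have "d \<in> B_words n" using \<psi>(2)[of b] that by auto
    with \<psi>(3)[OF that] word_crystal_ops[of b m] word_crystal_ops[of d n] that show ?thesis by simp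
  qed
  show "\<psi> (ew b) = Option.bind (\<psi> (Some b)) ew" if "b \<in> B_words m"
    using \<psi>(4)[OF that] word_crystal_ops[OF that] *[OF that] word_crystal_ops[of _ n]
    by (cases "\<psi> (Some b)") simp_all
  show "\<psi> (fw b) = Option.bind (\<psi> (Some b)) fw" if "b \<in> B_words m"
    using \<psi>(5)[OF that] word_crystal_ops[OF that] *[OF that] word_crystal_ops[of _ n]
    by (cases "\<psi> (Some b)") simp_all
qed

lemma linearize_words: "linearize (word_crystal (pw m)) \<psi> = (\<lambda>b d. if b \<in> B_words m \<and> \<psi> (Some b) = Some d then 1 else 0)"
  by (simp add: linearize_def B_words_def)

lemma CM_induct [consumes 1, case_names zero step]:
  assumes "M \<in> CM m n" and "Q 0"
    and "\<And>c \<psi> M. strict_words m n \<psi> \<Longrightarrow> M \<in> CM m n \<Longrightarrow> Q M \<Longrightarrow>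
      Q (mat_scale c (\<lambda>b d. if b \<in> B_words m \<and> \<psi> (Some b) = Some d then 1 else 0) + M)"
  shows "Q M"
proof -
  have "M \<in> CM m n \<and> Q M"
    using assms(1) unfolding crystal_maps_def
  proof (induction rule: mat.span_induct_alt)
    case base
    show ?case using assms(2) mat.span_zero by blast
  next
    case (step c x y)
    then obtain \<psi> where \<psi>: "x = linearize (word_crystal (pw m)) \<psi>" "strict_words m n \<psi>" by auto
    have y: "y \<in> CM m n" "Q y" using step(2) unfolding crystal_maps_def by blast+
    have "mat_scale c x + y \<in> CM m n"
      using y(1) unfolding crystal_maps_def
      by (rule mat.span_add[OF mat.span_scale[OF mat.span_base[OF step(1)]]])
    moreover have "Q (mat_scale c x + y)"
      using assms(3)[OF \<psi>(2) y, of c] unfolding \<psi>(1) linearize_words .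
    ultimately show ?case unfolding crystal_maps_def by blast
  qed
  then show ?thesis ..
qed

lemma CM_0: "0 \<in> CM m n"
  and CM_add: "M \<in> CM m n \<Longrightarrow> K \<in> CM m n \<Longrightarrow> M + K \<in> CM m n"
  and CM_scale: "M \<in> CM m n \<Longrightarrow> mat_scale a M \<in> CM m n"
  and CM_diff: "M \<in> CM m n \<Longrightarrow> K \<in> CM m n \<Longrightarrow> M - K \<in> CM m n"
  and CM_sum: "(\<And>s. s \<in> S \<Longrightarrow> f s \<in> CM m n) \<Longrightarrow> sum f S \<in> CM m n"
  unfolding crystal_maps_def
  by (simp_all add: mat.span_zero mat.span_add mat.span_scale mat.span_diff mat.span_sum)

lemma CM_strict: "strict_words m n \<psi> \<Longrightarrow> (\<lambda>b d. if b \<in> B_words m \<and> \<psi> (Some b) = Some d then 1 else 0) \<in> CM m n"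
  unfolding crystal_maps_def linearize_words[symmetric] by (rule mat.span_base) auto

lemma CM_wt: "M \<in> CM m n \<Longrightarrow> M b d \<noteq> 0 \<Longrightarrow> b \<in> B_words m \<and> d \<in> B_words n \<and> wtw d = wtw b"
proof (induction rule: CM_induct)
  case (step c \<psi> M)
  then show ?case
    using strict_wordsD(3)[OF step(1), of b d] by (cases "M b d = 0") (auto simp: mat_scale_def split: if_splits)
qed simp

text \<open>A strict morphism commutes with \<open>e\<close>, so it sends a word killed by
  \<open>e\<close> to 0 or to another such word; a nonzero entry of a combination comes from one of
  its terms.\<close>

lemma CM_hw:
  assumes "M \<in> CM m n" "epsw b = 0"
  shows "M b d \<noteq> 0 \<Longrightarrow> epsw d = 0"
  using assms(1)
proof (induction rule: CM_induct)
  case (step c \<psi> M)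
  have "epsw d = 0" if "b \<in> B_words m" "\<psi> (Some b) = Some d"
    using strict_wordsD(1,4)[OF step(1)] that assms(2) unfolding ew_None[symmetric] by fastforce
  with step show ?case by (cases "M b d = 0") (auto simp: mat_scale_def split: if_splits)
qed simp

lemma finite_B_words [simp]: "finite (B_words n)"
  by (simp add: B_words_def)

text \<open>Commutation with \<open>f\<close> as an identity of matrix entries. The sum over words
  mapped to \<open>d'\<close> makes it linear in \<open>M\<close>, so it extends from single strict
  morphisms to their span.\<close>

lemma CM_f:
  assumes "M \<in> CM m n" "b \<in> B_words m" "fw b = Some b'"
  shows "M b' d' = (\<Sum>d | d \<in> B_words n \<and> fw d = Some d'. M b d)"
  using assms(1)
proof (induction rule: CM_induct)
  case (step c \<psi> M)
  have b': "b' \<in> B_words m" using fw_Some[OF assms(3)] assms(2) by blast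
  have "(if b' \<in> B_words m \<and> \<psi> (Some b') = Some d' then 1 else 0) =
    (\<Sum>d | d \<in> B_words n \<and> fw d = Some d'. if b \<in> B_words m \<and> \<psi> (Some b) = Some d then 1 else (0 :: 'a))"
  proof (cases "\<psi> (Some b)")
    case None
    then show ?thesis
      using strict_wordsD(5)[OF step(1) assms(2)] assms(3) by simp
  next
    case (Some d0)
    then have d0: "d0 \<in> B_words n" using strict_wordsD(3)[OF step(1) assms(2)] by blast
    have "\<psi> (Some b') = fw d0"
      using strict_wordsD(5)[OF step(1) assms(2)] assms(3) Some by simp
    moreover have "(\<Sum>d | d \<in> B_words n \<and> fw d = Some d'. if b \<in> B_words m \<and> \<psi> (Some b) = Some d then 1 else (0 :: 'a))
      = (if fw d0 = Some d' then 1 else 0)"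
      using Some assms(2) d0 by simp
    ultimately show ?thesis using b' by simp
  qed
  with step show ?case
    by (simp add: mat_scale_def sum.distrib sum_distrib_left[symmetric])
qed simp

definition mm :: "nat \<Rightarrow> (letter list \<Rightarrow> letter list \<Rightarrow> 'k::field) \<Rightarrow> (letter list \<Rightarrow> letter list \<Rightarrow> 'k)
    \<Rightarrow> letter list \<Rightarrow> letter list \<Rightarrow> 'k" where
  "mm n M K = (\<lambda>b d. \<Sum>c\<in>B_words n. M b c * K c d)"

lemma mm_linear:
  "mm n (M + M') K = mm n M K + mm n M' K" "mm n (mat_scale a M) K = mat_scale a (mm n M K)"
  "mm n M (K + K') = mm n M K + mm n M K'" "mm n M (mat_scale a K) = mat_scale a (mm n M K)"
  "mm n 0 K = 0" "mm n M 0 = 0"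
  by (auto simp: mm_def mat_scale_def fun_eq_iff algebra_simps sum.distrib sum_distrib_left)

lemma mm_assoc: "mm n M (mm p K L) = mm p (mm n M K) L"
  by (auto simp: mm_def fun_eq_iff sum_distrib_left sum_distrib_right mult.assoc intro: sum.swap)

lemma strict_morphism_comp:
  assumes \<psi>: "strict_morphism X Y \<psi>" and \<chi>: "strict_morphism Y Z \<chi>"
  shows "strict_morphism X Z (\<lambda>x. \<chi> (\<psi> x))"
proof -
  have \<psi>D: "\<psi> None = None" "\<And>b. b \<in> elems X \<Longrightarrow> \<psi> (Some b) \<in> insert None (Some ` elems Y)"
    "\<And>b d. b \<in> elems X \<Longrightarrow> \<psi> (Some b) = Some d \<Longrightarrow> wt Y d = wt X b"
    "\<And>b. b \<in> elems X \<Longrightarrow> \<psi> (e_op X b) = Option.bind (\<psi> (Some b)) (e_op Y)"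
    "\<And>b. b \<in> elems X \<Longrightarrow> \<psi> (f_op X b) = Option.bind (\<psi> (Some b)) (f_op Y)"
    using \<psi> unfolding strict_morphism_def by blast+
  have \<chi>D: "\<chi> None = None" "\<And>b. b \<in> elems Y \<Longrightarrow> \<chi> (Some b) \<in> insert None (Some ` elems Z)"
    "\<And>b d. b \<in> elems Y \<Longrightarrow> \<chi> (Some b) = Some d \<Longrightarrow> wt Z d = wt Y b"
    "\<And>b. b \<in> elems Y \<Longrightarrow> \<chi> (e_op Y b) = Option.bind (\<chi> (Some b)) (e_op Z)"
    "\<And>b. b \<in> elems Y \<Longrightarrow> \<chi> (f_op Y b) = Option.bind (\<chi> (Some b)) (f_op Z)"
    using \<chi> unfolding strict_morphism_def by blast+
  have "\<chi> (\<psi> (Some b)) \<in> insert None (Some ` elems Z) \<and> (\<forall>d. \<chi> (\<psi> (Some b)) = Some d \<longrightarrow> wt Z d = wt X b) \<and>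
    \<chi> (\<psi> (e_op X b)) = Option.bind (\<chi> (\<psi> (Some b))) (e_op Z) \<and>
    \<chi> (\<psi> (f_op X b)) = Option.bind (\<chi> (\<psi> (Some b))) (f_op Z)" if b: "b \<in> elems X" for b
  proof (cases "\<psi> (Some b)")
    case None
    then show ?thesis using \<psi>D(4,5)[OF b] \<chi>D(1) by simp
  next
    case (Some c)
    then have c: "c \<in> elems Y" using \<psi>D(2)[OF b] by auto
    show ?thesis
      using \<psi>D(3)[OF b Some] \<psi>D(4,5)[OF b] \<chi>D(2,4,5)[OF c] \<chi>D(3)[OF c] Some by simp
  qed
  then show ?thesis unfolding strict_morphism_def using \<psi>D(1) \<chi>D(1) by simp
qed

lemma CM_mm:
  assumes M: "M \<in> CM m n" and K: "K \<in> CM n p"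
  shows "mm n M K \<in> CM m p"
  using M
proof (induction rule: CM_induct)
  case zero
  show ?case unfolding mm_linear by (rule CM_0)
next
  case (step c \<psi> M)
  let ?M = "\<lambda>b d. if b \<in> B_words m \<and> \<psi> (Some b) = Some d then 1 else (0 :: 'a)"
  have "mm n ?M K \<in> CM m p"
    using K
  proof (induction rule: CM_induct)
    case zero
    show ?case unfolding mm_linear by (rule CM_0)
  next
    case (step c \<chi> K)
    have "maps m n (\<lambda>b. \<psi> (Some b))"
      using strict_wordsD(2)[OF \<open>strict_words m n \<psi>\<close>] unfolding maps_def by blast
    from Comp_partial[OF this, of p "\<lambda>b. \<chi> (Some b)", where 'k = 'a]
    have "mm n ?M (\<lambda>b d. if b \<in> B_words n \<and> \<chi> (Some b) = Some d then 1 else 0) =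
      (\<lambda>b d. if b \<in> B_words m \<and> Option.bind (\<psi> (Some b)) (\<lambda>b. \<chi> (Some b)) = Some d then 1 else (0 :: 'a))"
      unfolding partial_mor_def mm_def Mat_simps B_words_def[symmetric] by simp
    also have "\<dots> = (\<lambda>b d. if b \<in> B_words m \<and> \<chi> (\<psi> (Some b)) = Some d then 1 else 0)"
    proof -
      have "Option.bind (\<psi> (Some b)) (\<lambda>b. \<chi> (Some b)) = \<chi> (\<psi> (Some b))" for b
        using strict_wordsD(1)[OF step(1)] by (cases "\<psi> (Some b)") simp_all
      then show ?thesis by simp
    qed
    also have "\<dots> \<in> CM m p"
      using CM_strict[OF strict_morphism_comp[OF \<open>strict_words m n \<psi>\<close> step(1)]] .
    finally show ?case
      unfolding mm_linear using step by (intro CM_add CM_scale)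
  qed
  with step show ?case unfolding mm_linear by (intro CM_add CM_scale)
qed

lemma mat_of_mm: "arr f \<Longrightarrow> arr g \<Longrightarrow> cd f = dm g \<Longrightarrow> mat_of (g * f) = mm (cd f) (mat_of f) (mat_of g)"
  by (simp add: fun_eq_iff mat_of_comp mm_def)

text \<open>Whisker induction leaves generators between identities as the essential base case,
  settled by \<open>wmap_gen_at\<close>. Tensor products of general crystal morphisms are thereby
  avoided.\<close>

lemma mat_of_in_CM: "arr f \<Longrightarrow> mat_of f \<in> CM (dm f) (cd f)"
proof (induction rule: mo_whisker_induct)
  case (gen a x b)
  have "mat_of (idn a \<odot> gen x \<odot> idn b) =
    (\<lambda>w d. if w \<in> B_words (a + length (mo_dom x) + b) \<and> Option.bind (Some w) (gen_at a x) = Some d then 1 else 0)"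
    by (simp only: fun_eq_iff mat_of_gen_at Option.bind.simps simp_thms)
  also have "\<dots> \<in> CM (a + length (mo_dom x) + b) (a + length (mo_cod x) + b)"
    by (rule CM_strict[OF wmap_strict[OF wmap_gen_at]])
  finally show ?case by (simp add: add.assoc)
next
  case (idn n)
  have "strict_words n n (\<lambda>x. x)" by (auto simp: strict_morphism_def)
  from CM_strict[OF this] show ?case by (simp add: mat_of_idn[abs_def] fun_eq_iff)
next
  case (comp f g)
  then show ?case by (simp add: mat_of_mm CM_mm)
next
  case (zer m n)
  show ?case unfolding mat_of_zer by (rule CM_0)
next
  case (add f g)
  then show ?case using CM_add[of "mat_of f" "dm f" "cd f" "mat_of g"]
    by (simp only: mat_of_add dm_simps cd_simps max.idem)
next
  case (scale a f)
  then show ?case unfolding mat_of_scale[OF scale(1)] using CM_scale by simp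
qed

section \<open>Highest weight words and their morphisms\<close>

abbreviation plus_word :: "nat \<Rightarrow> letter list" where "plus_word k \<equiv> replicate k (0, 0)"

lemma plus_word_Suc: "plus_word (Suc k) = plus_word k @ [(0, 0)]"
  by (simp add: replicate_append_same)

lemma wtw_append: "wtw (v @ w) = wtw v + wtw w"
  by (induction v) auto

text \<open>Weight is \<open>\<phi>\<close> minus \<open>\<epsilon>\<close>, so
  \<open>int (epsw w) + wtw w\<close> is \<open>\<phi>\<close> of \<open>w\<close>. A final
  \<open>(0, 1)\<close> leaves \<open>\<epsilon>\<close> unchanged exactly when this number is
  positive.\<close>

lemma epsw_snoc:
  "epsw (w @ [(0, 0)]) = epsw w \<and> epsw (w @ [(Suc 0, 0)]) = epsw w
   \<and> epsw (w @ [(0, Suc 0)]) = (if int (epsw w) + wtw w > 0 then epsw w else Suc (epsw w))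
   \<and> 0 \<le> int (epsw w) + wtw w"
  by (induction w) (auto simp: of_nat_diff)

text \<open>On words killed by \<open>e\<close>, \<open>\<phi>\<close>, the weight and the height
  coincide, so the condition \<open>height r > 0\<close> in \<open>hw\<close> is the positivity in
  \<open>epsw_snoc\<close>.\<close>

lemma hw_iff: "set r \<subseteq> {(0, 0), (0, 1), (1, 0)} \<Longrightarrow>
    (hw r \<longleftrightarrow> epsw (rev r) = 0) \<and> (hw r \<longrightarrow> wtw (rev r) = int (height r))"
proof (induction r)
  case (Cons x r)
  then show ?case
    using epsw_snoc[of "rev r"] by (auto simp: wtw_append of_nat_diff split: if_splits)
qed simp

lemma hw_letters: "hw r \<Longrightarrow> set r \<subseteq> {(0, 0), (0, 1), (1, 0)}"
  by (induction r) auto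

lemma rev_in_B_words: "hw r \<Longrightarrow> rev r \<in> B_words (length r)"
  using hw_letters[of r] by (simp add: B_words_iff)

lemma epsw_plus_word [simp]: "epsw (plus_word k) = 0"
  by (induction k) auto

lemma plus_word_in_B_words [simp]: "plus_word k \<in> B_words k"
  by (induction k) auto

text \<open>The \<open>f\<close>-string through \<open>plus_word k\<close>, that is, the component
  of the \<open>k\<close>-th tensor power isomorphic to
  \<open>B(k \<omega>\<^sub>1)\<close>.\<close>

definition string_words :: "nat \<Rightarrow> letter list set" where
  "string_words k = {replicate a (0, 1) @ plus_word c | a c. a + c = k}"

lemma fw_string:
  "fw (replicate a (0, 1) @ plus_word (Suc c)) = Some (replicate (Suc a) (0, 1) @ plus_word c)"
proof (induction a)
  case (Suc a)
  then show ?case by simp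
qed simp

lemma string_in_B_words: "w \<in> string_words k \<Longrightarrow> w \<in> B_words k"
  by (auto simp: string_words_def B_words_iff)

lemma plus_string: "plus_word k \<in> string_words k"
  unfolding string_words_def by (intro CollectI exI[of _ 0] exI[of _ k]) simp

text \<open>\<open>CM_f\<close> expresses each row of the string through the preceding one, so
  vanishing spreads from the highest weight row along the whole string.\<close>

lemma CM_eq_0:
  assumes M: "M \<in> CM k n" and string: "\<And>b d. b \<notin> string_words k \<Longrightarrow> M b d = 0"
    and plus: "\<And>d. M (plus_word k) d = 0"
  shows "M b d = 0"
proof (cases "b \<in> string_words k")
  case True
  have "\<forall>d. M (replicate a (0, 1) @ plus_word c) d = 0" if "a + c = k" for a c
    using that
  proof (induction a arbitrary: c)
    case 0
    then show ?case using plus by simp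
  next
    case (Suc a)
    let ?b = "replicate a (0, 1) @ plus_word (Suc c)"
    have "?b \<in> B_words k" using Suc.prems by (auto simp: B_words_iff)
    moreover have "M ?b d = 0" for d
      using Suc.IH[of "Suc c"] Suc.prems by (simp del: replicate_Suc)
    ultimately show ?case
      using CM_f[OF M _ fw_string] by (simp del: replicate_Suc)
  qed
  with True show ?thesis unfolding string_words_def by blast
qed (rule string)

lemma B_words_snoc: "w @ [x] \<in> B_words (Suc n) \<longleftrightarrow> w \<in> B_words n \<and> x \<in> {(0, 0), (0, 1), (1, 0)}"
  by (auto simp: B_words_iff)

lemma B_words_Suc_snoc:
  assumes "w \<in> B_words (Suc n)" obtains v x where "w = v @ [x]" "v \<in> B_words n" "x = (0, 0) \<or> x = (0, Suc 0) \<or> x = (Suc 0, 0)"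
  using assms by (cases w rule: rev_cases) (auto simp: B_words_snoc dest: B_words_length)

lemma string_snoc:
  "w @ [(0, 0)] \<in> string_words (Suc k) \<longleftrightarrow> w \<in> string_words k"
  "w @ [(0, Suc 0)] \<in> string_words (Suc k) \<longleftrightarrow> w = replicate k (0, 1)"
  "w @ [(Suc 0, 0)] \<notin> string_words (Suc k)"
proof -
  have *: "w @ [x] \<in> string_words (Suc k) \<longleftrightarrow> (x = (0, 0) \<and> w \<in> string_words k) \<or> (x = (0, 1) \<and> w = replicate k (0, 1))"
    for x
  proof
    assume "w @ [x] \<in> string_words (Suc k)"
    then obtain a c where ac: "w @ [x] = replicate a (0, 1) @ plus_word c" "a + c = Suc k"
      by (auto simp: string_words_def)
    show "(x = (0, 0) \<and> w \<in> string_words k) \<or> (x = (0, 1) \<and> w = replicate k (0, 1))"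
    proof (cases c)
      case 0
      then have "w @ [x] = replicate k (0, 1) @ [(0, 1)]"
        using ac by (simp add: replicate_append_same)
      then show ?thesis by simp
    next
      case (Suc c')
      then have "w @ [x] = (replicate a (0, 1) @ plus_word c') @ [(0, 0)]"
        using ac by (simp add: replicate_append_same)
      then show ?thesis using ac(2) Suc by (auto simp: string_words_def)
    qed
  next
    assume "(x = (0, 0) \<and> w \<in> string_words k) \<or> (x = (0, 1) \<and> w = replicate k (0, 1))"
    then show "w @ [x] \<in> string_words (Suc k)"
    proof
      assume "x = (0, 0) \<and> w \<in> string_words k"
      then obtain a c where "w = replicate a (0, 1) @ plus_word c" "a + c = k" "x = (0, 0)"
        by (auto simp: string_words_def)
      then show ?thesis
        unfolding string_words_def
        by (intro CollectI exI[of _ a] exI[of _ "Suc c"]) (simp add: replicate_append_same)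
    next
      assume "x = (0, 1) \<and> w = replicate k (0, 1)"
      then show ?thesis
        unfolding string_words_def
        by (intro CollectI exI[of _ "Suc k"] exI[of _ 0]) (simp add: replicate_append_same)
    qed
  qed
  show "w @ [(0, 0)] \<in> string_words (Suc k) \<longleftrightarrow> w \<in> string_words k"
    "w @ [(0, Suc 0)] \<in> string_words (Suc k) \<longleftrightarrow> w = replicate k (0, 1)"
    "w @ [(Suc 0, 0)] \<notin> string_words (Suc k)"
    using *[of "(0, 0)"] *[of "(0, Suc 0)"] *[of "(Suc 0, 0)"] by simp_all
qed

lemma replicate_snoc_iff: "w @ [x] = replicate (Suc k) y \<longleftrightarrow> x = y \<and> w = replicate k y"
  unfolding replicate_Suc replicate_append_same[symmetric] by auto

lemma mat_of_comp_single:
  assumes "arr f" "arr g" "cd f = dm g" "c0 \<in> B_words (cd f)" "\<And>c. c \<in> B_words (cd f) \<Longrightarrow> mat_of f b c = (if c = c0 then a else 0)"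
  shows "mat_of (g * f) b d = a * mat_of g c0 d"
proof -
  have "mat_of (g * f) b d = (\<Sum>c\<in>B_words (cd f). if c = c0 then a * mat_of g c0 d else 0)"
    unfolding mat_of_comp[OF assms(1-3)] using assms(5) by (intro sum.cong) auto
  then show ?thesis using assms(4) by simp
qed

lemma mat_of_comp_zero:
  assumes "arr f" "arr g" "cd f = dm g" "\<And>c. mat_of f b c = 0"
  shows "mat_of (g * f) b d = 0"
  unfolding mat_of_comp[OF assms(1-3)] by (simp add: assms(4))

lemma mat_of_dot: "mat_of (\<eta> * \<theta>) b d = (if b = [(Suc 0, 0)] \<and> d = [(Suc 0, 0)] then 1 else 0)"
proof (cases "b = [(Suc 0, 0)]")
  case True
  have "mat_of (\<eta> * \<theta>) b d = 1 * mat_of \<eta> [] d"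
    by (rule mat_of_comp_single) (auto simp: mat_of_gen True B_words_Suc[of 0])
  then show ?thesis by (simp add: mat_of_gen True eq_commute)
next
  case False
  have "mat_of (\<eta> * \<theta>) b d = 0"
    by (rule mat_of_comp_zero) (use False in \<open>auto simp: mat_of_gen B_words_Suc\<close>)
  with False show ?thesis by simp
qed

lemma mat_of_cap_end: "u \<in> B_words k \<Longrightarrow> mat_of (idn k \<odot> \<inter>) (u @ [y, x]) c = (if c = u \<and> y = (0, 0) \<and> x = (0, Suc 0) then 1 else 0)"
proof -
  assume u: "u \<in> B_words k"
  have "c = u" if "take k c = u" "drop k c = []"
    using that by (metis append_take_drop_id append_Nil2)
  then show ?thesis
    using u B_words_length[OF u] by (auto simp: mat_of_tens mat_of_idn mat_of_gen B_words_Suc split: if_splits)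
qed

lemma mat_of_cup_end:
  assumes c: "c \<in> B_words k"
  shows "mat_of (idn k \<odot> \<union>) c d = (if d = c @ [(0, 0), (0, Suc 0)] then 1 else 0)"
proof -
  have tk: "take k c = c" "drop k c = []" using B_words_length[OF c] by simp_all
  have iff: "c = take k d \<and> drop k d = [(0, 0), (0, Suc 0)] \<longleftrightarrow> d = c @ [(0, 0), (0, Suc 0)]"
    using B_words_length[OF c] by (metis append_eq_conv_conj append_take_drop_id)
  have "mat_of (idn k \<odot> \<union>) c d = (if c = take k d \<and> drop k d = [(0, 0), (0, Suc 0)] then 1 else 0)"
    using c by (simp add: mat_of_tens mat_of_idn mat_of_gen tk eq_commute[of "drop k d"])
  then show ?thesis unfolding iff .
qed

text \<open>Among words with a string before the last letter, the dot term removes those ending in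
  \<open>(1, 0)\<close> and the cup term those ending in \<open>(0, 0)\<close>,
  \<open>(0, 1)\<close>. What remains ends in \<open>(0, 0)\<close> or consists of letters
  \<open>(0, 1)\<close> only: the strings one letter longer.\<close>

lemma mat_of_jones: "mat_of (jones k :: 'k::field mo) b d = (if b \<in> string_words k \<and> b = d then 1 else 0)"
proof (induction k arbitrary: b d rule: jones.induct)
  case 1
  then show ?case by (auto simp: mat_of_idn string_words_def)
next
  case 2
  have "[(0, 0)] \<in> string_words (Suc 0)" "[(0, Suc 0)] \<in> string_words (Suc 0)"
    "[(Suc 0, 0)] \<notin> string_words (Suc 0)"
    using string_snoc[of "[]" 0] plus_string[of 0] by simp_all
  then show ?case
    using string_in_B_words[of b "Suc 0"] by (auto simp: mat_of_diff mat_of_dot mat_of_idn B_words_Suc)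
next
  case (3 k)
  show ?case
  proof (cases "b \<in> B_words (Suc (Suc k))")
    case False
    then show ?thesis using mat_of_0(1)[of "jones (Suc (Suc k))" b d] string_in_B_words by auto
  next
    case True
    then obtain v x where vx: "b = v @ [x]" "v \<in> B_words (Suc k)" "x = (0, 0) \<or> x = (0, Suc 0) \<or> x = (Suc 0, 0)"
      by (rule B_words_Suc_snoc)
    obtain u y where uy: "v = u @ [y]" "u \<in> B_words k" "y = (0, 0) \<or> y = (0, Suc 0) \<or> y = (Suc 0, 0)"
      using vx(2) by (rule B_words_Suc_snoc)
    have lv: "length v = Suc k" and lu: "length u = k" using vx(2) uy(2) by (simp_all add: B_words_length)
    have take_eq: "take (Suc k) d = v \<and> drop (Suc k) d = [z] \<longleftrightarrow> d = v @ [z]" for z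
      using lv by (metis append_eq_conv_conj append_take_drop_id)
    have A: "mat_of (jones (Suc k) \<odot> \<iota> :: 'k mo) b d = (if v \<in> string_words (Suc k) \<and> d = b then 1 else 0)"
      using vx(3) lv take_eq[of x] by (auto simp: mat_of_tens 3(1) mat_of_idn vx(1) B_words_Suc)
    have B: "mat_of (jones (Suc k) \<odot> (\<eta> * \<theta>) :: 'k mo) b d = (if v \<in> string_words (Suc k) \<and> d = b \<and> x = (Suc 0, 0) then 1 else 0)"
      using lv take_eq[of x] by (auto simp: mat_of_tens 3(1) mat_of_dot vx(1))
    have E: "mat_of ((idn k \<odot> \<union>) * jones k * (idn k \<odot> \<inter>) :: 'k mo) b d =
      (if u \<in> string_words k \<and> d = b \<and> y = (0, 0) \<and> x = (0, Suc 0) then 1 else 0)"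
    proof (cases "y = (0, 0) \<and> x = (0, Suc 0)")
      case True
      have "mat_of ((idn k \<odot> \<union>) * jones k * (idn k \<odot> \<inter>) :: 'k mo) b d = 1 * mat_of ((idn k \<odot> \<union>) * jones k :: 'k mo) u d"
        by (rule mat_of_comp_single) (use uy vx True in \<open>auto simp: mat_of_cap_end\<close>)
      also have "mat_of ((idn k \<odot> \<union>) * jones k :: 'k mo) u d = (if u \<in> string_words k then 1 else 0) * mat_of (idn k \<odot> \<union> :: 'k mo) u d"
        by (rule mat_of_comp_single) (use uy in \<open>auto simp: 3(3)\<close>)
      finally show ?thesis using True uy(2) by (auto simp: vx uy mat_of_cup_end)
    next
      case False
      have "mat_of ((idn k \<odot> \<union>) * jones k * (idn k \<odot> \<inter>) :: 'k mo) b d = 0"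
        by (rule mat_of_comp_zero) (use uy vx False in \<open>auto simp: mat_of_cap_end\<close>)
      with False show ?thesis by auto
    qed
    have "mat_of (jones (Suc (Suc k)) :: 'k mo) b d = mat_of (jones (Suc k) \<odot> \<iota> :: 'k mo) b d
      - mat_of (jones (Suc k) \<odot> (\<eta> * \<theta>) :: 'k mo) b d - mat_of ((idn k \<odot> \<union>) * jones k * (idn k \<odot> \<inter>) :: 'k mo) b d"
      unfolding jones_Suc_Suc by (simp add: mat_of_diff)
    also have "\<dots> = (if b \<in> string_words (Suc (Suc k)) \<and> b = d then 1 else 0)"
    proof -
      have 1: "b \<in> string_words (Suc (Suc k)) \<longleftrightarrow>
          (x = (0, 0) \<and> v \<in> string_words (Suc k)) \<or> (x = (0, Suc 0) \<and> v = replicate (Suc k) (0, 1))"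
        using vx(3) unfolding vx(1) by (elim disjE) (simp_all add: string_snoc del: replicate_Suc)
      have 2: "v \<in> string_words (Suc k) \<longleftrightarrow>
          (y = (0, 0) \<and> u \<in> string_words k) \<or> (y = (0, Suc 0) \<and> u = replicate k (0, 1))"
        using uy(3) unfolding uy(1) by (elim disjE) (simp_all add: string_snoc)
      have 3: "v = replicate (Suc k) (0, 1) \<longleftrightarrow> y = (0, Suc 0) \<and> u = replicate k (0, 1)"
        unfolding uy(1) replicate_snoc_iff by simp
      show ?thesis
        unfolding A B E 1 2 3 using vx(3) uy(3) by auto
    qed
    finally show ?thesis .
  qed
qed

text \<open>\<open>hw_mor r\<close> absorbs \<open>jones (height r)\<close> at its source, and this
  idempotent kills all other words.\<close>

lemma mat_of_hw_mor_string: "hw r \<Longrightarrow> b \<notin> string_words (height r) \<Longrightarrow> mat_of (hw_mor r) b d = 0"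
proof -
  assume r: "hw r" and b: "b \<notin> string_words (height r)"
  have "mat_of (hw_mor r * jones (height r)) b d = 0"
    using r b by (intro mat_of_comp_zero) (auto simp: mat_of_jones)
  with r show ?thesis by simp
qed

text \<open>The idempotent fixes the all-plus word and the cup lengthens it by
  \<open>(0, 0)\<close>, \<open>(0, 1)\<close>. In every case \<open>hw_mor r\<close> again receives
  an all-plus word, and the new strand or dot outputs \<open>x\<close>.\<close>

lemma mat_of_hw_mor_plus: "hw r \<Longrightarrow> mat_of (hw_mor r :: 'k::field mo) (plus_word (height r)) d = (if d = rev r then 1 else 0)"
proof (induction r arbitrary: d)
  case Nil
  then show ?case by (auto simp: mat_of_idn)
next
  case (Cons x r)
  have take_eq: "take (length r) d = rev r \<and> drop (length r) d = [z] \<longleftrightarrow> d = rev r @ [z]" for z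
    by (metis append_eq_conv_conj append_take_drop_id length_rev)
  from \<open>hw (x # r)\<close> show ?case
  proof (cases rule: hw_cases)
    case (Plus r')
    then have r: "hw r" "x = (0, 0)" by auto
    let ?k = "height r"
    have "mat_of (hw_mor (x # r) :: 'k mo) (plus_word (Suc ?k)) d = 1 * mat_of (hw_mor r \<odot> \<iota> :: 'k mo) (plus_word (Suc ?k)) d"
      unfolding r hw_mor_simps
      by (rule mat_of_comp_single) (use r plus_string[of "Suc ?k"] in \<open>auto simp: mat_of_jones simp del: replicate_Suc\<close>)
    also have "\<dots> = mat_of (hw_mor r :: 'k mo) (plus_word ?k) (take (length r) d) * mat_of (\<iota> :: 'k mo) [(0, 0)] (drop (length r) d)"
      using r unfolding plus_word_Suc by (simp add: mat_of_tens)
    also have "\<dots> = (if d = rev r @ [(0, 0)] then 1 else 0)"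
      using r Cons.IH take_eq[of "(0, 0)"] by (auto simp: mat_of_idn)
    finally show ?thesis using r by simp
  next
    case (Zero r')
    then have r: "hw r" "x = (Suc 0, 0)" by auto
    show ?thesis
      using r Cons.IH take_eq[of "(Suc 0, 0)"] by (auto simp: mat_of_tens mat_of_gen)
  next
    case (Minus r' l)
    then have r: "hw r" "x = (0, Suc 0)" "height r = Suc l" by auto
    have c0: "plus_word l @ [(0, 0), (0, Suc 0)] \<in> B_words (Suc (Suc l))"
      by (auto simp: B_words_iff)
    have "mat_of (hw_mor (x # r) :: 'k mo) (plus_word l) d = 1 * mat_of (hw_mor r \<odot> \<iota> :: 'k mo) (plus_word l @ [(0, 0), (0, Suc 0)]) d"
      unfolding r hw_mor_simps
      by (rule mat_of_comp_single) (use r c0 in \<open>auto simp: mat_of_cup_end\<close>)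
    also have "\<dots> = mat_of (hw_mor r :: 'k mo) (plus_word (Suc l)) (take (length r) d) * mat_of (\<iota> :: 'k mo) [(0, Suc 0)] (drop (length r) d)"
    proof -
      have "plus_word l @ [(0, 0), (0, Suc 0)] = plus_word (Suc l) @ [(0, Suc 0)]"
        unfolding plus_word_Suc by simp
      then show ?thesis using r by (simp add: mat_of_tens del: replicate_Suc)
    qed
    also have "\<dots> = (if d = rev r @ [(0, Suc 0)] then 1 else 0)"
      using r Cons.IH take_eq[of "(0, Suc 0)"] by (auto simp: mat_of_idn simp del: replicate_Suc)
    finally show ?thesis using r by simp
  qed simp
qed

section \<open>Fullness\<close>

definition realized :: "(letter list \<Rightarrow> letter list \<Rightarrow> 'k::field) \<Rightarrow> nat \<Rightarrow> nat \<Rightarrow> bool" where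
  "realized K m n \<longleftrightarrow> (\<exists>f. arr f \<and> dm f = m \<and> cd f = n \<and> mat_of f = K)"

lemma realized_add: "realized K m n \<Longrightarrow> realized L m n \<Longrightarrow> realized (K + L) m n"
  unfolding realized_def by (elim exE, rule_tac x = "f + fa" in exI) (auto simp: mat_of_add)

lemma realized_scale: "realized K m n \<Longrightarrow> realized (mat_scale a K) m n"
  unfolding realized_def by (elim exE, rule_tac x = "a \<bullet> f" in exI) (auto simp: mat_of_scale)

lemma sum_fun_apply2: "sum g S b d = (\<Sum>s\<in>S. g s b d)"
  by (induction S rule: infinite_finite_induct) auto

lemma realized_sum: "finite S \<Longrightarrow> (\<And>s. s \<in> S \<Longrightarrow> realized (g s) m n) \<Longrightarrow> realized (sum g S) m n"
proof (induction S rule: finite_induct)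
  case empty
  have "realized 0 m n"
    unfolding realized_def by (rule exI[of _ "zer m n"]) (simp add: mat_of_zer)
  then show ?case unfolding sum.empty .
next
  case (insert s S)
  then show ?case unfolding sum.insert[OF insert(1,2)] by (intro realized_add) auto
qed

lemma realized_mm: "arr f \<Longrightarrow> realized K (cd f) n \<Longrightarrow> realized (mm (cd f) (mat_of f) K) (dm f) n"
  unfolding realized_def by (elim exE, rule_tac x = "fa * f" in exI) (auto simp: mat_of_mm)

lemma mm_idn:
  assumes "\<And>b d. b \<notin> B_words m \<Longrightarrow> K b d = 0"
  shows "mm m (mat_of (idn m)) K = K"
proof (intro ext)
  fix b d
  have "mm m (mat_of (idn m)) K b d = (\<Sum>c\<in>B_words m. if b = c then K b d else 0)"
    unfolding mm_def mat_of_idn using assms by (intro sum.cong) auto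
  then show "mm m (mat_of (idn m)) K b d = K b d" using assms[of b d] by simp
qed

text \<open>Counterpart of \<open>eq_if_eq_on_hw_mor\<close> for a matrix that is not yet known to
  come from a diagram: precomposition is matrix multiplication, and the coefficients of
  \<open>hw_mor_split\<close> assemble a diagram from those of the extended words.\<close>

lemma realized_if_realized_on_hw_mor:
  fixes K :: "letter list \<Rightarrow> letter list \<Rightarrow> 'k::field"
  assumes "\<And>b d. b \<notin> B_words (m + p) \<Longrightarrow> K b d = 0"
    and "\<And>r. hw r \<Longrightarrow> length r = m \<Longrightarrow> realized (mm (m + p) (mat_of (hw_mor r \<odot> idn p)) K) (height r + p) n"
  shows "realized K (m + p) n"
  using assms
proof (induction m arbitrary: p)
  case 0
  have "mm p (mat_of (idn p)) K = K" using "0.prems"(1) by (intro mm_idn) simp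
  then show ?case using "0.prems"(2)[of "[]"] by simp
next
  case (Suc m)
  have "realized K (m + Suc p) n"
  proof (rule Suc.IH)
    fix b d assume "b \<notin> B_words (m + Suc p)"
    then show "K b d = 0" using Suc.prems(1) by simp
  next
    fix r assume r: "hw r" "length r = m"
    let ?q = "m + Suc p"
    obtain A where A: "arr A" "dm A = Suc (height r) + p" "cd A = height r + p"
      "height r = 0 \<Longrightarrow> hw_mor r \<odot> idn (Suc p) = (hw_mor ((Suc 0, 0) # r) \<odot> idn p) * A + (hw_mor ((0, 0) # r) \<odot> (idn p :: 'k::field mo))"
      "\<And>l. height r = Suc l \<Longrightarrow> \<exists>C :: 'k mo. arr C \<and> dm C = Suc (height r) + p \<and> cd C = l + p \<and>
        hw_mor r \<odot> idn (Suc p) = (hw_mor ((Suc 0, 0) # r) \<odot> idn p) * A + ((hw_mor ((0, 0) # r) \<odot> idn p) + (hw_mor ((0, Suc 0) # r) \<odot> idn p) * C)"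
      using hw_mor_split[OF r(1), of p, where 'k = 'k] by metis
    let ?hw_mor = "\<lambda>x. hw_mor (x # r) \<odot> (idn p :: 'k mo)"
    have hw_mor: "realized (mm ?q (mat_of (?hw_mor x)) K) (height (x # r) + p) n" if "hw (x # r)" for x
      using Suc.prems(2)[of "x # r"] that r by simp
    have comp: "realized (mm ?q (mat_of (?hw_mor x * C)) K) (dm C) n"
      if "hw (x # r)" "arr C" "cd C = height (x # r) + p" for x C
    proof -
      have "mat_of (?hw_mor x * C) = mm (cd C) (mat_of C) (mat_of (?hw_mor x))"
        using that by (intro mat_of_mm) simp_all
      then have "mm ?q (mat_of (?hw_mor x * C)) K = mm (cd C) (mat_of C) (mm ?q (mat_of (?hw_mor x)) K)"
        by (simp add: mm_assoc)
      then show ?thesis using realized_mm[OF that(2)] hw_mor[OF that(1)] that(3) by simp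
    qed
    have O: "realized (mm ?q (mat_of (?hw_mor (Suc 0, 0) * A)) K) (height r + Suc p) n"
      using comp[of "(Suc 0, 0)" A] r A(1-3) by (simp del: hw_mor_simps)
    have P: "realized (mm ?q (mat_of (?hw_mor (0, 0))) K) (height r + Suc p) n"
      using hw_mor[of "(0, 0)"] r by (simp del: hw_mor_simps)
    show "realized (mm ?q (mat_of (hw_mor r \<odot> idn (Suc p))) K) (height r + Suc p) n"
    proof (cases "height r")
      case 0
      have "mat_of (hw_mor r \<odot> (idn (Suc p) :: 'k mo)) = mat_of (?hw_mor (Suc 0, 0) * A) + mat_of (?hw_mor (0, 0))"
        unfolding A(4)[OF 0] using A(1-3) r 0 by (intro mat_of_add) simp_all
      then show ?thesis
        using realized_add[OF O P] by (simp only: mm_linear)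
    next
      case (Suc l)
      then obtain C where C: "arr C" "dm C = Suc (height r) + p" "cd C = l + p"
        "hw_mor r \<odot> idn (Suc p) = ?hw_mor (Suc 0, 0) * A + (?hw_mor (0, 0) + ?hw_mor (0, Suc 0) * C)"
        using A(5) by blast
      have "mat_of (hw_mor r \<odot> (idn (Suc p) :: 'k mo)) = mat_of (?hw_mor (Suc 0, 0) * A) + mat_of (?hw_mor (0, 0) + ?hw_mor (0, Suc 0) * C)"
        unfolding C(4) using A(1-3) C(1-3) r Suc by (intro mat_of_add) simp_all
      also have "mat_of (?hw_mor (0, 0) + ?hw_mor (0, Suc 0) * C) = mat_of (?hw_mor (0, 0)) + mat_of (?hw_mor (0, Suc 0) * C)"
        using A(1-3) C(1-3) r Suc by (intro mat_of_add) simp_all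
      finally have mat_of: "mat_of (hw_mor r \<odot> (idn (Suc p) :: 'k mo)) =
        mat_of (?hw_mor (Suc 0, 0) * A) + (mat_of (?hw_mor (0, 0)) + mat_of (?hw_mor (0, Suc 0) * C))" .
      have "realized (mm ?q (mat_of (?hw_mor (0, Suc 0) * C)) K) (height r + Suc p) n"
        using comp[of "(0, Suc 0)" C] r C(1-3) Suc by (simp del: hw_mor_simps)
      from realized_add[OF O realized_add[OF P this]] show ?thesis
        unfolding mat_of mm_linear .
    qed
  qed
  then show ?case by simp
qed

definition hw_set :: "nat \<Rightarrow> nat \<Rightarrow> letter list set" where
  "hw_set k n = {r. hw r \<and> height r = k \<and> length r = n}"

lemma finite_hw_set: "finite (hw_set k n)"
proof (rule finite_subset)
  show "hw_set k n \<subseteq> rev ` B_words n"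
    using rev_in_B_words unfolding hw_set_def by force
qed simp

text \<open>The difference of both sides is a crystal map supported on the string rows, so by
  \<open>CM_eq_0\<close> it is enough to compare the rows of
  \<open>plus_word (height r)\<close>.\<close>

lemma mm_hw_mor:
  fixes M :: "letter list \<Rightarrow> letter list \<Rightarrow> 'k::field"
  assumes M: "M \<in> CM m n" and r: "hw r" "length r = m"
  shows "mm m (mat_of (hw_mor r)) M = (\<Sum>s\<in>hw_set (height r) n. mat_scale (M (rev r) (rev s)) (mat_of (hw_mor s)))"
proof -
  let ?k = "height r"
  let ?S = "\<Sum>s\<in>hw_set ?k n. mat_scale (M (rev r) (rev s)) (mat_of (hw_mor s :: 'k mo))"
  have hw_mor: "mat_of (hw_mor s :: 'k mo) \<in> CM ?k n" if "s \<in> hw_set ?k n" for s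
    using mat_of_in_CM[of "hw_mor s :: 'k mo"] that unfolding hw_set_def by simp
  have "mm m (mat_of (hw_mor r)) M - ?S \<in> CM ?k n"
  proof (rule CM_diff)
    show "mm m (mat_of (hw_mor r)) M \<in> CM ?k n"
      using CM_mm[OF _ M] mat_of_in_CM[of "hw_mor r :: 'k mo"] r by simp
    show "?S \<in> CM ?k n"
      by (rule CM_sum, rule CM_scale, rule hw_mor)
  qed
  moreover have "(mm m (mat_of (hw_mor r)) M - ?S) b d = 0" if "b \<notin> string_words ?k" for b d
  proof -
    have "mat_of (hw_mor s :: 'k mo) b d = 0" if "s \<in> hw_set ?k n" for s
      using mat_of_hw_mor_string[of s b d] that \<open>b \<notin> string_words ?k\<close> unfolding hw_set_def by simp
    then show ?thesis
      by (simp add: mat_of_hw_mor_string[OF r(1) that] mm_def mat_scale_def sum_fun_apply2)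
  qed
  moreover have "(mm m (mat_of (hw_mor r)) M - ?S) (plus_word ?k) d = 0" for d
  proof -
    have 1: "mm m (mat_of (hw_mor r)) M (plus_word ?k) d = M (rev r) d"
    proof -
      have "mm m (mat_of (hw_mor r)) M (plus_word ?k) d = (\<Sum>c\<in>B_words m. if c = rev r then M (rev r) d else 0)"
        unfolding mm_def mat_of_hw_mor_plus[OF r(1)] by (intro sum.cong) auto
      then show ?thesis using rev_in_B_words[OF r(1)] r(2) by simp
    qed
    have "?S (plus_word ?k) d = (\<Sum>s\<in>hw_set ?k n. if s = rev d then M (rev r) d else 0)"
      unfolding sum_fun_apply2
    proof (intro sum.cong HOL.refl)
      fix s assume "s \<in> hw_set ?k n"
      then have "hw s" "height s = ?k" unfolding hw_set_def by auto
      then show "mat_scale (M (rev r) (rev s)) (mat_of (hw_mor s)) (plus_word ?k) d = (if s = rev d then M (rev r) d else 0)"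
        using mat_of_hw_mor_plus[of s d, where 'k = 'k] by (auto simp: mat_scale_def)
    qed
    \<comment> \<open>The index \<open>rev d\<close> lies in the summation range if the entry is
      nonzero, because \<open>M\<close> preserves weights and sends highest weight words to such
      words. Otherwise both sides are 0.\<close>
    also have "\<dots> = M (rev r) d"
    proof (cases "M (rev r) d = 0")
      case False
      have "epsw (rev r) = 0" "wtw (rev r) = int ?k"
        using hw_iff[OF hw_letters[OF r(1)]] r(1) by auto
      moreover from False have d: "d \<in> B_words n" "wtw d = wtw (rev r)"
        using CM_wt[OF M False] by auto
      ultimately have "epsw d = 0" "wtw d = int ?k"
        using CM_hw[OF M _ False] by auto
      moreover have "set (rev d) \<subseteq> {(0, 0), (0, 1), (1, 0)}" "length d = n"
        using d(1) unfolding B_words_iff by auto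
      ultimately have "rev d \<in> hw_set ?k n"
        using hw_iff[of "rev d"] unfolding hw_set_def by auto
      then show ?thesis using finite_hw_set by simp
    next
      case True
      then show ?thesis by (simp only: if_cancel sum.neutral_const)
    qed
    finally show ?thesis using 1 by simp
  qed
  ultimately have "(mm m (mat_of (hw_mor r)) M - ?S) b d = 0" for b d
    by (rule CM_eq_0)
  then show ?thesis by (simp add: fun_eq_iff)
qed

text \<open>Fullness. Composing with any \<open>hw_mor r\<close> gives a combination of morphisms
  \<open>hw_mor s\<close>, which come from diagrams, and such composites determine the
  matrix.\<close>

theorem realized_CM:
  assumes M: "M \<in> CM m n"
  shows "realized M m n"
proof -
  have "realized M (m + 0) n"
  proof (rule realized_if_realized_on_hw_mor)
    fix b d assume "b \<notin> B_words (m + 0)"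
    then show "M b d = 0" using CM_wt[OF M, of b d] by auto
  next
    fix r assume r: "hw r" "length r = m"
    have "realized (mm m (mat_of (hw_mor r)) M) (height r) n"
      unfolding mm_hw_mor[OF M r]
    proof (rule realized_sum[OF finite_hw_set], rule realized_scale)
      fix s assume "s \<in> hw_set (height r) n"
      then show "realized (mat_of (hw_mor s)) (height r) n"
        unfolding hw_set_def realized_def by (auto intro!: exI[of _ "hw_mor s"])
    qed
    then show "realized (mm (m + 0) (mat_of (hw_mor r \<odot> idn 0)) M) (height r + 0) n" by simp
  qed
  then show ?thesis by simp
qed

section \<open>Faithfulness\<close>

text \<open>Combinations are spelled out along a list because the type \<open>'k mo\<close> has a
  different zero for each pair of objects, so that set-indexed sums and spans do not apply to
  it.\<close>

primrec hw_mor_comb :: "nat \<Rightarrow> nat \<Rightarrow> letter list list \<Rightarrow> 'k::field mo \<Rightarrow> bool" where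
  "hw_mor_comb k n [] z \<longleftrightarrow> z = zer k n"
| "hw_mor_comb k n (r # rs) z \<longleftrightarrow> (\<exists>a y. hw_mor_comb k n rs y \<and> z = a \<bullet> hw_mor r + y)"

lemma hw_mor_comb_type:
  "set rs \<subseteq> hw_set k n \<Longrightarrow> hw_mor_comb k n rs z \<Longrightarrow> arr z \<and> dm z = k \<and> cd z = n"
  by (induction rs arbitrary: z) (auto simp: hw_set_def)

lemma hw_mor_comb_zer: "set rs \<subseteq> hw_set k n \<Longrightarrow> hw_mor_comb k n rs (zer k n)"
proof (induction rs)
  case (Cons r rs)
  then have "zer k n = 0 \<bullet> hw_mor r + zer k n" by (auto simp: scale_0 hw_set_def)
  with Cons show ?case by auto
qed simp

lemma hw_mor_comb_hw_mor: "set rs \<subseteq> hw_set k n \<Longrightarrow> r \<in> set rs \<Longrightarrow> hw_mor_comb k n rs (hw_mor r :: 'k::field mo)"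
proof (induction rs)
  case (Cons s rs)
  show ?case
  proof (cases "r = s")
    case True
    then have "hw_mor r = 1 \<bullet> hw_mor s + (zer k n :: 'k mo)" using Cons.prems by (simp add: hw_set_def)
    moreover have "hw_mor_comb k n rs (zer k n :: 'k mo)" using hw_mor_comb_zer[of rs k n] Cons.prems by simp
    ultimately show ?thesis unfolding hw_mor_comb.simps by blast
  next
    case False
    then have "hw_mor_comb k n rs (hw_mor r :: 'k mo)" using Cons by simp
    moreover have "hw_mor r = 0 \<bullet> hw_mor s + (hw_mor r :: 'k mo)"
      using Cons.prems by (auto simp: hw_set_def scale_0)
    ultimately show ?thesis unfolding hw_mor_comb.simps by blast
  qed
qed simp

lemma hw_mor_comb_add: "hw_mor_comb k n rs y \<Longrightarrow> hw_mor_comb k n rs z \<Longrightarrow> hw_mor_comb k n rs (y + z)"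
proof (induction rs arbitrary: y z)
  case (Cons r rs)
  then obtain a y' b z' where "hw_mor_comb k n rs y'" "y = a \<bullet> hw_mor r + y'" "hw_mor_comb k n rs z'" "z = b \<bullet> hw_mor r + z'"
    by auto
  moreover from this have "y + z = (a + b) \<bullet> hw_mor r + (y' + z')"
    by (simp add: scale_plus ac_simps)
  ultimately show ?case using Cons.IH by auto
qed simp

lemma hw_mor_comb_scale: "hw_mor_comb k n rs z \<Longrightarrow> hw_mor_comb k n rs (a \<bullet> z)"
proof (induction rs arbitrary: z)
  case (Cons r rs)
  then obtain b z' where "hw_mor_comb k n rs z'" "z = b \<bullet> hw_mor r + z'" by auto
  moreover from this have "a \<bullet> z = (a * b) \<bullet> hw_mor r + a \<bullet> z'"
    by (simp add: scale_add scale_scale)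
  ultimately show ?case using Cons.IH by auto
qed simp

lemma hw_mor_comb_comp:
  assumes X: "arr X" "dm X = n" "cd X = n'" and rs: "set rs \<subseteq> hw_set k n" and rs': "set rs' \<subseteq> hw_set k n'"
    and hw_mor: "\<And>r. r \<in> set rs \<Longrightarrow> hw_mor_comb k n' rs' (X * hw_mor r)"
  shows "hw_mor_comb k n rs z \<Longrightarrow> hw_mor_comb k n' rs' (X * z)"
  using rs hw_mor
proof (induction rs arbitrary: z)
  case Nil
  then show ?case using X hw_mor_comb_zer[OF rs'] by simp
next
  case (Cons r rs)
  then obtain a y where "hw_mor_comb k n rs y" "z = a \<bullet> hw_mor r + y" by auto
  moreover from this have "X * z = a \<bullet> (X * hw_mor r) + X * y"
    by (simp add: distrib_left scale_comp)
  ultimately show ?case using Cons by (auto intro!: hw_mor_comb_add hw_mor_comb_scale)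
qed

lemma mat_of_hw_mor_comb:
  fixes z :: "'k::field mo"
  shows "set rs \<subseteq> hw_set k n \<Longrightarrow> hw_mor_comb k n rs z \<Longrightarrow> s \<in> hw_set k n \<Longrightarrow> s \<notin> set rs \<Longrightarrow>
    mat_of z (plus_word k) (rev s) = 0"
proof (induction rs arbitrary: z)
  case Nil
  then show ?case by (simp add: mat_of_zer)
next
  case (Cons r rs)
  then obtain a y where y: "hw_mor_comb k n rs y" "z = a \<bullet> hw_mor r + y" by auto
  have r: "hw r" "height r = k" "length r = n" using Cons.prems by (auto simp: hw_set_def)
  have "arr y \<and> dm y = k \<and> cd y = n" using hw_mor_comb_type[OF _ y(1)] Cons.prems(1) by simp
  then have "mat_of z = mat_scale a (mat_of (hw_mor r)) + mat_of y"
    using r unfolding y(2) by (simp add: mat_of_add mat_of_scale)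
  moreover have "mat_of y (plus_word k) (rev s) = 0"
    using Cons.IH[OF _ y(1)] Cons.prems by simp
  moreover have "mat_of (hw_mor r :: 'k mo) (plus_word k) (rev s) = 0"
    using mat_of_hw_mor_plus[OF r(1), of "rev s", where 'k = 'k] Cons.prems(4) r by auto
  ultimately show ?case by (simp add: mat_scale_def)
qed

text \<open>Row \<open>plus_word k\<close> of \<open>mat_of (hw_mor s)\<close> is the unit vector at
  \<open>rev s\<close>, so the entry at \<open>rev r\<close> reads off the coefficient of
  \<open>hw_mor r\<close>.\<close>

lemma hw_mor_comb_unique:
  "distinct rs \<Longrightarrow> set rs \<subseteq> hw_set k n \<Longrightarrow> hw_mor_comb k n rs y \<Longrightarrow> hw_mor_comb k n rs z \<Longrightarrow> mat_of y = mat_of z \<Longrightarrow> y = z"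
proof (induction rs arbitrary: y z)
  case (Cons r rs)
  then obtain a y' b z' where yz: "hw_mor_comb k n rs y'" "y = a \<bullet> hw_mor r + y'" "hw_mor_comb k n rs z'" "z = b \<bullet> hw_mor r + z'"
    by auto
  have r: "hw r" "height r = k" "length r = n" "r \<in> hw_set k n" using Cons.prems by (auto simp: hw_set_def)
  have rs: "set rs \<subseteq> hw_set k n" "r \<notin> set rs" using Cons.prems by auto
  have mat_of: "mat_of y = mat_scale a (mat_of (hw_mor r)) + mat_of y'" "mat_of z = mat_scale b (mat_of (hw_mor r)) + mat_of z'"
    using hw_mor_comb_type[OF rs(1) yz(1)] hw_mor_comb_type[OF rs(1) yz(3)] r unfolding yz(2,4)
    by (simp_all add: mat_of_add mat_of_scale)
  have "mat_of y (plus_word k) (rev r) = a" "mat_of z (plus_word k) (rev r) = b"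
    using mat_of_hw_mor_comb[OF rs(1) yz(1) r(4) rs(2)] mat_of_hw_mor_comb[OF rs(1) yz(3) r(4) rs(2)]
    unfolding mat_of by (simp_all add: mat_scale_def mat_of_hw_mor_plus[OF r(1), unfolded r(2)])
  then have "a = b" using Cons.prems by simp
  with mat_of Cons.prems(5) have "mat_of y' = mat_of z'" by (metis add_left_cancel)
  with Cons yz rs \<open>a = b\<close> show ?case by auto
qed simp

definition hw_list :: "nat \<Rightarrow> nat \<Rightarrow> letter list list" where
  "hw_list k n = (SOME rs. set rs = hw_set k n \<and> distinct rs)"

lemma hw_list: "set (hw_list k n) = hw_set k n" "distinct (hw_list k n)"
  using someI_ex[OF finite_distinct_list[OF finite_hw_set[of k n]]] unfolding hw_list_def by blast+

text \<open>The monomial action of the generators is weakened to membership in a span, which unlike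
  \<open>act\<close> survives sums and scalar multiples.\<close>

lemma comp_hw_mor_comb:
  fixes X :: "'k::field mo"
  assumes "arr X" "hw r" "length r = dm X"
  shows "hw_mor_comb (height r) (cd X) (hw_list (height r) (cd X)) (X * hw_mor r)"
  using assms
proof (induction arbitrary: r rule: mo_whisker_induct)
  case (gen a x b)
  let ?X = "idn a \<odot> gen x \<odot> (idn b :: 'k mo)"
  have "act ?X r"
    using gen by (intro act_gen) (simp_all add: add.assoc)
  then show ?case
    unfolding act_def
  proof (elim disjE exE conjE)
    assume "?X * hw_mor r = zer (height r) (cd ?X)"
    then show ?thesis
      using hw_mor_comb_zer[of "hw_list (height r) (cd ?X)" "height r" "cd ?X"] hw_list(1) by simp
  next
    fix s assume "hw s" "height s = height r" "length s = cd ?X" "?X * hw_mor r = hw_mor s"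
    then show ?thesis
      using hw_mor_comb_hw_mor[of "hw_list (height r) (cd ?X)" "height r" "cd ?X" s]
      by (simp add: hw_list hw_set_def)
  qed
next
  case (idn n)
  have "hw_mor_comb (height r) n (hw_list (height r) n) (hw_mor r :: 'k mo)"
    by (rule hw_mor_comb_hw_mor) (use idn in \<open>simp_all add: hw_list hw_set_def\<close>)
  then show ?case using idn by simp
next
  case (comp f g)
  have "hw_mor_comb (height r) (cd g) (hw_list (height r) (cd g)) (g * (f * hw_mor r))"
  proof (rule hw_mor_comb_comp[OF comp(2) _ HOL.refl])
    show "dm g = cd f" using comp by simp
    show "hw_mor_comb (height r) (cd f) (hw_list (height r) (cd f)) (f * hw_mor r)" using comp by simp
    fix s assume "s \<in> set (hw_list (height r) (cd f))"
    then show "hw_mor_comb (height r) (cd g) (hw_list (height r) (cd g)) (g * hw_mor s)"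
      using comp(5)[of s] comp(3) by (auto simp: hw_list hw_set_def)
  qed (simp_all add: hw_list)
  then show ?case by (simp add: mult.assoc)
next
  case (zer m n)
  then show ?case by (simp add: hw_mor_comb_zer hw_list)
next
  case (add f g)
  then show ?case by (simp add: distrib_right hw_mor_comb_add)
next
  case (scale a f)
  then show ?case by (simp add: scale_comp hw_mor_comb_scale)
qed

text \<open>Faithfulness. It suffices to compare \<open>f\<close> and \<open>g\<close> on each
  \<open>hw_mor r\<close>; there both are combinations of the same independent family and have equal
  matrices.\<close>

theorem mat_of_inj:
  assumes "arr f" "arr g" "dm f = dm g" "cd f = cd g" "mat_of f = mat_of g"
  shows "f = g"
proof (rule eq_if_eq_on_hw_mor[of f "dm f" 0 g])
  fix r assume r: "hw r" "length r = dm f"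
  have "f * hw_mor r = g * hw_mor r"
  proof (rule hw_mor_comb_unique[OF hw_list(2)])
    show "hw_mor_comb (height r) (cd f) (hw_list (height r) (cd f)) (f * hw_mor r)"
      "hw_mor_comb (height r) (cd f) (hw_list (height r) (cd f)) (g * hw_mor r)"
      using comp_hw_mor_comb[OF assms(1) r] comp_hw_mor_comb[OF assms(2) r(1)] r assms(3,4) by simp_all
    show "mat_of (f * hw_mor r) = mat_of (g * hw_mor r)"
      using assms r by (simp add: mat_of_mm)
  qed (simp add: hw_list)
  then show "f * (hw_mor r \<odot> idn 0) = g * (hw_mor r \<odot> idn 0)" by simp
qed (use assms in simp_all)


section \<open>The isomorphism\<close>

lemma tensor_power_motzkin: "tensor_power sl2_Crys motzkin_B n = pw n"
  by (induction n) (simp_all add: tensor_power_def sl2_Crys_def motzkin_B_def pw_def)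

lemma CrysMo_Mat: "CrysMo = (Mat :: (nat list list, 'k::field crystal_mor, 'k) linear_monoidal)
    \<lparr>Obj := range pw, Hom := \<lambda>v w. (\<lambda>M. (v, w, M)) ` crystal_maps (word_crystal v) (word_crystal w)\<rparr>"
proof -
  have "range (tensor_power (sl2_Crys :: (_, 'k crystal_mor, 'k) linear_monoidal) motzkin_B) = range pw"
    using tensor_power_motzkin by auto
  moreover have "(\<lambda>v w. {(v, w, M) | M. M \<in> crystal_maps (word_crystal v) (word_crystal w)}) =
    (\<lambda>v w. (\<lambda>M :: letter list \<Rightarrow> letter list \<Rightarrow> 'k. (v, w, M)) ` crystal_maps (word_crystal v) (word_crystal w))"
    by (auto simp: fun_eq_iff)
  ultimately show ?thesis
    unfolding CrysMo_def full_on_def Mat_def by (simp add: sl2_Crys_def)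
qed

lemma CrysMo_Hom_iff:
  "X \<in> (\<lambda>M. (pw m, pw n, M)) ` CM m n \<longleftrightarrow> (\<exists>f. arr f \<and> dm f = m \<and> cd f = n \<and> X = crys_of f)"
proof
  assume "X \<in> (\<lambda>M. (pw m, pw n, M)) ` CM m n"
  then obtain M where M: "X = (pw m, pw n, M)" "M \<in> CM m n" by auto
  from realized_CM[OF M(2)] obtain f where "arr f" "dm f = m" "cd f = n" "mat_of f = M"
    unfolding realized_def by auto
  with M crys_of_eq[of f] show "\<exists>f. arr f \<and> dm f = m \<and> cd f = n \<and> X = crys_of f" by auto
next
  assume "\<exists>f. arr f \<and> dm f = m \<and> cd f = n \<and> X = crys_of f"
  then obtain f where "arr f" "dm f = m" "cd f = n" "X = crys_of f" by auto
  with crys_of_eq[of f] mat_of_in_CM[of f] show "X \<in> (\<lambda>M. (pw m, pw n, M)) ` CM m n" by auto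
qed

lemma crys_of_inj:
  assumes "arr f" "arr g" "dm f = dm g" "cd f = cd g" "crys_of f = crys_of g"
  shows "f = g"
  using mat_of_inj[OF assms(1-4)] assms(5) by (simp add: mat_of_def)

text \<open>By fullness the hom-sets consist of the values of \<open>crys_of\<close>, so closure
  under composition, tensor product and linear operations is inherited from diagrams.\<close>

lemma strict_linear_monoidal_category_CrysMo:
  "strict_linear_monoidal_category (CrysMo :: (nat list list, 'k::field crystal_mor, 'k) linear_monoidal)"
proof -
  define hom :: "nat \<Rightarrow> nat \<Rightarrow> 'k crystal_mor set" where
    "hom m n = {crys_of f | f. arr f \<and> dm f = m \<and> cd f = n}" for m n
  let ?H = "\<lambda>v w. (\<lambda>M :: letter list \<Rightarrow> letter list \<Rightarrow> 'k. (v, w, M)) ` crystal_maps (word_crystal v) (word_crystal w)"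
  have H: "?H (pw m) (pw n) = hom m n" for m n
    unfolding hom_def using CrysMo_Hom_iff[of _ m n ] by blast
  have closed: "Ident Mat (pw n) \<in> hom n n" "Zero Mat (pw m) (pw n) \<in> hom m n"
    "\<lbrakk>X \<in> hom m n; Y \<in> hom n p\<rbrakk> \<Longrightarrow> Comp Mat Y X \<in> hom m p"
    "\<lbrakk>X \<in> hom m n; Z \<in> hom m' n'\<rbrakk> \<Longrightarrow> TensM Mat X Z \<in> hom (m + m') (n + n')"
    "\<lbrakk>X \<in> hom m n; X' \<in> hom m n\<rbrakk> \<Longrightarrow> Add Mat X X' \<in> hom m n"
    "X \<in> hom m n \<Longrightarrow> Scale Mat a X \<in> hom m n" for m n p m' n' X Y Z X' a
  proof -
    show "Ident Mat (pw n) \<in> hom n n"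
      unfolding hom_def by (intro CollectI exI[of _ "idn n"]) (simp add: crys_of_ops)
    show "Zero Mat (pw m) (pw n) \<in> hom m n"
      unfolding hom_def by (intro CollectI exI[of _ "zer m n"]) (simp add: crys_of_ops)
    show "\<lbrakk>X \<in> hom m n; Y \<in> hom n p\<rbrakk> \<Longrightarrow> Comp Mat Y X \<in> hom m p"
      unfolding hom_def by clarify (metis crys_of_ops(1) arr_simps(1) dm_simps(1) cd_simps(1))
    show "\<lbrakk>X \<in> hom m n; Z \<in> hom m' n'\<rbrakk> \<Longrightarrow> TensM Mat X Z \<in> hom (m + m') (n + n')"
      unfolding hom_def by clarify (metis crys_of_ops(2) arr_simps(2) dm_simps(2) cd_simps(2))
    show "\<lbrakk>X \<in> hom m n; X' \<in> hom m n\<rbrakk> \<Longrightarrow> Add Mat X X' \<in> hom m n"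
      unfolding hom_def by clarify (metis crys_of_ops(3) arr_simps(3) dm_simps(3) cd_simps(3) max.idem)
    show "X \<in> hom m n \<Longrightarrow> Scale Mat a X \<in> hom m n"
      unfolding hom_def by clarify (metis crys_of_ops(4) arr_simps(5) dm_simps(5) cd_simps(5))
  qed
  have tens: "TensO Mat (pw m) (pw n) = pw (m + n)" for m n by (simp add: pw_append)
  have "hom m n \<subseteq> Hom Mat (pw m) (pw n)" for m n
    unfolding hom_def using crys_of_in_Hom by auto
  then show ?thesis
    unfolding CrysMo_Mat
  proof (intro Mat.subcategory)
    show "range pw \<subseteq> Obj Mat" by simp
    show "Unit Mat \<in> range pw" by (rule range_eqI[of _ _ 0]) (simp add: pw_def)
  qed (elim rangeE, hypsubst, unfold H tens, (intro closed rangeI | assumption)+)+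
qed

definition to_CrysMo :: "'k::field tm set \<Rightarrow> 'k crystal_mor" where
  "to_CrysMo X = ev (SOME t. t \<in> X)"

abbreviation mo_class :: "'k::field tm \<Rightarrow> 'k tm set" where
  "mo_class \<equiv> term_class mo_dom mo_cod mo_relations"

lemma to_CrysMo_class: "mo_type x y t \<Longrightarrow> to_CrysMo (mo_class t) = ev t"
proof -
  assume t: "mo_type x y t"
  then have "(SOME s. s \<in> mo_class t) \<in> mo_class t"
    using term_class_selfI by (metis someI)
  then have "mo_eq x y t (SOME s. s \<in> mo_class t)"
    using mem_term_class[OF t] by blast
  then show ?thesis
    unfolding to_CrysMo_def using mo_equiv_ev[OF mo_equivI] mo_eq_typed by metis
qed

text \<open>On typed terms \<open>mo_equiv\<close> is \<open>term_eq\<close>, so the quotient type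
  and the classes of \<open>presented_category\<close> carry the same morphisms. Injectivity is then
  faithfulness.\<close>

lemma bij_betw_to_CrysMo:
  "bij_betw to_CrysMo (mo_class ` {t. mo_type x y t}) {crys_of f | f :: 'k::field mo. arr f \<and> dm f = length x \<and> cd f = length y}"
  unfolding bij_betw_def
proof
  show "inj_on to_CrysMo (mo_class ` {t :: 'k tm. mo_type x y t})"
  proof (rule inj_onI)
    fix X Y assume X: "X \<in> mo_class ` {t. mo_type x y t}" and Y: "Y \<in> mo_class ` {t. mo_type x y t}"
      and XY: "to_CrysMo X = to_CrysMo Y"
    then obtain s t where st: "mo_type x y s" "mo_type x y t" and [simp]: "X = mo_class s" "Y = mo_class t"
      by auto
    note eq = XY[simplified]
    from st
    have ty: "typed s" "typed t" "tdom s = tdom t" "tcod s = tcod t" unfolding mo_type_iff by auto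
    have "crys_of (abs_mo s) = crys_of (abs_mo t)"
      using eq ty to_CrysMo_class[OF st(1)] to_CrysMo_class[OF st(2)] by simp
    then have "abs_mo s = abs_mo t"
      using ty by (intro crys_of_inj) (simp_all add: arr.abs_eq dm.abs_eq cd.abs_eq)
    then have "mo_equiv s t" by (simp add: mo.abs_eq_iff)
    then have "mo_eq (word (tdom s)) (word (tcod s)) s t"
      using ty unfolding mo_equiv_def by blast
    then have "mo_class s = mo_class t" by (rule term_class_eqI)
    then show "X = Y" by simp
  qed
  show "to_CrysMo ` (mo_class ` {t. mo_type x y t}) = {crys_of f | f :: 'k mo. arr f \<and> dm f = length x \<and> cd f = length y}"
  proof (intro equalityI subsetI)
    fix X :: "'k crystal_mor" assume "X \<in> to_CrysMo ` (mo_class ` {t :: 'k tm. mo_type x y t})"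
    then obtain t where t: "mo_type x y t" "X = to_CrysMo (mo_class t)" by auto
    then have "X = crys_of (abs_mo t)" using to_CrysMo_class[OF t(1)] unfolding mo_type_iff by simp
    moreover have "arr (abs_mo t) \<and> dm (abs_mo t) = length x \<and> cd (abs_mo t) = length y"
      using t(1) unfolding mo_type_iff by (simp add: arr.abs_eq dm.abs_eq cd.abs_eq)
    ultimately show "X \<in> {crys_of f | f. arr f \<and> dm f = length x \<and> cd f = length y}" by blast
  next
    fix X :: "'k crystal_mor" assume "X \<in> {crys_of f | f. arr f \<and> dm f = length x \<and> cd f = length y}"
    then obtain f :: "'k mo" where f: "X = crys_of f" "arr f" "dm f = length x" "cd f = length y" by auto
    obtain t where t: "f = abs_mo t" "typed t" "tdom t = dm f" "tcod t = cd f"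
      using f(2) by (rule arr_cases)
    then have "mo_type x y t" using f unfolding mo_type_iff by simp
    moreover from this have "X = to_CrysMo (mo_class t)"
      using to_CrysMo_class[OF \<open>mo_type x y t\<close>] f t by simp
    ultimately show "X \<in> to_CrysMo ` (mo_class ` {t :: 'k tm. mo_type x y t})" by blast
  qed
qed

theorem proposition4p5p1:
  shows "\<exists>Fo Fm.
    strict_linear_monoidal_isomorphism
      (presented_category mo_dom mo_cod mo_relations)
      (CrysMo :: (nat list list, 'k::field crystal_mor, 'k) linear_monoidal) Fo Fm
    \<and> Fo [()] = motzkin_B"
proof (intro exI conjI)
  let ?Fo = "\<lambda>w :: unit list. pw (length w)"
  let ?P = "presented_category mo_dom mo_cod mo_relations :: (unit list, 'k tm set, 'k) linear_monoidal"
  let ?C = "CrysMo :: (nat list list, 'k crystal_mor, 'k) linear_monoidal"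
  show "?Fo [()] = motzkin_B" by (simp add: pw_def motzkin_B_def)
  have C: "Ident ?C = Ident Mat" "Comp ?C = Comp Mat" "Unit ?C = []" "TensO ?C = (@)"
    "TensM ?C = TensM Mat" "Add ?C = Add Mat" "Scale ?C = Scale Mat" "Obj ?C = range pw"
    unfolding CrysMo_Mat by simp_all
  \<comment> \<open>Fullness enters here: the span of the strict morphisms is replaced by the set of
    values of \<open>crys_of\<close>.\<close>
  have hom: "Hom ?C (pw m) (pw n) = {crys_of f | f. arr f \<and> dm f = m \<and> cd f = n}" for m n
  proof -
    have "(\<lambda>M. (pw m, pw n, M)) ` CM m n = {crys_of f :: 'k crystal_mor | f. arr f \<and> dm f = m \<and> cd f = n}"
      using CrysMo_Hom_iff[of _ m n] by blast
    then show ?thesis unfolding CrysMo_Mat by simp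
  qed
  interpret P: strict_linear_monoidal_category ?P
    by (rule strict_linear_monoidal_category_presented)
  interpret C: strict_linear_monoidal_category ?C
    by (rule strict_linear_monoidal_category_CrysMo)
  show "strict_linear_monoidal_isomorphism ?P ?C ?Fo to_CrysMo"
  proof
    have "inj ?Fo"
      by (rule injI) (metis length_pw word_length)
    moreover have "range ?Fo = range pw"
      by (auto intro!: image_eqI[of _ _ "word _"])
    ultimately show "bij_betw ?Fo (Obj ?P) (Obj ?C)"
      unfolding bij_betw_def C by simp
    fix x y z x' y' :: "unit list" and f g h :: "'k tm set" and a :: 'k
    show "bij_betw to_CrysMo (Hom ?P x y) (Hom ?C (?Fo x) (?Fo y))"
      unfolding hom using bij_betw_to_CrysMo by simp
    show "to_CrysMo (Ident ?P x) = Ident ?C (?Fo x)"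
      unfolding C using to_CrysMo_class[OF has_type.Id, of x]
      by (simp add: eval_object_Mat)
    show "?Fo (Unit ?P) = Unit ?C" unfolding C by (simp add: pw_def)
    show "?Fo (TensO ?P x y) = TensO ?C (?Fo x) (?Fo y)" unfolding C by (simp add: pw_append)
    show "to_CrysMo (Comp ?P g f) = Comp ?C (to_CrysMo g) (to_CrysMo f)"
      if fg: "f \<in> Hom ?P x y" "g \<in> Hom ?P y z"
    proof -
      obtain s t where st: "mo_type x y s" "f = mo_class s" "mo_type y z t" "g = mo_class t"
        using fg by auto
      then show ?thesis
        using to_CrysMo_class[OF has_type.Comp[OF st(1,3)]] by (simp add: C to_CrysMo_class)
    qed
    show "to_CrysMo (TensM ?P f g) = TensM ?C (to_CrysMo f) (to_CrysMo g)"
      if fg: "f \<in> Hom ?P x y" "g \<in> Hom ?P x' y'"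
    proof -
      obtain s t where st: "mo_type x y s" "f = mo_class s" "mo_type x' y' t" "g = mo_class t"
        using fg by auto
      then show ?thesis
        using to_CrysMo_class[OF has_type.Tens[OF st(1,3)]] by (simp add: C to_CrysMo_class)
    qed
    show "to_CrysMo (Add ?P f g) = Add ?C (to_CrysMo f) (to_CrysMo g)"
      if fg: "f \<in> Hom ?P x y" "g \<in> Hom ?P x y"
    proof -
      obtain s t where st: "mo_type x y s" "f = mo_class s" "mo_type x y t" "g = mo_class t"
        using fg by auto
      then show ?thesis
        using to_CrysMo_class[OF has_type.Add[OF st(1,3)]] by (simp add: C to_CrysMo_class)
    qed
    show "to_CrysMo (Scale ?P a f) = Scale ?C a (to_CrysMo f)"
      if fg: "f \<in> Hom ?P x y"
    proof -
      obtain s where st: "mo_type x y s" "f = mo_class s"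
        using fg by auto
      then show ?thesis
        using to_CrysMo_class[OF has_type.Scale[OF st(1)], of a] by (simp add: C to_CrysMo_class)
    qed
  qed
qed

end
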